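(* Let $k$ be an algebraically closed field, let $n$ and $d$ be positive integers with $d\mid n$, and let $\zeta\in k^*$ be a root of unity of order $d$. Then the variety $$\mathcal{V}=\{(x,y)\in GL_n(k)\times GL_n(k)\mid [x,y]=\zeta I\}$$ is irreducible of dimension $n^2+n/d$.
   Context: Here $[x,y]=x^{-1}y^{-1}xy$ is the group commutator and $I$ is the $n\times n$ identity matrix. The order of $\zeta$ is exactly $d$, i.e. $d$ is the least positive integer with $\zeta^d=1$. $\mathcal{V}$ is regarded as a Zariski closed subset of $GL_n(k)\times GL_n(k)$. *)

theory Defs
  imports
    "HOL-Library.Poly_Mapping"
    "HOL-Library.Extended_Nat"
    "HOL-Analysis.Abstract_Topology"
    "HOL-Computational_Algebra.Polynomial"
    "Jordan_Normal_Form.Matrix"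
begin

section \<open>Irreducible spaces and Krull dimension\<close>

definition irreducible_space :: "'a topology \<Rightarrow> bool" where
  "irreducible_space X \<longleftrightarrow> topspace X \<noteq> {} \<and>
     (\<forall>C D. closedin X C \<and> closedin X D \<and> topspace X = C \<union> D
        \<longrightarrow> C = topspace X \<or> D = topspace X)"

text \<open>The supremum of the lengths \<open>m\<close> of chains \<open>Z 0 \<subset> \<dots> \<subset> Z m\<close> of irreducible closed subsets.
  The empty space gets the value \<open>0\<close>.\<close>

definition krull_dim :: "'a topology \<Rightarrow> enat" where
  "krull_dim X = Sup {enat m | m. \<exists>Z :: nat \<Rightarrow> 'a set.
     (\<forall>i\<le>m. closedin X (Z i) \<and> irreducible_space (subtopology X (Z i))) \<and>
     (\<forall>i<m. Z i \<subset> Z (Suc i))}"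

section \<open>The Zariski topology on affine space\<close>

text \<open>A polynomial in variables indexed by \<open>'i\<close> is a finitely supported map from monomials
  (finitely supported exponent functions) to coefficients.\<close>

definition poly_eval :: "(('i \<Rightarrow>\<^sub>0 nat) \<Rightarrow>\<^sub>0 'a) \<Rightarrow> ('i \<Rightarrow> 'a) \<Rightarrow> 'a::comm_ring_1" where
  "poly_eval p v = (\<Sum>m\<in>Poly_Mapping.keys p. Poly_Mapping.lookup p m *
     (\<Prod>i\<in>Poly_Mapping.keys m. v i ^ Poly_Mapping.lookup m i))"

definition zero_locus :: "(('i \<Rightarrow>\<^sub>0 nat) \<Rightarrow>\<^sub>0 'a) set \<Rightarrow> ('i \<Rightarrow> 'a::comm_ring_1) set" where
  "zero_locus P = {v. \<forall>p\<in>P. poly_eval p v = 0}"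

definition zariski :: "('i \<Rightarrow> 'a::field) topology" where
  "zariski = topology (\<lambda>U. \<exists>P. U = - zero_locus P)"

lemma monom_eval_add:
  fixes v :: "'i \<Rightarrow> 'a::comm_ring_1" and a b :: "'i \<Rightarrow>\<^sub>0 nat"
  shows "(\<Prod>i\<in>Poly_Mapping.keys (a + b). v i ^ Poly_Mapping.lookup (a + b) i) =
    (\<Prod>i\<in>Poly_Mapping.keys a. v i ^ Poly_Mapping.lookup a i) *
    (\<Prod>i\<in>Poly_Mapping.keys b. v i ^ Poly_Mapping.lookup b i)"
proof -
  let ?K = "Poly_Mapping.keys a \<union> Poly_Mapping.keys b"
  have ext: "(\<Prod>i\<in>Poly_Mapping.keys c. v i ^ Poly_Mapping.lookup c i) =
      (\<Prod>i\<in>?K. v i ^ Poly_Mapping.lookup c i)" if "Poly_Mapping.keys c \<subseteq> ?K" for c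
    by (rule prod.mono_neutral_left) (use that in \<open>auto simp: in_keys_iff\<close>)
  show ?thesis
    using ext[of "a + b"] ext[of a] ext[of b] Poly_Mapping.keys_add[of a b]
    by (simp add: lookup_add power_add prod.distrib)
qed

lemma poly_eval_superset:
  assumes "finite K" "Poly_Mapping.keys p \<subseteq> K"
  shows "poly_eval p v = (\<Sum>m\<in>K. Poly_Mapping.lookup p m *
     (\<Prod>i\<in>Poly_Mapping.keys m. v i ^ Poly_Mapping.lookup m i))"
  unfolding poly_eval_def
  by (rule sum.mono_neutral_left) (use assms in \<open>auto simp: in_keys_iff\<close>)

lemma poly_eval_add: "poly_eval (p + q) v = poly_eval p v + poly_eval q v"
proof -
  let ?K = "Poly_Mapping.keys p \<union> Poly_Mapping.keys q"
  have "Poly_Mapping.keys (p + q) \<subseteq> ?K" by (rule Poly_Mapping.keys_add)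
  then show ?thesis
    by (simp add: poly_eval_superset[of ?K] lookup_add algebra_simps sum.distrib)
qed

lemma poly_eval_zero [simp]: "poly_eval 0 v = 0"
  by (simp add: poly_eval_def)

lemma poly_eval_one [simp]: "poly_eval 1 v = 1"
  by (simp add: poly_eval_def)

lemma poly_eval_single:
  "poly_eval (Poly_Mapping.single m c) v =
     c * (\<Prod>i\<in>Poly_Mapping.keys m. v i ^ Poly_Mapping.lookup m i)"
  by (simp add: poly_eval_def)

lemma poly_eval_sum: "poly_eval (sum f A) v = (\<Sum>x\<in>A. poly_eval (f x) v)"
  by (induction A rule: infinite_finite_induct) (auto simp: poly_eval_add)

lemma poly_as_sum:
  "p = (\<Sum>m\<in>Poly_Mapping.keys p. Poly_Mapping.single m (Poly_Mapping.lookup p m))"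
proof (rule poly_mapping_eqI)
  fix k
  show "Poly_Mapping.lookup p k = Poly_Mapping.lookup
      (\<Sum>m\<in>Poly_Mapping.keys p. Poly_Mapping.single m (Poly_Mapping.lookup p m)) k"
    by (simp add: lookup_sum lookup_single when_def in_keys_iff)
qed

lemma poly_eval_mult: "poly_eval (p * q) v = poly_eval p v * poly_eval q v"
proof -
  have "p * q = (\<Sum>m\<in>Poly_Mapping.keys p. \<Sum>l\<in>Poly_Mapping.keys q.
      Poly_Mapping.single (m + l) (Poly_Mapping.lookup p m * Poly_Mapping.lookup q l))"
    using arg_cong2[OF poly_as_sum[of p] poly_as_sum[of q], of "(*)"]
    by (simp only: sum_product mult_single)
  then have "poly_eval (p * q) v = (\<Sum>m\<in>Poly_Mapping.keys p. \<Sum>l\<in>Poly_Mapping.keys q.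
      (Poly_Mapping.lookup p m * Poly_Mapping.lookup q l) *
      ((\<Prod>i\<in>Poly_Mapping.keys m. v i ^ Poly_Mapping.lookup m i) *
       (\<Prod>i\<in>Poly_Mapping.keys l. v i ^ Poly_Mapping.lookup l i)))"
    by (simp add: poly_eval_sum poly_eval_single monom_eval_add)
  also have "\<dots> = poly_eval p v * poly_eval q v"
    by (simp add: poly_eval_def sum_product mult_ac)
  finally show ?thesis .
qed

lemma zero_locus_Un:
  fixes P Q :: "(('i \<Rightarrow>\<^sub>0 nat) \<Rightarrow>\<^sub>0 'a::field) set"
  shows "zero_locus P \<union> zero_locus Q = zero_locus {p * q | p q. p \<in> P \<and> q \<in> Q}"
  (is "?L = ?R")
proof (rule equalityI)
  show "?L \<subseteq> ?R" by (auto simp: zero_locus_def poly_eval_mult)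
  show "?R \<subseteq> ?L"
  proof
    fix v assume v: "v \<in> ?R"
    show "v \<in> ?L"
    proof (rule ccontr)
      assume "v \<notin> ?L"
      then obtain p q where pq: "p \<in> P" "poly_eval p v \<noteq> 0" "q \<in> Q" "poly_eval q v \<noteq> 0"
        unfolding zero_locus_def by blast
      have "poly_eval (p * q) v = 0" using v pq(1,3) unfolding zero_locus_def by blast
      then show False using pq(2,4) by (simp add: poly_eval_mult)
    qed
  qed
qed

lemma istopology_zariski:
  "istopology (\<lambda>U :: ('i \<Rightarrow> 'a::field) set. \<exists>P. U = - zero_locus P)"
  unfolding istopology_def
proof (intro conjI allI impI)
  fix S T :: "('i \<Rightarrow> 'a) set"
  assume "\<exists>P. S = - zero_locus P" "\<exists>P. T = - zero_locus P"
  then show "\<exists>P. S \<inter> T = - zero_locus P"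
    by (auto simp only: Compl_Un[symmetric] zero_locus_Un)
next
  fix \<K> :: "('i \<Rightarrow> 'a) set set"
  assume "\<forall>K\<in>\<K>. \<exists>P. K = - zero_locus P"
  then obtain P where P: "\<forall>K\<in>\<K>. K = - zero_locus (P K)" by (auto dest: bchoice)
  have "\<Union>\<K> = (\<Union>K\<in>\<K>. - zero_locus (P K))" using P by (intro arg_cong[of _ _ Union]) force
  also have "\<dots> = - zero_locus (\<Union>K\<in>\<K>. P K)"
    by (auto simp: zero_locus_def)
  finally show "\<exists>P. \<Union>\<K> = - zero_locus P" by blast
qed

lemma openin_zariski: "openin zariski U \<longleftrightarrow> (\<exists>P. U = - zero_locus P)"
  unfolding zariski_def by (simp add: topology_inverse'[OF istopology_zariski])

lemma topspace_zariski [simp]: "topspace zariski = (UNIV :: ('i \<Rightarrow> 'a::field) set)"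
proof -
  have "openin zariski (UNIV :: ('i \<Rightarrow> 'a::field) set)"
    unfolding openin_zariski by (rule exI[of _ "{1}"]) (simp add: zero_locus_def)
  from openin_subset[OF this] show ?thesis by (rule equalityI[OF subset_UNIV])
qed

lemma closedin_zariski: "closedin zariski C \<longleftrightarrow> (\<exists>P. C = zero_locus P)"
proof -
  have "closedin zariski C \<longleftrightarrow> (\<exists>P. - C = - zero_locus P)"
    by (simp add: closedin_def openin_zariski Compl_eq_Diff_UNIV)
  then show ?thesis by (simp only: compl_eq_compl_iff)
qed

section \<open>Pairs of invertible matrices\<close>

definition GL :: "nat \<Rightarrow> 'a::field mat monoid" where
  "GL n = units_of (ring_mat TYPE('a) n ())"

definition group_commutator :: "('g, 'b) monoid_scheme \<Rightarrow> 'g \<Rightarrow> 'g \<Rightarrow> 'g" where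
  "group_commutator G x y = inv\<^bsub>G\<^esub> x \<otimes>\<^bsub>G\<^esub> inv\<^bsub>G\<^esub> y \<otimes>\<^bsub>G\<^esub> x \<otimes>\<^bsub>G\<^esub> y"

text \<open>The coordinates of a pair of \<open>n \<times> n\<close> matrices are its \<open>2n\<^sup>2\<close> entries.  The variables beyond these
  are set to zero, so the sets cut out by polynomials in all variables are exactly those
  cut out by polynomials in the \<open>2n\<^sup>2\<close> entries.\<close>

definition mat_pair_coords ::
    "nat \<Rightarrow> 'a::field mat \<times> 'a mat \<Rightarrow> (nat \<times> nat) + (nat \<times> nat) \<Rightarrow> 'a" where
  "mat_pair_coords n = (\<lambda>(x, y) c. case c of
      Inl (i, j) \<Rightarrow> if i < n \<and> j < n then x $$ (i, j) else 0
    | Inr (i, j) \<Rightarrow> if i < n \<and> j < n then y $$ (i, j) else 0)"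

text \<open>\<open>GL n \<times> GL n\<close> is open in the affine space of pairs of matrices, and its Zariski topology is
  the induced one: powers of the two determinants can be cleared from a regular function
  without changing its zeros.\<close>

definition zariski_GL_pair :: "nat \<Rightarrow> ('a::field mat \<times> 'a mat) topology" where
  "zariski_GL_pair n =
     pullback_topology (carrier (GL n) \<times> carrier (GL n)) (mat_pair_coords n) zariski"

definition commutator_variety :: "nat \<Rightarrow> 'a::field \<Rightarrow> ('a mat \<times> 'a mat) set" where
  "commutator_variety n \<zeta> =
     {(x, y). x \<in> carrier (GL n) \<and> y \<in> carrier (GL n) \<and>
        group_commutator (GL n) x y = \<zeta> \<cdot>\<^sub>m 1\<^sub>m n}"

end

theory Submission
  imports Defs
    "Jordan_Normal_Form.Jordan_Normal_Form_Uniqueness"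
    "Jordan_Normal_Form.Jordan_Normal_Form_Existence"
begin

text \<open>
  Membership of \<open>(x, y)\<close> means \<open>x y = \<zeta> y x\<close>.  Suppose that \<open>e\<close> is a cyclic vector of \<open>y\<close>.
  Then the pair is determined by the vectors \<open>x e, y e, \<dots>, y\<^sup>n\<^sup>-\<^sup>1 e\<close> and the coefficients of
  \<open>y\<^sup>n e\<close> in the basis \<open>y\<^sup>i e\<close>, and only the \<open>n/d\<close> coefficients with \<open>d\<close> dividing \<open>i\<close> can be nonzero,
  because \<open>y\<close> is similar to \<open>\<zeta> y\<close>.  Such pairs are therefore the bijective rational image of a
  principal open subset of an affine space of dimension \<open>n\<^sup>2 + n/d\<close>.

  They are dense.  By uniqueness of the Jordan normal form, \<open>x\<close> is similar to
  \<open>diag(X, \<zeta>X, \<dots>, \<zeta>\<^sup>d\<^sup>-\<^sup>1X)\<close>.  Since \<open>X\<close> commutes with a matrix that has a cyclic vector,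
  there is a \<open>z\<close> with a cyclic vector and \<open>x z = \<zeta> z x\<close>, and the generic point of the line from
  \<open>y\<close> to \<open>z\<close> inherits both properties.

  For the dimension, a chain of \<open>r\<close> strict inclusions of irreducible closed sets yields \<open>r\<close>
  algebraically independent regular functions, and counting monomials shows that more than \<open>s\<close>
  rational functions in \<open>s\<close> variables are dependent.  Conversely, the closures of the images of a
  flag of coordinate subspaces form a chain of length \<open>n\<^sup>2 + n/d\<close>.
\<close>

section \<open>Irreducible closed sets and algebraic independence\<close>

text \<open>The dimension is a count of parameters: n for \<open>x e\<close>, n(n - 1) for the
  vectors \<open>y e\<close> up to the (n-1)-st power, and n/d for the relation. The obstacle is
  density, because neither \<open>x\<close> nor \<open>y\<close> need have a cyclic vector. For
  fixed \<open>x\<close> the equation is linear in \<open>y\<close>, so it holds along a whole line,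
  while having a given \<open>v\<close> as cyclic vector is an open condition on \<open>y\<close>;
  one good \<open>z\<close> for each \<open>x\<close> is therefore enough. To find \<open>z\<close>:
  the inverse of \<open>y\<close> conjugates \<open>x\<close> into \<zeta> \<open>x\<close>, so the
  Jordan blocks of \<open>x\<close> are permuted by scaling the eigenvalues by \<zeta>. The
  eigenvalues are nonzero and \<zeta> has exact order d, hence all orbits have length d;
  representatives form \<open>X\<close>. A Jordan matrix with the block sizes of \<open>X\<close>
  but distinct eigenvalues commutes with \<open>X\<close> and has a cyclic vector, and cycling
  through the d copies with that matrix at the wrap-around gives \<open>z\<close>. Geometry enters
  only through functions that do or do not vanish: over an infinite field, two open conditions that
  hold at two points of a line hold together at a third.\<close>

lemma index_mult_vec_sum:
  assumes "A \<in> carrier_mat n m" "u \<in> carrier_vec m" "i < n"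
  shows "(A *\<^sub>v u) $ i = (\<Sum>j<m. A $$ (i, j) * u $ j)"
  using assms by (auto simp: scalar_prod_def lessThan_atLeast0 intro!: sum.cong)

lemma pow_mat_Suc_left:
  assumes "A \<in> carrier_mat n n"
  shows "A ^\<^sub>m Suc k = A * A ^\<^sub>m k"
proof (induction k)
  case 0
  then show ?case using assms by simp
next
  case (Suc k)
  have "A ^\<^sub>m Suc (Suc k) = (A * A ^\<^sub>m k) * A" using Suc by simp
  also have "\<dots> = A * (A ^\<^sub>m k * A)" using assms by (simp add: assoc_mult_mat[of _ n n _ n _ n])
  finally show ?case by simp
qed

lemma pow_mat_Suc_mult_vec:
  assumes "A \<in> carrier_mat n n" "v \<in> carrier_vec n"
  shows "A ^\<^sub>m Suc k *\<^sub>v v = A *\<^sub>v (A ^\<^sub>m k *\<^sub>v v)"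
  unfolding pow_mat_Suc_left[OF assms(1)]
  by (rule assoc_mult_mat_vec) (use assms in auto)


section \<open>Bounded exponent lists, monomials and algebraic independence\<close>

fun exponents :: "nat \<Rightarrow> nat \<Rightarrow> nat list set" where
  "exponents 0 M = {[]}"
| "exponents (Suc r) M = (\<lambda>(e, es). e # es) ` ({..M} \<times> exponents r M)"

fun monomial_fun :: "('p \<Rightarrow> 'k::comm_ring_1) list \<Rightarrow> nat list \<Rightarrow> 'p \<Rightarrow> 'k" where
  "monomial_fun (f # fs) (e # es) v = f v ^ e * monomial_fun fs es v"
| "monomial_fun _ _ v = 1"

text \<open>Every polynomial in the \<open>fs\<close> is such a sum once \<open>M\<close> is large
  enough, so this is algebraic independence of the restrictions to \<open>Z\<close>, with
  polynomials encoded by their coefficients.\<close>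

definition alg_indep_on :: "'p set \<Rightarrow> ('p \<Rightarrow> 'k::comm_ring_1) list \<Rightarrow> bool" where
  "alg_indep_on Z fs \<longleftrightarrow> (\<forall>M c. (\<forall>v\<in>Z. (\<Sum>es\<in>exponents (length fs) M. c es * monomial_fun fs es v) = 0)
      \<longrightarrow> (\<forall>es\<in>exponents (length fs) M. c es = 0))"

lemma finite_exponents [simp]: "finite (exponents r M)"
  by (induction r) auto

lemma card_exponents: "card (exponents r M) = (M + 1) ^ r"
proof (induction r)
  case (Suc r)
  have "inj_on (\<lambda>(e, es). e # es) ({..M} \<times> exponents r M)" by (auto simp: inj_on_def)
  then show ?case by (simp add: card_image card_cartesian_product Suc)
qed simp

lemma sum_exponents_Suc:
  "(\<Sum>es\<in>exponents (Suc r) M. F es) = (\<Sum>e\<le>M. \<Sum>es\<in>exponents r M. F (e # es))"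
proof -
  have "inj_on (\<lambda>(e, es). e # es) ({..M} \<times> exponents r M)" by (auto simp: inj_on_def)
  then show ?thesis
    by (simp add: sum.reindex sum.cartesian_product) (auto intro!: sum.cong)
qed

text \<open>Serves twice, for rational functions of the parameters and for polynomial functions on
  pairs of matrices, so that the closure properties of matrix products and determinants are proved
  once.\<close>

locale function_algebra =
  fixes R :: "('p \<Rightarrow> 'k::field) set"
  assumes const_R: "(\<lambda>_. c) \<in> R"
    and add_R: "f \<in> R \<Longrightarrow> g \<in> R \<Longrightarrow> (\<lambda>v. f v + g v) \<in> R"
    and mult_R: "f \<in> R \<Longrightarrow> g \<in> R \<Longrightarrow> (\<lambda>v. f v * g v) \<in> R"
begin

lemma sum_R: "(\<And>i. i \<in> S \<Longrightarrow> f i \<in> R) \<Longrightarrow> (\<lambda>v. \<Sum>i\<in>S. f i v) \<in> R"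
  by (induction S rule: infinite_finite_induct) (auto intro: const_R add_R)

lemma prod_R: "(\<And>i. i \<in> S \<Longrightarrow> f i \<in> R) \<Longrightarrow> (\<lambda>v. \<Prod>i\<in>S. f i v) \<in> R"
  by (induction S rule: infinite_finite_induct) (auto intro: const_R mult_R)

lemma power_R: "f \<in> R \<Longrightarrow> (\<lambda>v. f v ^ e) \<in> R"
  by (induction e) (auto intro: const_R mult_R)

lemma mult_vec_R:
  assumes "\<And>v. M v \<in> carrier_mat n n" "\<And>v. u v \<in> carrier_vec n"
    and "\<And>j. j < n \<Longrightarrow> (\<lambda>v. M v $$ (i, j)) \<in> R" "\<And>j. j < n \<Longrightarrow> (\<lambda>v. u v $ j) \<in> R" "i < n"
  shows "(\<lambda>v. (M v *\<^sub>v u v) $ i) \<in> R"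
proof -
  have "(\<lambda>v. (M v *\<^sub>v u v) $ i) = (\<lambda>v. \<Sum>j<n. M v $$ (i, j) * u v $ j)"
    by (rule ext) (rule index_mult_vec_sum[OF assms(1,2,5)])
  then show ?thesis by (simp only:) (intro sum_R mult_R assms; simp)
qed

lemma mult_mat_R:
  assumes "\<And>v. M v \<in> carrier_mat n n" "\<And>v. N v \<in> carrier_mat n n"
    and "\<And>i j. i < n \<Longrightarrow> j < n \<Longrightarrow> (\<lambda>v. M v $$ (i, j)) \<in> R"
    and "\<And>i j. i < n \<Longrightarrow> j < n \<Longrightarrow> (\<lambda>v. N v $$ (i, j)) \<in> R" and ij: "i < n" "j < n"
  shows "(\<lambda>v. (M v * N v) $$ (i, j)) \<in> R"
proof -
  have "(\<lambda>v. (M v * N v) $$ (i, j)) = (\<lambda>v. \<Sum>l<n. M v $$ (i, l) * N v $$ (l, j))"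
  proof
    fix v
    show "(M v * N v) $$ (i, j) = (\<Sum>l<n. M v $$ (i, l) * N v $$ (l, j))"
      using assms(1)[of v] assms(2)[of v] ij
      by (auto simp: scalar_prod_def lessThan_atLeast0 intro!: sum.cong)
  qed
  then show ?thesis by (simp only:) (intro sum_R mult_R assms; simp add: ij)
qed

lemma pow_mult_vec_R:
  assumes M: "\<And>v. M v \<in> carrier_mat n n" and u: "\<And>v. u v \<in> carrier_vec n"
    and "\<And>i j. i < n \<Longrightarrow> j < n \<Longrightarrow> (\<lambda>v. M v $$ (i, j)) \<in> R" "\<And>j. j < n \<Longrightarrow> (\<lambda>v. u v $ j) \<in> R"
    and "i < n"
  shows "(\<lambda>v. (M v ^\<^sub>m k *\<^sub>v u v) $ i) \<in> R"
  using assms(5)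
proof (induction k arbitrary: i)
  case 0
  have "M v ^\<^sub>m 0 *\<^sub>v u v = u v" for v using M[of v] u[of v] by simp
  then show ?case using assms(4) 0 by simp
next
  case (Suc k)
  have car: "M v ^\<^sub>m k *\<^sub>v u v \<in> carrier_vec n" for v
    by (rule mult_mat_vec_carrier[OF pow_carrier_mat[OF M] u])
  show ?case
    unfolding pow_mat_Suc_mult_vec[OF M u]
    by (rule mult_vec_R[OF M car assms(3)[OF Suc.prems] Suc.IH Suc.prems])
qed

lemma det_R:
  assumes M: "\<And>v. M v \<in> carrier_mat n n"
    and "\<And>i j. i < n \<Longrightarrow> j < n \<Longrightarrow> (\<lambda>v. M v $$ (i, j)) \<in> R"
  shows "(\<lambda>v. det (M v)) \<in> R"
  unfolding det_def'[OF M]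
proof (intro sum_R mult_R const_R prod_R assms(2))
  fix p i assume "p \<in> {p. p permutes {0..<n}}" "i \<in> {0..<n}"
  then show "i < n" "p i < n" using permutes_in_image[of p "{0..<n}" i] by auto
qed

end

text \<open>Makes irreducibility and chains of closed sets a matter of where members of
  \<open>R\<close> vanish. The instance in use is the set of pairs with the polynomials in the
  matrix entries.\<close>

locale zero_locus_topology = function_algebra R
  for X :: "'p topology" and R :: "('p \<Rightarrow> 'k::field) set" +
  assumes closedin_iff: "closedin X C \<longleftrightarrow> (\<exists>F\<subseteq>R. C = {v \<in> topspace X. \<forall>f\<in>F. f v = 0})"
begin

lemma monomial_fun_R: "set fs \<subseteq> R \<Longrightarrow> monomial_fun fs es \<in> R"
proof (induction fs arbitrary: es)
  case (Cons f fs)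
  from Cons.prems have f: "f \<in> R" and IH: "monomial_fun fs es' \<in> R" for es'
    using Cons.IH by auto
  show ?case
  proof (cases es)
    case Nil
    then have "monomial_fun (f # fs) es = (\<lambda>v. 1)" by auto
    then show ?thesis by (simp only: const_R)
  next
    case (Cons e es')
    then have "monomial_fun (f # fs) es = (\<lambda>v. f v ^ e * monomial_fun fs es' v)" by auto
    with mult_R[OF power_R[OF f] IH] show ?thesis by simp
  qed
next
  case Nil
  have "monomial_fun [] es = (\<lambda>v::'p. 1::'k)" by auto
  then show ?case by (simp only: const_R)
qed

text \<open>The sets on which one member of \<open>R\<close> is nonzero form a basis of the
  topology, so it suffices that any two nonempty ones meet.\<close>

lemma irreducible_iff:
  assumes "Z \<subseteq> topspace X"
  shows "irreducible_space (subtopology X Z) \<longleftrightarrow> Z \<noteq> {} \<and>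
    (\<forall>f\<in>R. \<forall>g\<in>R. (\<exists>a\<in>Z. f a \<noteq> 0) \<and> (\<exists>b\<in>Z. g b \<noteq> 0) \<longrightarrow> (\<exists>c\<in>Z. f c \<noteq> 0 \<and> g c \<noteq> 0))"
  (is "?irr \<longleftrightarrow> ?crit")
proof
  assume irr: ?irr
  have cl: "closedin (subtopology X Z) {v \<in> Z. f v = 0}" if "f \<in> R" for f
    unfolding closedin_subtopology closedin_iff
    by (rule exI[of _ "{v \<in> topspace X. \<forall>f\<in>{f}. f v = 0}"]) (use that assms in auto)
  show ?crit
  proof (intro conjI ballI impI)
    show "Z \<noteq> {}" using irr assms by (auto simp: irreducible_space_def)
    fix f g assume fg: "f \<in> R" "g \<in> R" and ne: "(\<exists>a\<in>Z. f a \<noteq> 0) \<and> (\<exists>b\<in>Z. g b \<noteq> 0)"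
    show "\<exists>c\<in>Z. f c \<noteq> 0 \<and> g c \<noteq> 0"
    proof (rule ccontr)
      assume "\<not> ?thesis"
      then have "Z = {v \<in> Z. f v = 0} \<union> {v \<in> Z. g v = 0}" by auto
      moreover have "topspace (subtopology X Z) = Z" using assms by auto
      ultimately show False
        using irr cl[OF fg(1)] cl[OF fg(2)] ne unfolding irreducible_space_def by blast
    qed
  qed
next
  assume crit: ?crit
  have top: "topspace (subtopology X Z) = Z" using assms by auto
  have "C = Z \<or> D = Z"
    if C: "closedin (subtopology X Z) C" and D: "closedin (subtopology X Z) D" and CD: "Z = C \<union> D" for C D
  proof (rule ccontr)
    assume neg: "\<not> ?thesis"
    have ex: "\<exists>f\<in>R. (\<forall>v\<in>C. f v = 0) \<and> (\<exists>a\<in>Z. f a \<noteq> 0)"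
      if C: "closedin (subtopology X Z) C" and "C \<noteq> Z" for C
    proof -
      from C obtain F where F: "F \<subseteq> R" "C = {v \<in> topspace X. \<forall>f\<in>F. f v = 0} \<inter> Z"
        unfolding closedin_subtopology closedin_iff by blast
      then have "C \<subseteq> Z" by blast
      with \<open>C \<noteq> Z\<close> obtain a where "a \<in> Z" "a \<notin> C" by blast
      with F assms obtain f where "f \<in> F" "f a \<noteq> 0" by blast
      with F \<open>a \<in> Z\<close> show ?thesis by blast
    qed
    from ex[OF C] neg obtain f where "f \<in> R" "\<forall>v\<in>C. f v = 0" "\<exists>a\<in>Z. f a \<noteq> 0" by blast
    moreover from ex[OF D] neg obtain g where "g \<in> R" "\<forall>v\<in>D. g v = 0" "\<exists>a\<in>Z. g a \<noteq> 0" by blast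
    ultimately show False using crit CD by blast
  qed
  with crit top show ?irr unfolding irreducible_space_def by auto
qed

lemma irreducibleD:
  assumes "Z \<subseteq> topspace X" "irreducible_space (subtopology X Z)" "f \<in> R" "g \<in> R"
    "a \<in> Z" "f a \<noteq> 0" "b \<in> Z" "g b \<noteq> 0"
  obtains c where "c \<in> Z" "f c \<noteq> 0" "g c \<noteq> 0"
  using assms(2)[unfolded irreducible_iff[OF assms(1)]] assms(3-) that by blast

text \<open>A relation for \<open>g # fs\<close> on \<open>Z'\<close> can be divided by \<open>g\<close> until some
  coefficient free of \<open>g\<close> survives; restricting to \<open>Z\<close>, where \<open>g\<close> vanishes, leaves a
  relation for \<open>fs\<close>.\<close>

lemma alg_indep_on_Cons:
  assumes Z: "Z \<subseteq> Z'" "Z' \<subseteq> topspace X" and irr: "irreducible_space (subtopology X Z')"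
    and fs: "set fs \<subseteq> R" "alg_indep_on Z fs"
    and g: "g \<in> R" "\<And>v. v \<in> Z \<Longrightarrow> g v = 0" "\<exists>v\<in>Z'. g v \<noteq> 0"
  shows "alg_indep_on Z' (g # fs)"
  unfolding alg_indep_on_def
proof (intro allI impI)
  fix M c
  let ?E = "exponents (length fs) M"
  let ?P = "\<lambda>e v. \<Sum>es\<in>?E. c (e # es) * monomial_fun fs es v"
  assume "\<forall>v\<in>Z'. (\<Sum>es\<in>exponents (length (g # fs)) M. c es * monomial_fun (g # fs) es v) = 0"
  then have rel: "(\<Sum>e\<le>M. g v ^ e * ?P e v) = 0" if "v \<in> Z'" for v
    using that by (simp add: sum_exponents_Suc sum_distrib_left mult.assoc mult.left_commute del: exponents.simps)
  have PR: "?P e \<in> R" for e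
    by (intro sum_R mult_R const_R monomial_fun_R fs)
  have "\<forall>es\<in>?E. c (e # es) = 0" if "e \<le> M" for e
    using that
  proof (induction e rule: less_induct)
    case (less J)
    let ?Q = "\<lambda>v. \<Sum>e\<in>{J..M}. g v ^ (e - J) * ?P e v"
    have QR: "?Q \<in> R" by (intro sum_R mult_R power_R g PR)
    have low: "?P e v = 0" if "e < J" for e v using less that by simp
    have Q: "g v ^ J * ?Q v = 0" if "v \<in> Z'" for v
    proof -
      have "(\<Sum>e\<le>M. g v ^ e * ?P e v) = (\<Sum>e\<in>{J..M}. g v ^ e * ?P e v)"
        by (rule sum.mono_neutral_right) (auto simp: low not_le)
      also have "\<dots> = (\<Sum>e\<in>{J..M}. g v ^ J * (g v ^ (e - J) * ?P e v))"
        by (intro sum.cong refl) (simp add: mult.assoc[symmetric] power_add[symmetric])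
      also have "\<dots> = g v ^ J * ?Q v" by (simp add: sum_distrib_left)
      finally show ?thesis using rel[OF that] by simp
    qed
    \<comment> \<open>Irreducibility makes the functions on \<open>Z'\<close> an integral domain, so
      the factor \<open>g ^ J\<close> can be cancelled.\<close>
    have Q0: "?Q v = 0" if v: "v \<in> Z'" for v
    proof (rule ccontr)
      assume Qv: "?Q v \<noteq> 0"
      from g(3) obtain u0 where u0: "u0 \<in> Z'" "g u0 \<noteq> 0" by blast
      obtain u where "u \<in> Z'" "g u \<noteq> 0" "?Q u \<noteq> 0"
        by (rule irreducibleD[OF Z(2) irr g(1) QR u0 v Qv])
      with Q[of u] show False by simp
    qed
    have "?P J v = 0" if "v \<in> Z" for v
    proof -
      have "?Q v = (\<Sum>e\<in>{J}. g v ^ (e - J) * ?P e v)"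
        by (rule sum.mono_neutral_right) (use \<open>J \<le> M\<close> g(2)[OF that] in auto)
      then show ?thesis using Q0[of v] that Z by auto
    qed
    then show ?case
      using fs(2)[unfolded alg_indep_on_def, THEN spec[of _ M], THEN spec[of _ "\<lambda>es. c (J # es)"]]
      by simp
  qed
  then show "\<forall>es\<in>exponents (length (g # fs)) M. c es = 0" by auto
qed

text \<open>Each strict inclusion supplies a function that vanishes on the smaller set but not on
  the larger one, and \<open>alg_indep_on_Cons\<close> adds it to the list.\<close>

lemma alg_indep_on_chain:
  assumes "\<And>i. i \<le> r \<Longrightarrow> closedin X (Z i) \<and> irreducible_space (subtopology X (Z i))"
    and "\<And>i. i < r \<Longrightarrow> Z i \<subset> Z (Suc i)"
  shows "\<exists>fs. length fs = r \<and> set fs \<subseteq> R \<and> alg_indep_on (Z r) fs"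
  using assms
proof (induction r)
  case 0
  \<comment> \<open>Irreducible spaces are nonempty, and a constant that vanishes on a nonempty set
    is zero: this is the independence of the empty list.\<close>
  then have "Z 0 \<noteq> {}" by (auto simp: irreducible_space_def)
  then have "alg_indep_on (Z 0) []" by (auto simp: alg_indep_on_def)
  then show ?case by (intro exI[of _ "[]"]) simp
next
  case (Suc r)
  then obtain fs where fs: "length fs = r" "set fs \<subseteq> R" "alg_indep_on (Z r) fs"
    by (metis le_SucI less_SucI)
  have sub: "Z r \<subset> Z (Suc r)" and cl: "closedin X (Z r)" "closedin X (Z (Suc r))"
    using Suc.prems by simp_all
  obtain F where F: "F \<subseteq> R" "Z r = {v \<in> topspace X. \<forall>f\<in>F. f v = 0}"
    using cl(1)[unfolded closedin_iff] by (elim exE conjE)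
  have top: "Z (Suc r) \<subseteq> topspace X" using cl(2) by (rule closedin_subset)
  from sub obtain v where v: "v \<in> Z (Suc r)" "v \<notin> Z r" by blast
  with F top obtain g where g: "g \<in> F" "g v \<noteq> 0" by blast
  have "alg_indep_on (Z (Suc r)) (g # fs)"
    by (rule alg_indep_on_Cons[OF _ top _ fs(2,3)]) (use sub F g v Suc.prems in auto)
  then show ?case using fs F g by (intro exI[of _ "g # fs"]) auto
qed

lemma krull_dim_eqI:
  assumes "\<And>fs. set fs \<subseteq> R \<Longrightarrow> alg_indep_on (topspace X) fs \<Longrightarrow> length fs \<le> s"
    and "\<And>i. i \<le> s \<Longrightarrow> closedin X (Z i) \<and> irreducible_space (subtopology X (Z i))"
    and "\<And>i. i < s \<Longrightarrow> Z i \<subset> Z (Suc i)"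
  shows "krull_dim X = enat s"
  unfolding krull_dim_def
proof (rule antisym)
  show "Sup {enat m | m. \<exists>Z. (\<forall>i\<le>m. closedin X (Z i) \<and> irreducible_space (subtopology X (Z i))) \<and>
     (\<forall>i<m. Z i \<subset> Z (Suc i))} \<le> enat s"
  proof (rule Sup_least, clarify)
    fix r and Z :: "nat \<Rightarrow> 'p set"
    assume Z: "\<forall>i\<le>r. closedin X (Z i) \<and> irreducible_space (subtopology X (Z i))" "\<forall>i<r. Z i \<subset> Z (Suc i)"
    then obtain fs where fs: "length fs = r" "set fs \<subseteq> R" "alg_indep_on (Z r) fs"
      using alg_indep_on_chain[of r Z] by auto
    moreover have "Z r \<subseteq> topspace X" using Z(1) closedin_subset[of X "Z r"] by simp
    \<comment> \<open>A relation on the whole space restricts to \<open>Z r\<close>, so independence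
      passes to the larger set.\<close>
    ultimately have "alg_indep_on (topspace X) fs" unfolding alg_indep_on_def by (meson subsetD)
    from assms(1)[OF fs(2) this] fs(1) show "enat r \<le> enat s" by simp
  qed
  show "enat s \<le> Sup {enat m | m. \<exists>Z. (\<forall>i\<le>m. closedin X (Z i) \<and> irreducible_space (subtopology X (Z i))) \<and>
     (\<forall>i<m. Z i \<subset> Z (Suc i))}"
    by (rule Sup_upper) (use assms(2,3) in blast)
qed

text \<open>The set is the closure of \<open>B\<close>. Images of parameter sets need not be closed,
  so chains are built from such closures.\<close>

lemma closedin_zero_closure:
  "closedin X {v \<in> topspace X. \<forall>f\<in>R. (\<forall>u\<in>B. f u = 0) \<longrightarrow> f v = 0}"
proof -
  let ?F = "{f \<in> R. \<forall>u\<in>B. f u = 0}"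
  have "?F \<subseteq> R" by simp
  moreover have "{v \<in> topspace X. \<forall>f\<in>R. (\<forall>u\<in>B. f u = 0) \<longrightarrow> f v = 0} =
      {v \<in> topspace X. \<forall>f\<in>?F. f v = 0}"
    by (simp add: Ball_def imp_conjL)
  ultimately show ?thesis unfolding closedin_iff by (intro exI conjI)
qed

text \<open>A function that is nonzero somewhere on the closure is nonzero somewhere on
  \<open>B\<close>, so the criterion has to be checked on \<open>B\<close> only.\<close>

lemma irreducible_zero_closure:
  assumes "B \<subseteq> topspace X" "B \<noteq> {}"
    and "\<And>f g a b. f \<in> R \<Longrightarrow> g \<in> R \<Longrightarrow> a \<in> B \<Longrightarrow> b \<in> B \<Longrightarrow> f a \<noteq> 0 \<Longrightarrow> g b \<noteq> 0 \<Longrightarrow>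
      \<exists>c\<in>B. f c \<noteq> 0 \<and> g c \<noteq> 0"
  shows "irreducible_space (subtopology X {v \<in> topspace X. \<forall>f\<in>R. (\<forall>u\<in>B. f u = 0) \<longrightarrow> f v = 0})"
    (is "irreducible_space (subtopology X ?Z)")
proof -
  have sub: "?Z \<subseteq> topspace X" by (rule Collect_restrict)
  have B: "B \<subseteq> ?Z" using assms(1) by fast
  have ex: "\<exists>u\<in>B. f u \<noteq> 0" if "f \<in> R" "\<exists>a\<in>?Z. f a \<noteq> 0" for f
  proof (rule ccontr)
    assume "\<not> ?thesis"
    then have "\<forall>u\<in>B. f u = 0" by simp
    with that show False by simp
  qed
  show ?thesis
    unfolding irreducible_iff[OF sub]
  proof (intro conjI ballI impI)
    show "?Z \<noteq> {}" using B assms(2) by fast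
    fix f g assume fg: "f \<in> R" "g \<in> R" and ne: "(\<exists>a\<in>?Z. f a \<noteq> 0) \<and> (\<exists>b\<in>?Z. g b \<noteq> 0)"
    obtain a b where "a \<in> B" "f a \<noteq> 0" "b \<in> B" "g b \<noteq> 0"
      using ex[OF fg(1) conjunct1[OF ne]] ex[OF fg(2) conjunct2[OF ne]] by metis
    from assms(3)[OF fg this(1,3,2,4)] B show "\<exists>c\<in>?Z. f c \<noteq> 0 \<and> g c \<noteq> 0" by (meson subsetD)
  qed
qed

end

section \<open>Rational functions on principal open sets\<close>

text \<open>Euclid's argument: over a finite field, 1 plus the product of all \<open>X - a\<close>
  has positive degree but no root.\<close>

lemma infinite_UNIV_alg_closed: "infinite (UNIV :: 'k::alg_closed_field set)"
proof
  assume fin: "finite (UNIV :: 'k set)"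
  define p :: "'k poly" where "p = (\<Prod>a\<in>UNIV. [:- a, 1:]) + 1"
  have "degree (\<Prod>a\<in>(UNIV::'k set). [:- a, 1:]) = card (UNIV::'k set)"
    by (subst degree_prod_eq_sum_degree) auto
  moreover have "card (UNIV :: 'k set) > 0" using fin by (simp add: card_gt_0_iff)
  ultimately have "degree p > 0" unfolding p_def by (subst degree_add_eq_left) auto
  then obtain x where "poly p x = 0" using alg_closed_imp_poly_has_root by blast
  moreover have "poly (\<Prod>a\<in>(UNIV::'k set). [:- a, 1:]) x = 0"
    using fin by (auto simp: poly_prod)
  ultimately show False by (simp add: p_def)
qed

text \<open>Generated by the ring operations, so that restriction to a line is an induction;
  coefficients are recovered in \<open>polyfun_bounded\<close>.\<close>

inductive polyfun :: "'i set \<Rightarrow> (('i \<Rightarrow> 'k::comm_ring_1) \<Rightarrow> 'k) \<Rightarrow> bool" for I where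
  polyfun_const [intro]: "polyfun I (\<lambda>_. c)"
| polyfun_var [intro]: "i \<in> I \<Longrightarrow> polyfun I (\<lambda>a. a i)"
| polyfun_add [intro]: "polyfun I f \<Longrightarrow> polyfun I g \<Longrightarrow> polyfun I (\<lambda>a. f a + g a)"
| polyfun_mult [intro]: "polyfun I f \<Longrightarrow> polyfun I g \<Longrightarrow> polyfun I (\<lambda>a. f a * g a)"

definition line_point :: "('i \<Rightarrow> 'k::comm_ring_1) \<Rightarrow> ('i \<Rightarrow> 'k) \<Rightarrow> 'k \<Rightarrow> 'i \<Rightarrow> 'k" where
  "line_point a b t = (\<lambda>i. a i + t * (b i - a i))"

lemma polyfun_line:
  assumes "polyfun I f"
  shows "\<exists>p. \<forall>t. f (line_point a b t) = poly p t"
  using assms unfolding line_point_def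
proof induction
  case (polyfun_const c)
  show ?case by (rule exI[of _ "[:c:]"]) simp
next
  case (polyfun_var i)
  show ?case by (rule exI[of _ "[:a i, b i - a i:]"]) simp
next
  case (polyfun_add f g)
  then show ?case by (metis poly_add)
next
  case (polyfun_mult f g)
  then show ?case by (metis poly_mult)
qed

definition principal_open :: "'i set \<Rightarrow> ('i \<Rightarrow> 'k::field) set \<Rightarrow> bool" where
  "principal_open I A \<longleftrightarrow> (\<exists>D. polyfun I D \<and> A = {a. D a \<noteq> 0})"

text \<open>One fraction for all of \<open>A\<close>, so that its denominator can be cleared
  globally. The values of \<open>f\<close> outside \<open>A\<close> are left open, which absorbs the
  default value of a division by zero there.\<close>

definition ratfun :: "'i set \<Rightarrow> ('i \<Rightarrow> 'k::field) set \<Rightarrow> (('i \<Rightarrow> 'k) \<Rightarrow> 'k) \<Rightarrow> bool" where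
  "ratfun I A f \<longleftrightarrow> (\<exists>p q. polyfun I p \<and> polyfun I q \<and> (\<forall>a\<in>A. q a \<noteq> 0 \<and> f a = p a / q a))"

lemma ratfun_polyfun: "polyfun I f \<Longrightarrow> ratfun I A f"
  unfolding ratfun_def by (intro exI[of _ f] exI[of _ "\<lambda>_. 1"]) auto

lemma ratfun_const: "ratfun I A (\<lambda>_. c)"
  by (intro ratfun_polyfun polyfun.intros)

lemma ratfun_var: "i \<in> I \<Longrightarrow> ratfun I A (\<lambda>a. a i)"
  by (intro ratfun_polyfun polyfun.intros)

lemma ratfun_add:
  assumes "ratfun I A f" "ratfun I A g"
  shows "ratfun I A (\<lambda>a. f a + g a)"
proof -
  from assms obtain p q p' q' where
    "polyfun I p" "polyfun I q" "\<And>a. a \<in> A \<Longrightarrow> q a \<noteq> 0 \<and> f a = p a / q a"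
    "polyfun I p'" "polyfun I q'" "\<And>a. a \<in> A \<Longrightarrow> q' a \<noteq> 0 \<and> g a = p' a / q' a"
    unfolding ratfun_def by metis
  then show ?thesis unfolding ratfun_def
    by (intro exI[of _ "\<lambda>a. p a * q' a + p' a * q a"] exI[of _ "\<lambda>a. q a * q' a"])
      (auto intro!: polyfun.intros simp: field_simps)
qed

lemma ratfun_mult:
  assumes "ratfun I A f" "ratfun I A g"
  shows "ratfun I A (\<lambda>a. f a * g a)"
proof -
  from assms obtain p q p' q' where
    "polyfun I p" "polyfun I q" "\<And>a. a \<in> A \<Longrightarrow> q a \<noteq> 0 \<and> f a = p a / q a"
    "polyfun I p'" "polyfun I q'" "\<And>a. a \<in> A \<Longrightarrow> q' a \<noteq> 0 \<and> g a = p' a / q' a"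
    unfolding ratfun_def by metis
  then show ?thesis unfolding ratfun_def
    by (intro exI[of _ "\<lambda>a. p a * p' a"] exI[of _ "\<lambda>a. q a * q' a"])
      (auto intro!: polyfun.intros)
qed

lemma ratfun_divide:
  assumes "ratfun I A f" "ratfun I A g" "\<And>a. a \<in> A \<Longrightarrow> g a \<noteq> 0"
  shows "ratfun I A (\<lambda>a. f a / g a)"
proof -
  from assms(1,2) obtain p q p' q' where pq:
    "polyfun I p" "polyfun I q" "\<And>a. a \<in> A \<Longrightarrow> q a \<noteq> 0 \<and> f a = p a / q a"
    "polyfun I p'" "polyfun I q'" "\<And>a. a \<in> A \<Longrightarrow> q' a \<noteq> 0 \<and> g a = p' a / q' a"
    unfolding ratfun_def by metis
  have "p' a \<noteq> 0" if "a \<in> A" for a using assms(3)[OF that] pq(6)[OF that] by auto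
  with pq show ?thesis unfolding ratfun_def
    by (intro exI[of _ "\<lambda>a. p a * q' a"] exI[of _ "\<lambda>a. q a * p' a"])
      (auto intro!: polyfun.intros)
qed

lemma ratfun_sum:
  "(\<And>j. j \<in> S \<Longrightarrow> ratfun I A (f j)) \<Longrightarrow> ratfun I A (\<lambda>a. \<Sum>j\<in>S. f j a)"
  by (induction S rule: infinite_finite_induct) (auto intro: ratfun_const ratfun_add)

lemma ratfun_prod:
  "(\<And>j. j \<in> S \<Longrightarrow> ratfun I A (f j)) \<Longrightarrow> ratfun I A (\<lambda>a. \<Prod>j\<in>S. f j a)"
  by (induction S rule: infinite_finite_induct) (auto intro: ratfun_const ratfun_mult)

lemma ratfun_power: "ratfun I A f \<Longrightarrow> ratfun I A (\<lambda>a. f a ^ e)"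
  by (induction e) (auto intro: ratfun_const ratfun_mult)

lemma ratfun_poly_eval:
  "(\<And>j. ratfun I A (\<lambda>a. F a j)) \<Longrightarrow> ratfun I A (\<lambda>a. poly_eval p (F a))"
  unfolding poly_eval_def
  by (intro ratfun_sum ratfun_mult ratfun_prod ratfun_power ratfun_const)

lemma principal_open_UNIV: "principal_open I UNIV"
  unfolding principal_open_def by (rule exI[of _ "\<lambda>_. 1"]) auto

text \<open>On \<open>A\<close> the function vanishes exactly where its numerator does, so the new
  equation is the old one times the numerator.\<close>

lemma principal_open_nonzero:
  assumes "principal_open I A" "ratfun I A f"
  shows "principal_open I {a \<in> A. f a \<noteq> 0}"
proof -
  obtain D where D: "polyfun I D" "A = {a. D a \<noteq> 0}" using assms(1) unfolding principal_open_def by blast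
  obtain p q where pq: "polyfun I p" "\<And>a. a \<in> A \<Longrightarrow> q a \<noteq> 0 \<and> f a = p a / q a"
    using assms(2) unfolding ratfun_def by blast
  show ?thesis unfolding principal_open_def
    by (rule exI[of _ "\<lambda>a. D a * p a"]) (use D pq in \<open>auto intro!: polyfun.intros\<close>)
qed

text \<open>On the line through \<open>a\<close> and \<open>b\<close> both numerators and the equation of \<open>A\<close> become nonzero
  polynomials in one variable.\<close>

lemma nonzero_on_line:
  fixes A :: "('i \<Rightarrow> 'k::alg_closed_field) set"
  assumes A: "principal_open I A" and f: "ratfun I A f" and g: "ratfun I A g"
    and ab: "a \<in> A" "f a \<noteq> 0" "b \<in> A" "g b \<noteq> 0"
  shows "\<exists>t. line_point a b t \<in> A \<and> f (line_point a b t) \<noteq> 0 \<and> g (line_point a b t) \<noteq> 0"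
proof -
  let ?l = "line_point a b"
  have l: "?l 0 = a" "?l 1 = b" by (auto simp: line_point_def)
  obtain D where D: "polyfun I D" "A = {a. D a \<noteq> 0}" using A unfolding principal_open_def by blast
  obtain pf qf where f: "polyfun I pf" "\<And>a. a \<in> A \<Longrightarrow> qf a \<noteq> 0 \<and> f a = pf a / qf a"
    using f unfolding ratfun_def by blast
  obtain pg qg where g: "polyfun I pg" "\<And>a. a \<in> A \<Longrightarrow> qg a \<noteq> 0 \<and> g a = pg a / qg a"
    using g unfolding ratfun_def by blast
  obtain d where d: "\<And>t. D (?l t) = poly d t" using polyfun_line[OF D(1)] by blast
  obtain u where u: "\<And>t. pf (?l t) = poly u t" using polyfun_line[OF f(1)] by blast
  obtain v where v: "\<And>t. pg (?l t) = poly v t" using polyfun_line[OF g(1)] by blast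
  have "poly d 0 \<noteq> 0" using d[of 0] ab D by (simp add: l)
  moreover have "poly u 0 \<noteq> 0" using u[of 0] ab f by (auto simp: l)
  moreover have "poly v 1 \<noteq> 0" using v[of 1] ab g by (auto simp: l)
  ultimately have "d * u * v \<noteq> 0" by auto
  then have "finite {t. poly (d * u * v) t = 0}" by (rule poly_roots_finite)
  then obtain t where "poly (d * u * v) t \<noteq> 0"
    using infinite_UNIV_alg_closed by (metis (mono_tags, lifting) ex_new_if_finite mem_Collect_eq)
  then have "D (?l t) \<noteq> 0" "pf (?l t) \<noteq> 0" "pg (?l t) \<noteq> 0" using d u v by auto
  then have "?l t \<in> A" "f (?l t) \<noteq> 0" "g (?l t) \<noteq> 0" using D f(2)[of "?l t"] g(2)[of "?l t"] by auto
  then show ?thesis by blast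
qed

lemma common_nonzero:
  fixes A :: "('i \<Rightarrow> 'k::alg_closed_field) set"
  assumes "principal_open I A" "ratfun I A f" "ratfun I A g" "a \<in> A" "f a \<noteq> 0" "b \<in> A" "g b \<noteq> 0"
  shows "\<exists>c\<in>A. f c \<noteq> 0 \<and> g c \<noteq> 0"
  using nonzero_on_line[OF assms] by blast

text \<open>Gaussian elimination, one equation at a time: each equation uses up at most one
  unknown.\<close>

lemma homogeneous_system_nontrivial:
  fixes C :: "'s \<Rightarrow> 't \<Rightarrow> 'k::field"
  assumes "finite T" "finite S" "card T < card S"
  shows "\<exists>c. (\<exists>s\<in>S. c s \<noteq> 0) \<and> (\<forall>t\<in>T. (\<Sum>s\<in>S. c s * C s t) = 0)"
  using assms
proof (induction T arbitrary: S C rule: finite_induct)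
  case empty
  then have "S \<noteq> {}" by auto
  then show ?case by (intro exI[of _ "\<lambda>_. 1"]) auto
next
  case (insert t T)
  show ?case
  proof (cases "\<exists>s0\<in>S. C s0 t \<noteq> 0")
    case False
    have "card T < card S" using insert.prems insert.hyps by simp
    from insert.IH[OF insert.prems(1) this, of C]
    obtain c where "\<exists>s\<in>S. c s \<noteq> 0" "\<forall>t\<in>T. (\<Sum>s\<in>S. c s * C s t) = 0"
      by (elim exE conjE)
    then show ?thesis using False by (intro exI[of _ c]) simp
  next
    case True
    then obtain s0 where s0: "s0 \<in> S" "C s0 t \<noteq> 0" by blast
    \<comment> \<open>\<open>?C\<close> is the system left after equation \<open>t\<close> has been
      solved for the unknown \<open>s0\<close> and the result substituted.\<close>
    let ?S = "S - {s0}" and ?C = "\<lambda>s t'. C s t' - C s t / C s0 t * C s0 t'"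
    have "finite ?S" "card T < card ?S"
      using insert.prems insert.hyps s0 by (simp_all add: card_Diff_singleton)
    from insert.IH[OF this, of ?C]
    obtain c where c: "\<exists>s\<in>?S. c s \<noteq> 0" "\<forall>t\<in>T. (\<Sum>s\<in>?S. c s * ?C s t) = 0"
      by (elim exE conjE)
    \<comment> \<open>The value that equation \<open>t\<close> forces on the eliminated
      unknown.\<close>
    define c0 where "c0 = - (\<Sum>s\<in>?S. c s * C s t) / C s0 t"
    let ?c = "c(s0 := c0)"
    have split: "(\<Sum>s\<in>S. ?c s * C s t') = c0 * C s0 t' + (\<Sum>s\<in>?S. c s * C s t')" for t'
    proof -
      have "(\<Sum>s\<in>S. ?c s * C s t') = ?c s0 * C s0 t' + (\<Sum>s\<in>?S. ?c s * C s t')"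
        using s0(1) insert.prems(1) by (rule sum.remove[rotated])
      moreover have "(\<Sum>s\<in>?S. ?c s * C s t') = (\<Sum>s\<in>?S. c s * C s t')"
        by (rule sum.cong) auto
      ultimately show ?thesis by simp
    qed
    have "(\<Sum>s\<in>S. ?c s * C s t') = 0" if "t' \<in> T" for t'
    proof -
      have "(\<Sum>s\<in>?S. c s * ?C s t') =
          (\<Sum>s\<in>?S. c s * C s t') - (\<Sum>s\<in>?S. c s * C s t) * (C s0 t' / C s0 t)"
        by (simp add: right_diff_distrib sum_subtractf sum_distrib_right sum_divide_distrib mult.assoc)
      also have "(\<Sum>s\<in>?S. c s * ?C s t') = 0" using c(2) that by blast
      finally have "(\<Sum>s\<in>?S. c s * C s t') = (\<Sum>s\<in>?S. c s * C s t) * (C s0 t' / C s0 t)"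
        by simp
      then show ?thesis by (simp only: split) (simp add: c0_def)
    qed
    moreover have "(\<Sum>s\<in>S. ?c s * C s t) = 0" using s0(2) by (simp only: split) (simp add: c0_def)
    moreover have "\<exists>s\<in>S. ?c s \<noteq> 0"
    proof -
      from c(1) obtain s where "s \<in> S" "s \<noteq> s0" "c s \<noteq> 0" by blast
      then show ?thesis by (intro bexI[of _ s]) simp_all
    qed
    ultimately show ?thesis by (intro exI[of _ ?c]) simp
  qed
qed

text \<open>The degree is bounded in each variable separately, which makes the number of monomials
  the exact power \<open>(N + 1) ^ card I\<close> for finite \<open>I\<close>.\<close>

definition bounded_polyfun :: "'i set \<Rightarrow> nat \<Rightarrow> (('i \<Rightarrow> 'k::comm_ring_1) \<Rightarrow> 'k) \<Rightarrow> bool" where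
  "bounded_polyfun I N f \<longleftrightarrow>
     (\<exists>c. \<forall>a. f a = (\<Sum>e\<in>(I \<rightarrow>\<^sub>E {..N}). c e * (\<Prod>i\<in>I. a i ^ e i)))"

text \<open>The family \<open>e\<close> may repeat exponents, as it does when a product is expanded;
  the coefficients of equal exponents are added up.\<close>

lemma bounded_polyfun_sum:
  assumes "finite S" "finite I"
    and "\<And>j. j \<in> S \<Longrightarrow> e j \<in> (I \<rightarrow>\<^sub>E {..N})"
  shows "bounded_polyfun I N (\<lambda>a. \<Sum>j\<in>S. c j * (\<Prod>i\<in>I. a i ^ e j i))"
  unfolding bounded_polyfun_def
proof (intro exI allI)
  fix a
  let ?E = "I \<rightarrow>\<^sub>E {..N}"
  have fin: "finite ?E" using assms(2) by (intro finite_PiE) auto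
  have "(\<Sum>j\<in>S. c j * (\<Prod>i\<in>I. a i ^ e j i)) =
      (\<Sum>e'\<in>?E. \<Sum>j\<in>{j \<in> S. e j = e'}. c j * (\<Prod>i\<in>I. a i ^ e j i))"
    by (rule sum.group[symmetric]) (use assms fin in auto)
  also have "\<dots> = (\<Sum>e'\<in>?E. (\<Sum>j\<in>{j \<in> S. e j = e'}. c j) * (\<Prod>i\<in>I. a i ^ e' i))"
    by (intro sum.cong refl) (simp add: sum_distrib_right)
  finally show "(\<Sum>j\<in>S. c j * (\<Prod>i\<in>I. a i ^ e j i)) =
      (\<Sum>e'\<in>?E. (\<Sum>j\<in>{j \<in> S. e j = e'}. c j) * (\<Prod>i\<in>I. a i ^ e' i))" .
qed

lemma bounded_polyfun_const:
  assumes "finite I" shows "bounded_polyfun I N (\<lambda>_. c)"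
  using bounded_polyfun_sum[of "{()}" I "\<lambda>_. restrict (\<lambda>_. 0) I" N "\<lambda>_. c"] assms by simp

lemma bounded_polyfun_var:
  fixes i :: 'i
  assumes "finite I" "i \<in> I" "0 < N"
  shows "bounded_polyfun I N (\<lambda>a. a i :: 'k::comm_ring_1)"
proof -
  let ?e = "\<lambda>_::unit. restrict (\<lambda>j. if j = i then 1 else 0 :: nat) I"
  have mem: "?e () \<in> (I \<rightarrow>\<^sub>E {..N})" using assms(3) by auto
  have eq: "(\<Prod>j\<in>I. a j ^ ?e () j) = a i" for a :: "'i \<Rightarrow> 'k"
  proof -
    have "(\<Prod>j\<in>I. a j ^ ?e () j) = (\<Prod>j\<in>I. if j = i then a j else 1)"
      by (rule prod.cong) auto
    then show ?thesis using assms by simp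
  qed
  have "bounded_polyfun I N (\<lambda>a::'i \<Rightarrow> 'k. \<Sum>u\<in>{()}. 1 * (\<Prod>j\<in>I. a j ^ ?e u j))"
    by (rule bounded_polyfun_sum) (use assms(1) mem in auto)
  then show ?thesis by (simp only: eq sum.insert finite.emptyI empty_iff sum.empty) simp
qed

lemma bounded_polyfun_mult:
  assumes I: "finite I" and f: "bounded_polyfun I N f" and g: "bounded_polyfun I M g"
  shows "bounded_polyfun I (N + M) (\<lambda>a. f a * g a)"
proof -
  let ?E = "\<lambda>N. I \<rightarrow>\<^sub>E {..N::nat}"
  obtain c where c: "\<And>a. f a = (\<Sum>e\<in>?E N. c e * (\<Prod>i\<in>I. a i ^ e i))"
    using f unfolding bounded_polyfun_def by blast
  obtain c' where c': "\<And>a. g a = (\<Sum>e\<in>?E M. c' e * (\<Prod>i\<in>I. a i ^ e i))"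
    using g unfolding bounded_polyfun_def by blast
  let ?s = "\<lambda>(e, e'). restrict (\<lambda>i. e i + e' i) I"
  have "f a * g a = (\<Sum>x\<in>?E N \<times> ?E M. (case x of (e, e') \<Rightarrow> c e * c' e') * (\<Prod>i\<in>I. a i ^ ?s x i))" for a
    unfolding c c' sum_product sum.cartesian_product
    by (intro sum.cong refl) (clarsimp simp: power_add prod.distrib mult.assoc mult.left_commute)
  moreover have "finite (?E N \<times> ?E M)" using I by (intro finite_cartesian_product finite_PiE) auto
  moreover have "?s x \<in> ?E (N + M)" if "x \<in> ?E N \<times> ?E M" for x
    using that by (auto simp: PiE_iff intro!: add_mono)
  ultimately show ?thesis
    using bounded_polyfun_sum[of "?E N \<times> ?E M" I ?s "N + M" "\<lambda>(e, e'). c e * c' e'"] I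
    by presburger
qed

lemma bounded_polyfun_power:
  "finite I \<Longrightarrow> bounded_polyfun I N f \<Longrightarrow> bounded_polyfun I (e * N) (\<lambda>a. f a ^ e)"
  by (induction e) (auto intro: bounded_polyfun_const dest: bounded_polyfun_mult)

text \<open>The bound is raised by multiplying with the constant 1, taken as a polynomial of degree
  at most \<open>M - N\<close>.\<close>

lemma bounded_polyfun_mono:
  assumes "finite I" "bounded_polyfun I N f" "N \<le> M" shows "bounded_polyfun I M f"
  using bounded_polyfun_mult[OF assms(1,2) bounded_polyfun_const[OF assms(1), of "M - N" 1]] assms(3)
  by simp

lemma bounded_polyfun_add:
  assumes I: "finite I" and "bounded_polyfun I N f" "bounded_polyfun I N g"
  shows "bounded_polyfun I N (\<lambda>a. f a + g a)"
proof -
  obtain c c' where "\<forall>a. f a = (\<Sum>e\<in>(I \<rightarrow>\<^sub>E {..N}). c e * (\<Prod>i\<in>I. a i ^ e i))"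
    "\<forall>a. g a = (\<Sum>e\<in>(I \<rightarrow>\<^sub>E {..N}). c' e * (\<Prod>i\<in>I. a i ^ e i))"
    using assms(2,3) unfolding bounded_polyfun_def by (elim exE)
  then show ?thesis unfolding bounded_polyfun_def
    by (intro exI[of _ "\<lambda>e. c e + c' e"]) (simp add: sum.distrib distrib_right)
qed

lemma polyfun_bounded:
  assumes "finite I" "polyfun I f"
  obtains N where "bounded_polyfun I N f"
proof -
  have "\<exists>N. bounded_polyfun I N f" using assms(2)
  proof induction
    case (polyfun_const c)
    then show ?case using bounded_polyfun_const[OF assms(1)] by blast
  next
    case (polyfun_var i)
    then show ?case using bounded_polyfun_var[OF assms(1), of i 1] by auto
  next
    case (polyfun_add f g)
    then obtain N M where "bounded_polyfun I N f" "bounded_polyfun I M g" by blast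
    then have "bounded_polyfun I (max N M) f" "bounded_polyfun I (max N M) g"
      using bounded_polyfun_mono[OF assms(1)] by (meson max.cobounded1 max.cobounded2)+
    then show ?case using bounded_polyfun_add[OF assms(1)] by blast
  next
    case (polyfun_mult f g)
    then show ?case using bounded_polyfun_mult[OF assms(1)] by blast
  qed
  then show ?thesis using that by blast
qed

text \<open>The \<open>(M + 1) ^ length hs\<close> monomials of exponents at most \<open>M\<close> in the \<open>hs\<close> become, after
  clearing one common denominator, polynomials in \<open>card I\<close> variables of degree linear in \<open>M\<close>;
  for large \<open>M\<close> these are too many to be linearly independent.\<close>

lemma ratfun_monomial_clear:
  assumes I: "finite I" and "\<forall>h\<in>set hs. ratfun I A h"
  shows "\<exists>C Q. (\<forall>a\<in>A. Q a \<noteq> 0) \<and> (\<forall>M. \<forall>es\<in>exponents (length hs) M. \<exists>g. bounded_polyfun I (C * M) g \<and>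
     (\<forall>a\<in>A. g a = Q a ^ M * monomial_fun hs es a))"
  using assms(2)
proof (induction hs)
  case Nil
  have "bounded_polyfun I 0 (\<lambda>_. 1)" by (rule bounded_polyfun_const[OF I])
  then show ?case
    by (intro exI[of _ 0] exI[of _ "\<lambda>_. 1"]) auto
next
  case (Cons h hs)
  have "\<forall>h\<in>set hs. ratfun I A h" "ratfun I A h" using Cons.prems by simp_all
  from Cons.IH[OF this(1)] obtain C Q where CQ: "\<forall>a\<in>A. Q a \<noteq> 0"
    "\<forall>M. \<forall>es\<in>exponents (length hs) M. \<exists>g. bounded_polyfun I (C * M) g \<and>
     (\<forall>a\<in>A. g a = Q a ^ M * monomial_fun hs es a)"
    by (elim exE conjE)
  from \<open>ratfun I A h\<close> obtain p q where pq: "polyfun I p" "polyfun I q" "\<And>a. a \<in> A \<Longrightarrow> q a \<noteq> 0 \<and> h a = p a / q a"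
    unfolding ratfun_def by blast
  obtain N1 N2 where N12: "bounded_polyfun I N1 p" "bounded_polyfun I N2 q"
    using polyfun_bounded[OF I] pq by metis
  define N where "N = max N1 N2"
  have N: "bounded_polyfun I N p" "bounded_polyfun I N q"
    using bounded_polyfun_mono[OF I] N12 unfolding N_def by (meson max.cobounded1 max.cobounded2)+
  have "\<exists>g. bounded_polyfun I ((N + C) * M) g \<and> (\<forall>a\<in>A. g a = (q a * Q a) ^ M * monomial_fun (h # hs) es a)"
    if "es \<in> exponents (length (h # hs)) M" for M es
  proof -
    from that obtain e es' where es: "es = e # es'" "e \<le> M" "es' \<in> exponents (length hs) M" by auto
    obtain g where g: "bounded_polyfun I (C * M) g" "\<forall>a\<in>A. g a = Q a ^ M * monomial_fun hs es' a"
      using bspec[OF spec[OF CQ(2)] es(3)] by (elim exE conjE)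
    \<comment> \<open>The numerator \<open>p a ^ e\<close> absorbs \<open>e\<close> of the
      \<open>M\<close> factors \<open>q a\<close> and \<open>M - e\<close> of them remain, so the
      degree bound is \<open>N * M\<close> for this part whatever \<open>e\<close> is.\<close>
    have "bounded_polyfun I (e * N + (M - e) * N + C * M) (\<lambda>a. p a ^ e * q a ^ (M - e) * g a)"
      by (intro bounded_polyfun_mult bounded_polyfun_power I N g)
    moreover have "e * N + (M - e) * N + C * M = (N + C) * M"
    proof -
      have "e * N + (M - e) * N = M * N" using es(2) by (metis add_mult_distrib le_add_diff_inverse)
      then show ?thesis by (simp add: algebra_simps)
    qed
    moreover have "p a ^ e * q a ^ (M - e) * g a = (q a * Q a) ^ M * monomial_fun (h # hs) es a" if "a \<in> A" for a
    proof -
      have "q a ^ M = q a ^ e * q a ^ (M - e)" using es(2) by (simp flip: power_add)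
      then show ?thesis using pq(3)[OF that] g(2) that
        by (simp add: es(1) power_mult_distrib power_divide)
    qed
    ultimately show ?thesis by (intro exI[of _ "\<lambda>a. p a ^ e * q a ^ (M - e) * g a"]) simp
  qed
  moreover have "\<forall>a\<in>A. q a * Q a \<noteq> 0" using CQ(1) pq(3) by simp
  ultimately show ?case by (intro exI[of _ "N + C"] exI[of _ "\<lambda>a. q a * Q a"]) simp
qed

lemma ratfun_not_alg_indep:
  fixes A :: "('i \<Rightarrow> 'k::field) set"
  assumes I: "finite I" and hs: "\<forall>h\<in>set hs. ratfun I A h" and card: "card I < length hs"
  shows "\<not> alg_indep_on A hs"
proof
  assume indep: "alg_indep_on A hs"
  obtain C Q where Q: "\<forall>a\<in>A. Q a \<noteq> 0" and
    CQ: "\<forall>M. \<forall>es\<in>exponents (length hs) M. \<exists>g. bounded_polyfun I (C * M) g \<and>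
     (\<forall>a\<in>A. g a = Q a ^ M * monomial_fun hs es a)"
    using ratfun_monomial_clear[OF I hs] by (elim exE conjE)
  \<comment> \<open>With s = \<open>card I\<close> there are at most (C+1)^s (M+1)^s monomials in
    the variables and at least (M+1)^(s+1) in the \<open>hs\<close>; this \<open>M\<close> is the
    first factor, so the former are strictly fewer.\<close>
  define M where "M = (C + 1) ^ card I"
  let ?S = "exponents (length hs) M" and ?T = "I \<rightarrow>\<^sub>E {..C * M}"
  have "card ?T = (C * M + 1) ^ card I" using I by (simp add: card_PiE)
  also have "\<dots> \<le> ((C + 1) * (M + 1)) ^ card I" by (intro power_mono) auto
  also have "\<dots> = (C + 1) ^ card I * (M + 1) ^ card I" by (rule power_mult_distrib)
  also have "\<dots> = M * (M + 1) ^ card I" by (simp only: M_def)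
  also have "\<dots> < (M + 1) * (M + 1) ^ card I" by simp
  also have "\<dots> = (M + 1) ^ Suc (card I)" by simp
  also have "\<dots> \<le> (M + 1) ^ length hs" using card by (intro power_increasing) auto
  also have "\<dots> = card ?S" by (simp add: card_exponents)
  finally have lt: "card ?T < card ?S" .
  have fin: "finite ?T" using I by (intro finite_PiE) auto
  have "\<forall>es\<in>?S. \<exists>c. \<forall>a\<in>A. Q a ^ M * monomial_fun hs es a = (\<Sum>e\<in>?T. c e * (\<Prod>i\<in>I. a i ^ e i))"
  proof
    fix es assume "es \<in> ?S"
    from bspec[OF spec[OF CQ] this] obtain g c where
      "\<forall>a\<in>A. g a = Q a ^ M * monomial_fun hs es a"
      "\<forall>a. g a = (\<Sum>e\<in>?T. c e * (\<Prod>i\<in>I. a i ^ e i))"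
      unfolding bounded_polyfun_def by (elim exE conjE)
    then show "\<exists>c. \<forall>a\<in>A. Q a ^ M * monomial_fun hs es a = (\<Sum>e\<in>?T. c e * (\<Prod>i\<in>I. a i ^ e i))"
      by (intro exI[of _ c]) simp
  qed
  from bchoice[OF this] obtain G where G: "\<forall>es\<in>?S. \<forall>a\<in>A.
      Q a ^ M * monomial_fun hs es a = (\<Sum>e\<in>?T. G es e * (\<Prod>i\<in>I. a i ^ e i))"
    by (elim exE)
  \<comment> \<open>One unknown for each monomial in the \<open>hs\<close>, one equation for each
    monomial in the variables: a nontrivial solution is an algebraic relation.\<close>
  obtain c where c: "\<exists>es\<in>?S. c es \<noteq> 0" "\<forall>e\<in>?T. (\<Sum>es\<in>?S. c es * G es e) = 0"
    using homogeneous_system_nontrivial[OF fin finite_exponents lt, of G] by (elim exE conjE)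
  have "(\<Sum>es\<in>?S. c es * monomial_fun hs es a) = 0" if a: "a \<in> A" for a
  proof -
    have "Q a ^ M * (\<Sum>es\<in>?S. c es * monomial_fun hs es a) =
        (\<Sum>es\<in>?S. c es * (Q a ^ M * monomial_fun hs es a))"
      by (simp add: sum_distrib_left mult.left_commute)
    also have "\<dots> = (\<Sum>es\<in>?S. c es * (\<Sum>e\<in>?T. G es e * (\<Prod>i\<in>I. a i ^ e i)))"
      by (intro sum.cong refl) (simp only: bspec[OF bspec[OF G] a])
    also have "\<dots> = (\<Sum>e\<in>?T. (\<Sum>es\<in>?S. c es * G es e) * (\<Prod>i\<in>I. a i ^ e i))"
      unfolding sum_distrib_left sum_distrib_right
      by (subst sum.swap) (simp add: mult.assoc)
    also have "\<dots> = 0" using c(2) by simp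
    finally show ?thesis using Q a by auto
  qed
  then show False using indep c(1) unfolding alg_indep_on_def by blast
qed

section \<open>Cyclic matrices in twisted centralizers\<close>

text \<open>The sums are the coefficients of \<open>p\<close> expanded around \<open>c\<close>, that
  is, of p(X + c). If the first \<open>r\<close> vanish, then X^r divides p(X + c). Binomial
  coefficients in place of iterated derivatives keep this valid in positive characteristic.\<close>

lemma power_dvd_of_taylor_coeffs:
  fixes p :: "'k::field poly"
  assumes N: "degree p < N" and "\<And>l. l < r \<Longrightarrow> (\<Sum>k<N. coeff p k * (of_nat (k choose l) * c ^ (k - l))) = 0"
  shows "[:- c, 1:] ^ r dvd p"
proof -
  let ?q = "pcompose p [:c, 1:]"
  have p: "p = (\<Sum>k<N. Polynomial.smult (coeff p k) ([:0, 1:] ^ k))"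
  proof -
    have "p = (\<Sum>k\<le>degree p. monom (coeff p k) k)" by (rule poly_as_sum_of_monoms[symmetric])
    also have "\<dots> = (\<Sum>k<N. monom (coeff p k) k)"
      by (rule sum.mono_neutral_left) (use N in \<open>auto simp: coeff_eq_0\<close>)
    also have "\<dots> = (\<Sum>k<N. Polynomial.smult (coeff p k) ([:0, 1:] ^ k))"
      by (intro sum.cong refl) (simp add: monom_altdef)
    finally show ?thesis .
  qed
  have pw: "pcompose ([:0, 1:] ^ k) [:c, 1:] = [:c, 1:] ^ k" for k
    by (induction k) (simp_all add: pcompose_mult pcompose_pCons)
  have "?q = (\<Sum>k<N. Polynomial.smult (coeff p k) ([:c, 1:] ^ k))"
    by (subst (1) p) (simp add: pcompose_sum pcompose_smult pw)
  moreover have "coeff ([:c, 1:] ^ k) l = of_nat (k choose l) * c ^ (k - l)" for k l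
  proof (cases "l \<le> k")
    case False
    then have "degree ([:c, 1:] ^ k) < l" by (simp add: degree_linear_power)
    then show ?thesis using False by (simp add: coeff_eq_0 binomial_eq_0)
  qed (simp add: coeff_linear_poly_power)
  ultimately have co: "coeff ?q l = 0" if "l < r" for l
    using assms(2)[OF that] by (simp add: coeff_sum)
  then obtain q' where q': "?q = monom 1 r * q'"
    using monom_1_dvd_iff'[of r ?q] by auto
  have "p = pcompose ?q [:- c, 1:]"
    by (simp add: pcompose_assoc[symmetric] pcompose_pCons)
  also have "\<dots> = pcompose (monom 1 r) [:- c, 1:] * pcompose q' [:- c, 1:]"
    unfolding q' by (rule pcompose_mult)
  also have "pcompose (monom 1 r) [:- c, 1:] = [:- c, 1:] ^ r"
  proof -
    have "pcompose ([:0, 1:] ^ r) [:- c, 1:] = [:- c, 1:] ^ r"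
      by (induction r) (simp_all add: pcompose_mult pcompose_pCons)
    then show ?thesis by (simp add: monom_altdef)
  qed
  finally show ?thesis by (rule dvdI)
qed

text \<open>The last column of \<open>p\<close> evaluated at a Jordan block lists, from bottom to
  top, the Taylor coefficients of \<open>p\<close> at \<open>c\<close>.\<close>

lemma jordan_block_cyclic:
  fixes c :: "'k::field"
  assumes N: "degree p < N"
    and "\<And>i. i < r \<Longrightarrow> (\<Sum>k<N. coeff p k * (jordan_block r c ^\<^sub>m k) $$ (i, r - 1)) = 0"
  shows "[:- c, 1:] ^ r dvd p"
proof (rule power_dvd_of_taylor_coeffs[OF N])
  fix l assume l: "l < r"
  let ?i = "r - 1 - l"
  have "(jordan_block r c ^\<^sub>m k) $$ (?i, r - 1) = of_nat (k choose l) * c ^ (k - l)" for k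
  proof -
    have "(jordan_block r c ^\<^sub>m k) $$ (?i, r - 1) = of_nat (k choose (r - 1 - ?i)) * c ^ (k + ?i - (r - 1))"
      using l unfolding jordan_block_pow by simp
    moreover have "r - 1 - ?i = l" "k + ?i - (r - 1) = k - l" using l by auto
    ultimately show ?thesis by simp
  qed
  then show "(\<Sum>k<N. coeff p k * (of_nat (k choose l) * c ^ (k - l))) = 0"
    using assms(2)[of ?i] l by simp
qed

text \<open>\<open>w\<close> stacks the last unit vectors of the blocks, and a polynomial in the
  matrix acts on each block separately. \<open>w\<close> is chosen before \<open>N\<close> and
  \<open>p\<close>, so that one vector serves all polynomials.\<close>

lemma jordan_matrix_annihilator:
  fixes ns :: "(nat \<times> 'k::field) list"
  assumes "\<forall>(r, c)\<in>set ns. 0 < r"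
  shows "\<exists>w\<in>carrier_vec (sum_list (map fst ns)). \<forall>N p. degree p < N \<longrightarrow>
     (\<forall>i<sum_list (map fst ns). (\<Sum>k<N. coeff p k * (jordan_matrix ns ^\<^sub>m k *\<^sub>v w) $ i) = 0) \<longrightarrow>
     (\<forall>(r, c)\<in>set ns. [:- c, 1:] ^ r dvd p)"
  using assms
proof (induction ns)
  case Nil
  show ?case by (intro bexI[of _ "0\<^sub>v 0"]) auto
next
  case (Cons rc ns)
  obtain r c where rc: "rc = (r, c)" by force
  let ?m = "sum_list (map fst ns)"
  let ?J = "jordan_block r c" and ?K = "jordan_matrix ns"
  have r: "0 < r" and pos: "\<forall>(r, c)\<in>set ns. 0 < r" using Cons.prems rc by auto
  from Cons.IH[OF pos] obtain w where w: "w \<in> carrier_vec ?m" and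
    IH: "\<forall>N p. degree p < N \<longrightarrow> (\<forall>i<?m. (\<Sum>k<N. coeff p k * (?K ^\<^sub>m k *\<^sub>v w) $ i) = 0) \<longrightarrow>
     (\<forall>(r, c)\<in>set ns. [:- c, 1:] ^ r dvd p)" by (elim bexE)
  let ?e = "unit_vec r (r - 1) :: 'k vec"
  have car: "?J ^\<^sub>m k \<in> carrier_mat r r" "?K ^\<^sub>m k \<in> carrier_mat ?m ?m" for k
    by (auto intro: pow_carrier_mat)
  have vec: "jordan_matrix (rc # ns) ^\<^sub>m k *\<^sub>v (?e @\<^sub>v w) = (?J ^\<^sub>m k *\<^sub>v ?e) @\<^sub>v (?K ^\<^sub>m k *\<^sub>v w)" for k
  proof -
    have "jordan_matrix (rc # ns) ^\<^sub>m k =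
        four_block_mat (?J ^\<^sub>m k) (0\<^sub>m r ?m) (0\<^sub>m ?m r) (?K ^\<^sub>m k)"
      unfolding rc jordan_matrix_Cons by (rule pow_four_block_mat) auto
    then have "jordan_matrix (rc # ns) ^\<^sub>m k *\<^sub>v (?e @\<^sub>v w) =
        (?J ^\<^sub>m k *\<^sub>v ?e + 0\<^sub>m r ?m *\<^sub>v w) @\<^sub>v (0\<^sub>m ?m r *\<^sub>v ?e + ?K ^\<^sub>m k *\<^sub>v w)"
      using four_block_mat_mult_vec[OF car(1) zero_carrier_mat zero_carrier_mat car(2), of ?e w] w by simp
    moreover have "?J ^\<^sub>m k *\<^sub>v ?e + 0\<^sub>m r ?m *\<^sub>v w = ?J ^\<^sub>m k *\<^sub>v ?e"
      using car(1)[of k] w by (intro eq_vecI) auto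
    moreover have "0\<^sub>m ?m r *\<^sub>v ?e + ?K ^\<^sub>m k *\<^sub>v w = ?K ^\<^sub>m k *\<^sub>v w"
      using car(2)[of k] w by (intro eq_vecI) auto
    ultimately show ?thesis by simp
  qed
  have dims: "dim_vec (?J ^\<^sub>m k *\<^sub>v ?e) = r" "dim_vec (?K ^\<^sub>m k *\<^sub>v w) = ?m" for k
    using car by auto
  have "\<forall>(r', c')\<in>set (rc # ns). [:- c', 1:] ^ r' dvd p"
    if N: "degree p < N" and z: "\<And>i. i < r + ?m \<Longrightarrow>
      (\<Sum>k<N. coeff p k * (jordan_matrix (rc # ns) ^\<^sub>m k *\<^sub>v (?e @\<^sub>v w)) $ i) = 0" for N p
  proof -
    have "[:- c, 1:] ^ r dvd p"
    proof (rule jordan_block_cyclic[OF N])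
      fix i assume i: "i < r"
      have "(?J ^\<^sub>m k *\<^sub>v ?e) $ i = (?J ^\<^sub>m k) $$ (i, r - 1)" for k
      proof -
        have "(?J ^\<^sub>m k *\<^sub>v ?e) $ i = (\<Sum>j<r. (?J ^\<^sub>m k) $$ (i, j) * (if j = r - 1 then 1 else 0))"
          by (subst index_mult_vec_sum[OF car(1) _ i]) (auto intro!: sum.cong)
        also have "\<dots> = (?J ^\<^sub>m k) $$ (i, r - 1)"
          using r by (simp add: if_distrib sum.delta cong: if_cong)
        finally show ?thesis .
      qed
      then show "(\<Sum>k<N. coeff p k * (?J ^\<^sub>m k) $$ (i, r - 1)) = 0"
        using z[of i] i unfolding vec by (simp add: dims)
    qed
    moreover have "(\<Sum>k<N. coeff p k * (?K ^\<^sub>m k *\<^sub>v w) $ i) = 0" if "i < ?m" for i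
      using z[of "r + i"] that unfolding vec by (simp add: dims)
    then have "\<forall>(r, c)\<in>set ns. [:- c, 1:] ^ r dvd p" using IH N by blast
    ultimately show ?thesis using rc by auto
  qed
  moreover have "?e @\<^sub>v w \<in> carrier_vec (r + ?m)" using w by auto
  ultimately show ?case unfolding rc by (intro bexI[of _ "?e @\<^sub>v w"]) auto
qed

text \<open>Read the coefficients \<open>u\<close> as a polynomial of degree below \<open>m\<close>.
  As the eigenvalues are distinct, the block sizes add up as multiplicities of different roots,
  giving \<open>m\<close> roots in total; so the polynomial is zero.\<close>

lemma jordan_matrix_cyclic:
  fixes ns :: "(nat \<times> 'k::field) list"
  assumes pos: "\<forall>(r, c)\<in>set ns. 0 < r" and dist: "distinct (map snd ns)"
  defines "m \<equiv> sum_list (map fst ns)"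
  obtains w where "w \<in> carrier_vec m"
    "\<And>u. (\<And>i. i < m \<Longrightarrow> (\<Sum>k<m. u k * (jordan_matrix ns ^\<^sub>m k *\<^sub>v w) $ i) = 0) \<Longrightarrow> \<forall>k<m. u k = 0"
proof -
  from jordan_matrix_annihilator[OF pos] obtain w where w: "w \<in> carrier_vec m" and
    ann: "\<forall>N p. degree p < N \<longrightarrow> (\<forall>i<m. (\<Sum>k<N. coeff p k * (jordan_matrix ns ^\<^sub>m k *\<^sub>v w) $ i) = 0) \<longrightarrow>
     (\<forall>(r, c)\<in>set ns. [:- c, 1:] ^ r dvd p)" unfolding m_def by (elim bexE)
  have "\<forall>k<m. u k = 0"
    if u: "\<And>i. i < m \<Longrightarrow> (\<Sum>k<m. u k * (jordan_matrix ns ^\<^sub>m k *\<^sub>v w) $ i) = 0" for u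
  proof (cases "m = 0")
    case False
    define p where "p = (\<Sum>k<m. monom (u k) k)"
    have co: "coeff p k = (if k < m then u k else 0)" for k
      unfolding p_def coeff_sum by simp
    have deg: "degree p < m"
      using False by (intro le_less_trans[OF degree_le[of "m - 1"]]) (auto simp: co)
    have dvd: "\<forall>(r, c)\<in>set ns. [:- c, 1:] ^ r dvd p"
      using ann deg u by (simp add: co)
    have "p = 0"
    proof (rule ccontr)
      assume p0: "p \<noteq> 0"
      have "m = (\<Sum>x\<leftarrow>ns. fst x)" unfolding m_def ..
      also have "\<dots> \<le> (\<Sum>x\<leftarrow>ns. Polynomial.order (snd x) p)"
        using dvd p0 by (intro sum_list_mono) (force simp: order_divides)
      also have "\<dots> = (\<Sum>c\<leftarrow>map snd ns. Polynomial.order c p)" by (simp add: o_def)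
      also have "\<dots> = (\<Sum>c\<in>snd ` set ns. Polynomial.order c p)"
        using dist by (subst sum_list_distinct_conv_sum_set) auto
      also have "\<dots> \<le> (\<Sum>c | poly p c = 0. Polynomial.order c p)"
      proof (rule sum_mono2)
        show "finite {c. poly p c = 0}" using p0 by (rule poly_roots_finite)
        show "snd ` set ns \<subseteq> {c. poly p c = 0}"
        proof clarsimp
          fix r c assume rc: "(r, c) \<in> set ns"
          then have "[:- c, 1:] dvd [:- c, 1:] ^ r" "[:- c, 1:] ^ r dvd p"
            using dvd pos by (auto intro!: dvd_power)
          then show "poly p c = 0" unfolding poly_eq_0_iff_dvd by (rule dvd_trans)
        qed
      qed simp
      also have "\<dots> \<le> degree p" using p0 by (rule sum_order_le_degree)
      finally show False using deg by simp
    qed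
    then show ?thesis using co by (metis coeff_0)
  qed simp
  with w show ?thesis using that by blast
qed

text \<open>Both blocks are scalar matrices plus the same nilpotent matrix.\<close>

lemma jordan_block_commute:
  "jordan_block r (a::'k::field) * jordan_block r b = jordan_block r b * jordan_block r a"
proof -
  let ?N = "jordan_block r (0::'k)"
  have J: "jordan_block r c = c \<cdot>\<^sub>m 1\<^sub>m r + ?N" for c :: 'k
    by (intro eq_matI) auto
  have N: "?N \<in> carrier_mat r r" by simp
  have "jordan_block r a * jordan_block r b = (a * b) \<cdot>\<^sub>m 1\<^sub>m r + (a \<cdot>\<^sub>m ?N + b \<cdot>\<^sub>m ?N) + ?N * ?N" for a b
    unfolding J[of a] J[of b] using N
    by (subst add_mult_distrib_mat[of _ r r], auto, subst mult_add_distrib_mat[of _ r r _ r], auto,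
        subst mult_add_distrib_mat[of _ r r _ r], auto intro!: eq_matI simp: algebra_simps)
  from this[of a b] this[of b a] show ?thesis
    using N by (simp add: mult.commute comm_add_mat[of "a \<cdot>\<^sub>m ?N" r r "b \<cdot>\<^sub>m ?N"])
qed

text \<open>Allows the eigenvalues of \<open>X\<close> to be replaced by distinct ones: the
  resulting matrix still commutes with \<open>X\<close>, but has a cyclic vector.\<close>

lemma jordan_matrix_commute:
  fixes ns ms :: "(nat \<times> 'k::field) list"
  assumes "map fst ns = map fst ms"
  shows "jordan_matrix ns * jordan_matrix ms = jordan_matrix ms * jordan_matrix ns"
  using assms
proof (induction ns arbitrary: ms)
  case (Cons rc ns)
  then obtain r a b ms' where eq: "rc = (r, a)" "ms = (r, b) # ms'" and ms': "map fst ns = map fst ms'"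
    by (cases rc; cases ms) auto
  let ?m = "sum_list (map fst ns)"
  have m: "sum_list (map fst ms') = ?m" using ms' by simp
  have car: "jordan_matrix ns \<in> carrier_mat ?m ?m" "jordan_matrix ms' \<in> carrier_mat ?m ?m"
    using jordan_matrix_carrier[of ns] jordan_matrix_carrier[of ms'] unfolding m .
  have J: "jordan_block r x \<in> carrier_mat r r" for x :: 'k by simp
  note mult = mult_four_block_mat[OF J zero_carrier_mat zero_carrier_mat _ J zero_carrier_mat zero_carrier_mat]
  show ?case
    unfolding eq jordan_matrix_Cons m mult[OF car] mult[OF car(2,1)]
      left_mult_zero_mat[OF car(1)] left_mult_zero_mat[OF car(2)]
      right_mult_zero_mat[OF car(1)] right_mult_zero_mat[OF car(2)]
    using Cons.IH[OF ms'] jordan_block_commute[of r a b] by simp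
qed simp

lemma eq_mat_mult_vecI:
  fixes A B :: "'k::comm_ring_1 mat"
  assumes A: "A \<in> carrier_mat n n" and B: "B \<in> carrier_mat n n"
    and eq: "\<And>u. u \<in> carrier_vec n \<Longrightarrow> A *\<^sub>v u = B *\<^sub>v u"
  shows "A = B"
proof (rule eq_matI)
  fix i j assume "i < dim_row B" "j < dim_col B"
  then have ij: "i < n" "j < n" using B by auto
  have "(M *\<^sub>v unit_vec n j) $ i = M $$ (i, j)" if M: "M \<in> carrier_mat n n" for M :: "'k mat"
  proof -
    have "(M *\<^sub>v unit_vec n j) $ i = (\<Sum>l<n. M $$ (i, l) * (if l = j then 1 else 0))"
      by (subst index_mult_vec_sum[OF M _ ij(1)]) (use ij in \<open>auto intro!: sum.cong\<close>)
    then show ?thesis using ij(2) by (simp add: if_distrib sum.delta cong: if_cong)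
  qed
  from this[OF A] this[OF B] eq[of "unit_vec n j"] show "A $$ (i, j) = B $$ (i, j)" by simp
qed (use A B in auto)

section \<open>Matrices on \<open>d\<close> copies of an \<open>m\<close>-dimensional space\<close>

lemma sum_lessThan_mult:
  "(\<Sum>k<d * m. f k) = (\<Sum>j<d. \<Sum>b<m. f (j * m + b :: nat))"
proof (induction d)
  case (Suc d)
  have "(\<Sum>k<c + m. f k) = (\<Sum>k<c. f k) + (\<Sum>b<m. f (c + b))" for c
    by (induction m) (simp_all add: add.assoc)
  from this[of "d * m"] have "(\<Sum>k<Suc d * m. f k) = (\<Sum>k<d * m. f k) + (\<Sum>b<m. f (d * m + b))"
    by (simp add: add.commute)
  then show ?case using Suc by simp
qed simp

lemma smult_mat_mult_vec:
  fixes A :: "'k::comm_ring_1 mat"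
  assumes "A \<in> carrier_mat n m" "u \<in> carrier_vec m"
  shows "(k \<cdot>\<^sub>m A) *\<^sub>v u = k \<cdot>\<^sub>v (A *\<^sub>v u)"
  using assms by (intro eq_vecI) (auto simp: index_mult_vec_sum[of _ n m] sum_distrib_left mult.assoc
      simp del: index_mult_mat_vec)

text \<open>The index \<open>j * m + a\<close> stands for the basis vector \<open>a\<close> of the \<open>j\<close>-th of \<open>d\<close> copies
  of an \<open>m\<close>-dimensional space: \<open>graded_diag\<close> acts as \<open>\<zeta>\<^sup>j X\<close> on the \<open>j\<close>-th copy, and
  \<open>graded_shift\<close> moves each copy identically to the next one, and the last one back to the
  first by \<open>Z\<close>.\<close>

definition graded_diag :: "nat \<Rightarrow> nat \<Rightarrow> 'k \<Rightarrow> 'k mat \<Rightarrow> 'k::comm_ring_1 mat" where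
  "graded_diag d m \<zeta> X = mat (d * m) (d * m) (\<lambda>(i, k).
     if i div m = k div m then \<zeta> ^ (i div m) * X $$ (i mod m, k mod m) else 0)"

definition graded_shift :: "nat \<Rightarrow> nat \<Rightarrow> 'k mat \<Rightarrow> 'k::comm_ring_1 mat" where
  "graded_shift d m Z = mat (d * m) (d * m) (\<lambda>(i, k).
     if i div m = 0 then (if k div m = d - 1 then Z $$ (i mod m, k mod m) else 0)
     else if i div m = Suc (k div m) \<and> i mod m = k mod m then 1 else 0)"

lemma graded_carrier [simp]:
  "graded_diag d m \<zeta> X \<in> carrier_mat (d * m) (d * m)"
  "graded_shift d m Z \<in> carrier_mat (d * m) (d * m)"
  by (simp_all add: graded_diag_def graded_shift_def)

lemma block_index_less: "j < d \<Longrightarrow> a < m \<Longrightarrow> j * m + a < d * (m::nat)"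
proof -
  assume "j < d" "a < m"
  then have "j * m + a < Suc j * m" by simp
  also have "\<dots> \<le> d * m" using \<open>j < d\<close> by (intro mult_le_mono1) simp
  finally show ?thesis .
qed

lemma graded_diag_mult_vec:
  assumes "u \<in> carrier_vec (d * m)" "j < d" "a < m"
  shows "(graded_diag d m \<zeta> X *\<^sub>v u) $ (j * m + a) = \<zeta> ^ j * (\<Sum>b<m. X $$ (a, b) * u $ (j * m + b))"
proof -
  have "(graded_diag d m \<zeta> X *\<^sub>v u) $ (j * m + a) =
      (\<Sum>k<d * m. graded_diag d m \<zeta> X $$ (j * m + a, k) * u $ k)"
    by (rule index_mult_vec_sum[OF graded_carrier(1)]) (use assms block_index_less in auto)
  also have "\<dots> = (\<Sum>l<d. \<Sum>b<m. graded_diag d m \<zeta> X $$ (j * m + a, l * m + b) * u $ (l * m + b))"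
    by (rule sum_lessThan_mult)
  also have "\<dots> = (\<Sum>l<d. if l = j then \<Sum>b<m. \<zeta> ^ j * X $$ (a, b) * u $ (l * m + b) else 0)"
    using assms(2,3) by (intro sum.cong refl) (auto simp: graded_diag_def block_index_less)
  also have "\<dots> = \<zeta> ^ j * (\<Sum>b<m. X $$ (a, b) * u $ (j * m + b))"
    using assms(2) by (simp add: sum.delta' sum_distrib_left mult.assoc)
  finally show ?thesis .
qed

lemma graded_shift_mult_vec:
  assumes "u \<in> carrier_vec (d * m)" "j < d" "a < m"
  shows "(graded_shift d m Z *\<^sub>v u) $ (j * m + a) =
    (if j = 0 then \<Sum>b<m. Z $$ (a, b) * u $ ((d - 1) * m + b) else u $ ((j - 1) * m + a))"
proof -
  have "(graded_shift d m Z *\<^sub>v u) $ (j * m + a) =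
      (\<Sum>k<d * m. graded_shift d m Z $$ (j * m + a, k) * u $ k)"
    by (rule index_mult_vec_sum[OF graded_carrier(2)]) (use assms block_index_less in auto)
  also have "\<dots> = (\<Sum>l<d. \<Sum>b<m. graded_shift d m Z $$ (j * m + a, l * m + b) * u $ (l * m + b))"
    by (rule sum_lessThan_mult)
  also have "\<dots> = (if j = 0 then \<Sum>b<m. Z $$ (a, b) * u $ ((d - 1) * m + b) else u $ ((j - 1) * m + a))"
  proof (cases "j = 0")
    case True
    have "(\<Sum>l<d. \<Sum>b<m. graded_shift d m Z $$ (j * m + a, l * m + b) * u $ (l * m + b)) =
        (\<Sum>l<d. if l = d - 1 then \<Sum>b<m. Z $$ (a, b) * u $ (l * m + b) else 0)"
      using assms(2,3) True block_index_less[OF assms(2,3)]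
      by (intro sum.cong refl) (auto simp: graded_shift_def block_index_less)
    then show ?thesis using True assms(2) by (simp add: sum.delta')
  next
    case False
    have "(\<Sum>b<m. graded_shift d m Z $$ (j * m + a, l * m + b) * u $ (l * m + b)) =
        (if l = j - 1 then u $ (l * m + a) else 0)" if "l < d" for l
    proof -
      have "(\<Sum>b<m. graded_shift d m Z $$ (j * m + a, l * m + b) * u $ (l * m + b)) =
          (\<Sum>b<m. if b = a then (if l = j - 1 then u $ (l * m + a) else 0) else 0)"
        using assms(2,3) False that
        by (intro sum.cong refl) (auto simp: graded_shift_def block_index_less)
      then show ?thesis using assms(3) by (simp add: sum.delta')
    qed
    then have "(\<Sum>l<d. \<Sum>b<m. graded_shift d m Z $$ (j * m + a, l * m + b) * u $ (l * m + b)) =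
        (\<Sum>l<d. if l = j - 1 then u $ (l * m + a) else 0)" by simp
    then show ?thesis using False assms(2) by (simp add: sum.delta')
  qed
  finally show ?thesis .
qed

lemma eq_vec_blockI:
  assumes "u \<in> carrier_vec (d * m)" "v \<in> carrier_vec (d * m)"
    and "\<And>j a. j < d \<Longrightarrow> a < m \<Longrightarrow> u $ (j * m + a) = v $ (j * m + a)"
  shows "u = v"
proof (rule eq_vecI)
  fix i assume "i < dim_vec v"
  then have "i < d * m" using assms(2) by simp
  moreover from this have "0 < m" by (cases m) auto
  ultimately have "i div m < d" "i mod m < m" by (simp_all add: less_mult_imp_div_less)
  from assms(3)[OF this] show "u $ i = v $ i" by simp
qed (use assms in auto)

text \<open>Going from copy j - 1 to copy j multiplies the weight of \<open>graded_diag\<close> by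
  \<zeta>. At the wrap-around the weight \<zeta>^(d-1) is followed by 1, again a factor \<zeta>
  because \<zeta>^d = 1, and there \<open>Z\<close> has to commute with \<open>X\<close>.\<close>

lemma graded_diag_shift_commute:
  fixes X Z :: "'k::comm_ring_1 mat"
  assumes X: "X \<in> carrier_mat m m" and Z: "Z \<in> carrier_mat m m" and XZ: "X * Z = Z * X"
    and \<zeta>: "\<zeta> ^ d = 1"
  shows "graded_diag d m \<zeta> X * graded_shift d m Z = \<zeta> \<cdot>\<^sub>m (graded_shift d m Z * graded_diag d m \<zeta> X)"
proof (rule eq_mat_mult_vecI[of _ "d * m"])
  let ?D = "graded_diag d m \<zeta> X" and ?S = "graded_shift d m Z"
  fix u :: "'k vec" assume u: "u \<in> carrier_vec (d * m)"
  have Du: "?D *\<^sub>v u \<in> carrier_vec (d * m)" and Su: "?S *\<^sub>v u \<in> carrier_vec (d * m)"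
    by (rule mult_mat_vec_carrier[OF graded_carrier(1) u], rule mult_mat_vec_carrier[OF graded_carrier(2) u])
  have "?D *\<^sub>v (?S *\<^sub>v u) = \<zeta> \<cdot>\<^sub>v (?S *\<^sub>v (?D *\<^sub>v u))"
  proof (rule eq_vec_blockI)
    fix j a assume ja: "j < d" "a < m"
    have lt: "j * m + a < d * m" using ja by (rule block_index_less)
    have dim: "dim_vec (?S *\<^sub>v (?D *\<^sub>v u)) = d * m"
      using carrier_matD(1)[OF graded_carrier(2)] by simp
    show "(?D *\<^sub>v (?S *\<^sub>v u)) $ (j * m + a) = (\<zeta> \<cdot>\<^sub>v (?S *\<^sub>v (?D *\<^sub>v u))) $ (j * m + a)"
    proof (cases "j = 0")
      case True
      have swap: "(\<Sum>b<m. X $$ (a, b) * (\<Sum>c<m. Z $$ (b, c) * x c)) =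
          (\<Sum>b<m. Z $$ (a, b) * (\<Sum>c<m. X $$ (b, c) * x c))" for x
      proof -
        have prod: "(\<Sum>b<m. A $$ (a, b) * (\<Sum>c<m. B $$ (b, c) * x c)) = (\<Sum>c<m. (A * B) $$ (a, c) * x c)"
          if "A \<in> carrier_mat m m" "B \<in> carrier_mat m m" for A B :: "'k mat"
        proof -
          have "(\<Sum>c<m. (A * B) $$ (a, c) * x c) = (\<Sum>c<m. \<Sum>b<m. A $$ (a, b) * B $$ (b, c) * x c)"
            using that ja(2)
            by (intro sum.cong refl) (auto simp: scalar_prod_def lessThan_atLeast0 sum_distrib_right intro!: sum.cong)
          also have "\<dots> = (\<Sum>b<m. \<Sum>c<m. A $$ (a, b) * B $$ (b, c) * x c)" by (rule sum.swap)
          finally show ?thesis by (simp add: sum_distrib_left mult.assoc)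
        qed
        show ?thesis unfolding prod[OF X Z] prod[OF Z X] XZ ..
      qed
      have "\<zeta> * \<zeta> ^ (d - 1) = 1" using \<zeta> ja(1) by (simp flip: power_Suc)
      have "(?S *\<^sub>v (?D *\<^sub>v u)) $ (j * m + a) =
          \<zeta> ^ (d - 1) * (\<Sum>b<m. Z $$ (a, b) * (\<Sum>c<m. X $$ (b, c) * u $ ((d - 1) * m + c)))"
        using True ja graded_shift_mult_vec[OF Du ja, of Z] graded_diag_mult_vec[OF u, of "d - 1"]
        by (simp add: sum_distrib_left mult.left_commute)
      then have "\<zeta> * (?S *\<^sub>v (?D *\<^sub>v u)) $ (j * m + a) =
          (\<Sum>b<m. Z $$ (a, b) * (\<Sum>c<m. X $$ (b, c) * u $ ((d - 1) * m + c)))"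
        using \<open>\<zeta> * \<zeta> ^ (d - 1) = 1\<close> by (simp flip: mult.assoc)
      moreover have "(?D *\<^sub>v (?S *\<^sub>v u)) $ (j * m + a) =
          (\<Sum>b<m. X $$ (a, b) * (\<Sum>c<m. Z $$ (b, c) * u $ ((d - 1) * m + c)))"
        using True ja graded_diag_mult_vec[OF Su ja, of \<zeta> X] graded_shift_mult_vec[OF u ja(1), of _ Z]
        by simp
      ultimately show ?thesis using lt dim swap by simp
    next
      case False
      have "(?D *\<^sub>v (?S *\<^sub>v u)) $ (j * m + a) = \<zeta> ^ j * (\<Sum>b<m. X $$ (a, b) * u $ ((j - 1) * m + b))"
        using False ja graded_diag_mult_vec[OF Su ja, of \<zeta> X] graded_shift_mult_vec[OF u ja(1), of _ Z]
        by simp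
      moreover have "(?S *\<^sub>v (?D *\<^sub>v u)) $ (j * m + a) =
          \<zeta> ^ (j - 1) * (\<Sum>b<m. X $$ (a, b) * u $ ((j - 1) * m + b))"
        using False ja graded_shift_mult_vec[OF Du ja, of Z] graded_diag_mult_vec[OF u, of "j - 1" a] by simp
      moreover have "\<zeta> ^ j = \<zeta> * \<zeta> ^ (j - 1)" using False by (simp flip: power_Suc)
      ultimately show ?thesis using lt dim by (simp add: mult.assoc)
    qed
  qed (use mult_mat_vec_carrier[OF graded_carrier(1) Su] mult_mat_vec_carrier[OF graded_carrier(2) Du]
      in \<open>simp_all add: smult_carrier_vec\<close>)
  then show "?D * ?S *\<^sub>v u = \<zeta> \<cdot>\<^sub>m (?S * ?D) *\<^sub>v u"
    using u assoc_mult_mat_vec[OF graded_carrier(1) graded_carrier(2) u, of \<zeta> X Z]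
      assoc_mult_mat_vec[OF graded_carrier(2) graded_carrier(1) u, of Z \<zeta> X]
      smult_mat_mult_vec[OF mult_carrier_mat[OF graded_carrier(2) graded_carrier(1)] u, of \<zeta> Z \<zeta> X]
    by simp
qed (rule mult_carrier_mat smult_carrier_mat graded_carrier)+

text \<open>Linear independence of the first \<open>n\<close> iterates of \<open>v\<close> under
  \<open>A\<close>, which in dimension \<open>n\<close> makes them a basis.\<close>

definition cyclic_vec :: "nat \<Rightarrow> 'k::comm_ring_1 mat \<Rightarrow> 'k vec \<Rightarrow> bool" where
  "cyclic_vec n A v \<longleftrightarrow> v \<in> carrier_vec n \<and>
     (\<forall>u. (\<forall>i<n. (\<Sum>k<n. u k * (A ^\<^sub>m k *\<^sub>v v) $ i) = 0) \<longrightarrow> (\<forall>k<n. u k = 0))"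

text \<open>A vector that starts in copy 0 is in copy \<open>t mod d\<close> after \<open>t\<close>
  steps and has passed the wrap-around, hence \<open>Z\<close>, \<open>t div d\<close>
  times.\<close>

lemma graded_shift_power_mult_vec:
  assumes Z: "Z \<in> carrier_mat m m" and w: "w \<in> carrier_vec m" and ja: "j < d" "a < m"
  shows "(graded_shift d m Z ^\<^sub>m t *\<^sub>v vec (d * m) (\<lambda>i. if i < m then w $ i else 0)) $ (j * m + a) =
    (if t mod d = j then (Z ^\<^sub>m (t div d) *\<^sub>v w) $ a else 0)"
  using ja
proof (induction t arbitrary: j a)
  case 0
  have "j * m + a < m \<longleftrightarrow> j = 0" using 0 by (cases j) auto
  then show ?case using 0 Z w block_index_less[OF 0] carrier_matD(1)[OF graded_carrier(2), of d m Z] by auto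
next
  case (Suc t)
  let ?S = "graded_shift d m Z" and ?v = "vec (d * m) (\<lambda>i. if i < m then w $ i else 0)"
  have St: "?S ^\<^sub>m t *\<^sub>v ?v \<in> carrier_vec (d * m)"
    by (rule mult_mat_vec_carrier[OF pow_carrier_mat[OF graded_carrier(2)]]) simp
  have step: "(?S ^\<^sub>m Suc t *\<^sub>v ?v) $ (j * m + a) = (if j = 0
      then \<Sum>b<m. Z $$ (a, b) * (?S ^\<^sub>m t *\<^sub>v ?v) $ ((d - 1) * m + b)
      else (?S ^\<^sub>m t *\<^sub>v ?v) $ ((j - 1) * m + a))"
    unfolding pow_mat_Suc_mult_vec[OF graded_carrier(2) vec_carrier]
    by (rule graded_shift_mult_vec[OF St Suc.prems])
  show ?case
  proof (cases "j = 0")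
    case True
    have "(\<Sum>b<m. Z $$ (a, b) * (?S ^\<^sub>m t *\<^sub>v ?v) $ ((d - 1) * m + b)) =
        (\<Sum>b<m. Z $$ (a, b) * (if t mod d = d - 1 then (Z ^\<^sub>m (t div d) *\<^sub>v w) $ b else 0))"
      using Suc.prems by (intro sum.cong refl arg_cong2[where f = "(*)"] Suc.IH) auto
    also have "\<dots> = (if t mod d = d - 1 then (Z ^\<^sub>m Suc (t div d) *\<^sub>v w) $ a else 0)"
      unfolding pow_mat_Suc_mult_vec[OF Z w]
      using index_mult_vec_sum[OF Z mult_mat_vec_carrier[OF pow_carrier_mat[OF Z] w] Suc.prems(2)] by simp
    also have "\<dots> = (if Suc t mod d = j then (Z ^\<^sub>m (Suc t div d) *\<^sub>v w) $ a else 0)"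
      using True Suc.prems by (auto simp: mod_Suc div_Suc)
    finally show ?thesis unfolding step using True by simp
  next
    case False
    have "(?S ^\<^sub>m t *\<^sub>v ?v) $ ((j - 1) * m + a) = (if t mod d = j - 1 then (Z ^\<^sub>m (t div d) *\<^sub>v w) $ a else 0)"
      using Suc.prems False by (intro Suc.IH) auto
    also have "\<dots> = (if Suc t mod d = j then (Z ^\<^sub>m (Suc t div d) *\<^sub>v w) $ a else 0)"
      using False Suc.prems by (auto simp: mod_Suc div_Suc)
    finally show ?thesis unfolding step using False by simp
  qed
qed

text \<open>Only powers with the same residue modulo \<open>d\<close> reach the same copy, so a
  linear relation splits into \<open>d\<close> relations between powers of \<open>Z\<close> applied
  to \<open>w\<close>.\<close>

lemma graded_shift_cyclic:
  assumes Z: "Z \<in> carrier_mat m m" and cyc: "cyclic_vec m Z w"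
  shows "cyclic_vec (d * m) (graded_shift d m Z) (vec (d * m) (\<lambda>i. if i < m then w $ i else 0))"
    (is "cyclic_vec _ ?S ?v")
  unfolding cyclic_vec_def
proof (intro conjI allI impI)
  have w: "w \<in> carrier_vec m" using cyc unfolding cyclic_vec_def by blast
  fix u t assume z: "\<forall>i<d * m. (\<Sum>k<d * m. u k * (?S ^\<^sub>m k *\<^sub>v ?v) $ i) = 0" and t: "t < d * m"
  let ?j = "t mod d"
  have "0 < d" using t by (cases d) auto
  then have j: "?j < d" by simp
  have "(\<Sum>k<m. u (k * d + ?j) * (Z ^\<^sub>m k *\<^sub>v w) $ a) = 0" if a: "a < m" for a
  proof -
    have "0 = (\<Sum>k<d * m. u k * (?S ^\<^sub>m k *\<^sub>v ?v) $ (?j * m + a))"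
      using z block_index_less[OF j a] by simp
    \<comment> \<open>The factors are exchanged because here the exponent is split into full rounds
      \<open>k\<close> and a residue \<open>l\<close>, whereas the vector index was split into
      copies of length \<open>m\<close>.\<close>
    also have "\<dots> = (\<Sum>k<m * d. u k * (if k mod d = ?j then (Z ^\<^sub>m (k div d) *\<^sub>v w) $ a else 0))"
      unfolding graded_shift_power_mult_vec[OF Z w j a] by (simp only: mult.commute[of d m])
    also have "\<dots> = (\<Sum>k<m. \<Sum>l<d. if l = ?j then u (k * d + l) * (Z ^\<^sub>m k *\<^sub>v w) $ a else 0)"
      unfolding sum_lessThan_mult by (intro sum.cong refl) auto
    also have "\<dots> = (\<Sum>k<m. u (k * d + ?j) * (Z ^\<^sub>m k *\<^sub>v w) $ a)"
      using j by simp
    finally show ?thesis by simp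
  qed
  then have "\<forall>k<m. u (k * d + ?j) = 0"
    using conjunct2[OF cyc[unfolded cyclic_vec_def], THEN spec, of "\<lambda>k. u (k * d + ?j)"] by blast
  moreover have "t div d < m" using t by (simp add: less_mult_imp_div_less mult.commute)
  ultimately have "u (t div d * d + ?j) = 0" by blast
  then show "u t = 0" by simp
qed simp

text \<open>Connects the index formula of \<open>graded_diag\<close> with the block diagonal form in
  which Jordan matrices arise.\<close>

lemma diag_block_mat_graded:
  fixes X :: "'k::comm_ring_1 mat"
  assumes X: "X \<in> carrier_mat m m"
  shows "diag_block_mat (map (\<lambda>j. \<zeta> ^ j \<cdot>\<^sub>m X) [0..<d]) = graded_diag d m \<zeta> X"
proof (induction d)
  case 0
  show ?case by (intro eq_matI) (auto simp: graded_diag_def)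
next
  case (Suc d)
  have "diag_block_mat (map (\<lambda>j. \<zeta> ^ j \<cdot>\<^sub>m X) [0..<Suc d]) =
      four_block_mat (graded_diag d m \<zeta> X) (0\<^sub>m (d * m) m) (0\<^sub>m m (d * m)) (\<zeta> ^ d \<cdot>\<^sub>m X)"
    using X carrier_matD[OF graded_carrier(1), of d m \<zeta> X]
    by (simp add: diag_block_mat_last Suc)
  also have "\<dots> = graded_diag (Suc d) m \<zeta> X" (is "?L = ?R")
  proof (rule eq_matI)
    fix i k assume "i < dim_row ?R" "k < dim_col ?R"
    then have ik: "i < d * m + m" "k < d * m + m" by (simp_all add: graded_diag_def add.commute)
    then have m: "0 < m" by (cases m) auto
    have lo: "i div m < d" if "i < d * m" for i using that by (simp add: less_mult_imp_div_less)
    have hi: "i div m = d \<and> i mod m = i - d * m" if "\<not> i < d * m" "i < d * m + m" for i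
    proof -
      define b where "b = i - d * m"
      have "i = d * m + b" "b < m" using that by (auto simp: b_def)
      then show ?thesis by simp
    qed
    show "?L $$ (i, k) = ?R $$ (i, k)"
      using ik X lo[of i] lo[of k] hi[of i] hi[of k]
      by (cases "i < d * m"; cases "k < d * m") (auto simp: graded_diag_def add.commute)
  qed (use X in \<open>auto simp: graded_diag_def\<close>)
  finally show ?case .
qed

lemma similar_four_block_swap:
  fixes A B :: "'k::comm_ring_1 mat"
  assumes A: "A \<in> carrier_mat n n" and B: "B \<in> carrier_mat m m"
  shows "similar_mat (four_block_mat A (0\<^sub>m n m) (0\<^sub>m m n) B) (four_block_mat B (0\<^sub>m m n) (0\<^sub>m n m) A)"
proof (rule similar_matI)
  let ?P = "four_block_mat (0\<^sub>m n m) (1\<^sub>m n) (1\<^sub>m m) (0\<^sub>m m n) :: 'k mat"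
  let ?Q = "four_block_mat (0\<^sub>m m n) (1\<^sub>m m) (1\<^sub>m n) (0\<^sub>m n m) :: 'k mat"
  have z: "(0\<^sub>m n m :: 'k mat) \<in> carrier_mat n m" "(0\<^sub>m m n :: 'k mat) \<in> carrier_mat m n"
    "(1\<^sub>m n :: 'k mat) \<in> carrier_mat n n" "(1\<^sub>m m :: 'k mat) \<in> carrier_mat m m"
    by simp_all
  show "{four_block_mat A (0\<^sub>m n m) (0\<^sub>m m n) B, four_block_mat B (0\<^sub>m m n) (0\<^sub>m n m) A, ?P, ?Q}
      \<subseteq> carrier_mat (n + m) (n + m)"
  proof -
    have "M \<in> carrier_mat (n + m) (n + m)"
      if "dim_row M = n + m" "dim_col M = n + m" for M :: "'k mat"
      using that by (rule carrier_matI)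
    then show ?thesis using A B by simp
  qed
  show "?P * ?Q = 1\<^sub>m (n + m)"
    by (subst mult_four_block_mat[OF z(1,3,4,2) z(2,4,3,1)]) simp
  show "?Q * ?P = 1\<^sub>m (n + m)"
    by (subst mult_four_block_mat[OF z(2,4,3,1) z(1,3,4,2)]) (simp add: add.commute)
  have "?P * four_block_mat B (0\<^sub>m m n) (0\<^sub>m n m) A = four_block_mat (0\<^sub>m n m) A B (0\<^sub>m m n)"
    by (subst mult_four_block_mat[OF z(1,3,4,2) B z(2,1) A]) (use A B in simp)
  then show "four_block_mat A (0\<^sub>m n m) (0\<^sub>m m n) B = ?P * four_block_mat B (0\<^sub>m m n) (0\<^sub>m n m) A * ?Q"
    using mult_four_block_mat[OF z(1) A B z(2) z(2,4,3,1)] A B by simp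
qed

lemma jordan_matrix_append:
  "jordan_matrix (xs @ ys) = four_block_mat (jordan_matrix xs)
     (0\<^sub>m (sum_list (map fst xs)) (sum_list (map fst ys)))
     (0\<^sub>m (sum_list (map fst ys)) (sum_list (map fst xs))) (jordan_matrix ys)"
  using jordan_matrix_dim[of xs] jordan_matrix_dim[of ys]
  unfolding jordan_matrix_def by (simp add: diag_block_mat_append Let_def)

text \<open>By induction the remaining blocks can be reordered; then the head \<open>x\<close> is
  swapped past the blocks \<open>as\<close> that precede it in \<open>ys\<close>.\<close>

lemma similar_jordan_matrix_mset:
  fixes xs ys :: "(nat \<times> 'k::comm_ring_1) list"
  assumes "mset xs = mset ys"
  shows "similar_mat (jordan_matrix xs) (jordan_matrix ys)"
  using assms
proof (induction xs arbitrary: ys)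
  case Nil
  then show ?case by (auto intro: similar_mat_refl[OF jordan_matrix_carrier])
next
  case (Cons x xs)
  then have "x \<in> set ys" by (metis list.set_intros(1) set_mset_mset)
  then obtain as bs where ys: "ys = as @ x # bs" by (meson split_list)
  with Cons.prems have xs: "mset xs = mset (as @ bs)" by simp
  have cong: "similar_mat (jordan_matrix (us @ vs)) (jordan_matrix (us' @ vs'))"
    if "similar_mat (jordan_matrix us) (jordan_matrix us')" "similar_mat (jordan_matrix vs) (jordan_matrix vs')"
      "sum_list (map fst us) = sum_list (map fst us')" "sum_list (map fst vs) = sum_list (map fst vs')"
    for us vs us' vs' :: "(nat \<times> 'k) list"
    using similar_mat_four_block_0_0[OF that(1,2) jordan_matrix_carrier jordan_matrix_carrier] that(3,4)
    unfolding jordan_matrix_append by simp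
  have refl: "similar_mat (jordan_matrix us) (jordan_matrix us)" for us :: "(nat \<times> 'k) list"
    by (rule similar_mat_refl[OF jordan_matrix_carrier])
  have "sum_list (map fst xs) = sum_list (map fst (as @ bs))"
    using xs by (metis mset_map sum_mset_sum_list)
  then have "similar_mat (jordan_matrix ([x] @ xs)) (jordan_matrix ([x] @ (as @ bs)))"
    by (intro cong refl Cons.IH xs) simp_all
  also have "[x] @ (as @ bs) = ([x] @ as) @ bs" by simp
  finally have 1: "similar_mat (jordan_matrix ([x] @ xs)) (jordan_matrix (([x] @ as) @ bs))" .
  have "similar_mat (jordan_matrix ([x] @ as)) (jordan_matrix (as @ [x]))"
    unfolding jordan_matrix_append
    by (rule similar_four_block_swap[OF jordan_matrix_carrier jordan_matrix_carrier])
  then have "similar_mat (jordan_matrix (([x] @ as) @ bs)) (jordan_matrix ((as @ [x]) @ bs))"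
    by (rule cong[OF _ refl]) simp_all
  from similar_mat_trans[OF 1 this] show ?case unfolding ys by simp
qed

section \<open>Triangular form, and existence and uniqueness of the Jordan form\<close>

lemma inverse_mat_exists:
  fixes A :: "'k::field mat"
  assumes A: "A \<in> carrier_mat n n" and det: "det A \<noteq> 0"
  obtains B where "B \<in> carrier_mat n n" "A * B = 1\<^sub>m n" "B * A = 1\<^sub>m n"
  using det_non_zero_imp_unit[OF A det, of "()"] that unfolding Units_def by (auto simp: ring_mat_def)

text \<open>At an index \<open>i\<close> with \<open>v $ i\<close> nonzero, \<open>v\<close> can
  replace the unit vector \<open>i\<close> in the standard basis. It is put into column 0, and the
  unit vector displaced from there takes the vacant column \<open>i\<close>.\<close>

lemma invertible_with_first_col:
  fixes v :: "'k::field vec"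
  assumes v: "v \<in> carrier_vec n" "v \<noteq> 0\<^sub>v n"
  obtains P where "P \<in> carrier_mat n n" "det P \<noteq> 0" "\<And>i. i < n \<Longrightarrow> P $$ (i, 0) = v $ i"
proof -
  have "\<exists>i<n. v $ i \<noteq> 0"
  proof (rule ccontr)
    assume "\<not> ?thesis"
    then have "v = 0\<^sub>v n" using v(1) by (intro eq_vecI) auto
    with v(2) show False ..
  qed
  then obtain i where i: "i < n" "v $ i \<noteq> 0" by blast
  define P where "P = mat n n (\<lambda>(a, b). if b = 0 then v $ a else if b = i then (if a = 0 then 1 else 0)
      else if a = b then 1 else 0)"
  have P: "P \<in> carrier_mat n n" unfolding P_def by simp
  have mult: "(P *\<^sub>v u) $ a = v $ a * u $ 0 + (if i \<noteq> 0 \<and> a = 0 then u $ i else 0) +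
      (if a \<noteq> 0 \<and> a \<noteq> i then u $ a else 0)" if u: "u \<in> carrier_vec n" and a: "a < n" for u a
  proof -
    have "(P *\<^sub>v u) $ a = (\<Sum>b<n. (if b = 0 then v $ a * u $ 0 else 0) +
        (if b = i then (if i \<noteq> 0 \<and> a = 0 then u $ i else 0) else 0) +
        (if b = a then (if a \<noteq> 0 \<and> a \<noteq> i then u $ a else 0) else 0))"
      unfolding index_mult_vec_sum[OF P u a] by (intro sum.cong refl) (use a in \<open>auto simp: P_def\<close>)
    then show ?thesis using a i(1) by (simp add: sum.distrib)
  qed
  have "det P \<noteq> 0"
  proof
    assume "det P = 0"
    then obtain u where u: "u \<in> carrier_vec n" "u \<noteq> 0\<^sub>v n" "P *\<^sub>v u = 0\<^sub>v n"
      using det_0_iff_vec_prod_zero_field[OF P] by blast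
    have eq: "v $ a * u $ 0 + (if i \<noteq> 0 \<and> a = 0 then u $ i else 0) +
        (if a \<noteq> 0 \<and> a \<noteq> i then u $ a else 0) = 0" if "a < n" for a
      using mult[OF u(1) that] u(3) that by simp
    have u0: "u $ 0 = 0" using eq[OF i(1)] i(2) by (auto split: if_splits)
    have "u $ a = 0" if "a < n" for a
      using eq[OF that] eq[of 0] u0 i(1) by (cases "a = 0"; cases "a = i") auto
    then have "u = 0\<^sub>v n" using u(1) by (intro eq_vecI) auto
    with u(2) show False ..
  qed
  with P show ?thesis by (rule that) (simp add: P_def)
qed

text \<open>Taking an eigenvector as the first basis vector clears the first column below the
  diagonal; the induction handles the lower right block \<open>?B4\<close>.\<close>

lemma similar_upper_triangular:
  fixes A :: "'k::alg_closed_field mat"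
  assumes "A \<in> carrier_mat n n"
  shows "\<exists>B\<in>carrier_mat n n. upper_triangular B \<and> similar_mat A B"
  using assms
proof (induction n arbitrary: A)
  case 0
  then show ?case by (intro bexI[of _ A]) (auto intro: similar_mat_refl)
next
  case (Suc n)
  have A: "A \<in> carrier_mat (Suc n) (Suc n)" by fact
  obtain e where "poly (char_poly A) e = 0"
    using alg_closed_imp_poly_has_root[of "char_poly A"] degree_monic_char_poly[OF A] by auto
  then have "eigenvalue A e" using eigenvalue_root_char_poly[OF A] by simp
  then obtain v where v: "v \<in> carrier_vec (Suc n)" "v \<noteq> 0\<^sub>v (Suc n)" "A *\<^sub>v v = e \<cdot>\<^sub>v v"
    using A unfolding eigenvalue_def eigenvector_def by auto
  obtain P where P: "P \<in> carrier_mat (Suc n) (Suc n)" "det P \<noteq> 0"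
    and Pv: "\<And>i. i < Suc n \<Longrightarrow> P $$ (i, 0) = v $ i"
    using invertible_with_first_col[OF v(1,2)] by blast
  obtain Q where Q: "Q \<in> carrier_mat (Suc n) (Suc n)" "P * Q = 1\<^sub>m (Suc n)" "Q * P = 1\<^sub>m (Suc n)"
    using inverse_mat_exists[OF P] by blast
  define B where "B = Q * A * P"
  have B: "B \<in> carrier_mat (Suc n) (Suc n)" using A P Q unfolding B_def by auto
  have "A = P * B * Q"
  proof -
    have "P * B * Q = (P * Q) * A * (P * Q)"
      unfolding B_def using A P(1) Q(1) by (simp add: assoc_mult_mat[of _ "Suc n" "Suc n" _ "Suc n" _ "Suc n"])
    then show ?thesis using A Q(2) by simp
  qed
  then have simB: "similar_mat A B"
    using A B P(1) Q by (intro similar_matI[of _ _ P Q "Suc n"]) auto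
  have col: "col P 0 = v" using P(1) v(1) Pv by (intro eq_vecI) auto
  have "col B 0 = Q *\<^sub>v (A *\<^sub>v v)"
  proof -
    have "col B 0 = (Q * A) *\<^sub>v col P 0" unfolding B_def using A P(1) Q(1) by (intro col_mult2) auto
    then show ?thesis using A Q(1) v(1) by (simp add: col)
  qed
  also have "\<dots> = e \<cdot>\<^sub>v (Q *\<^sub>v v)" unfolding v(3) using Q(1) v(1) by (rule mult_mat_vec)
  also have "Q *\<^sub>v v = col (Q * P) 0" using Q(1) P(1) by (simp add: col_mult2[of _ "Suc n" "Suc n"] col)
  also have "\<dots> = unit_vec (Suc n) 0" unfolding Q(3) by simp
  finally have colB: "col B 0 = e \<cdot>\<^sub>v unit_vec (Suc n) 0" .
  have Bz: "B $$ (i, 0) = 0" if "0 < i" "i < Suc n" for i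
  proof -
    have "B $$ (i, 0) = col B 0 $ i" using B that by simp
    then show ?thesis unfolding colB using that by simp
  qed
  let ?B1 = "mat 1 1 (\<lambda>_. B $$ (0, 0))" and ?B2 = "mat 1 n (\<lambda>(i, j). B $$ (0, Suc j))"
    and ?B4 = "mat n n (\<lambda>(i, j). B $$ (Suc i, Suc j))"
  have split: "B = four_block_mat ?B1 ?B2 (0\<^sub>m n 1) ?B4"
    using B Bz by (intro eq_matI) auto
  have B1: "?B1 \<in> carrier_mat 1 1" and B2: "?B2 \<in> carrier_mat 1 n" and B4: "?B4 \<in> carrier_mat n n"
    by simp_all
  obtain C where C: "C \<in> carrier_mat n n" "upper_triangular C" "similar_mat ?B4 C"
    using Suc.IH[of ?B4] by auto
  \<comment> \<open>The similarity of \<open>?B4\<close> and \<open>C\<close> extends to the whole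
    matrix at the price of changing the upper right block to \<open>D\<close>.\<close>
  obtain D where D: "D \<in> carrier_mat 1 n"
    "similar_mat (four_block_mat ?B1 ?B2 (0\<^sub>m n 1) ?B4) (four_block_mat ?B1 D (0\<^sub>m n 1) C)"
    using similar_mat_four_block_0_ex[OF similar_mat_refl[OF B1] C(3) B2 B1 B4] by blast
  have "upper_triangular (four_block_mat ?B1 D (0\<^sub>m n 1) C)"
    by (rule upper_triangular_four_block[OF _ C(1) _ C(2)]) auto
  moreover have "similar_mat A (four_block_mat ?B1 D (0\<^sub>m n 1) C)"
    using simB D(2) unfolding split[symmetric] by (rule similar_mat_trans)
  moreover have "four_block_mat ?B1 D (0\<^sub>m n 1) C \<in> carrier_mat (Suc n) (Suc n)"
    using C(1) four_block_carrier_mat[of ?B1 1 1 C n n] by auto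
  ultimately show ?case by blast
qed

lemma jordan_nf_exists_alg_closed:
  fixes A :: "'k::alg_closed_field mat"
  assumes "A \<in> carrier_mat n n"
  obtains ns where "jordan_nf A ns"
proof -
  obtain B where B: "B \<in> carrier_mat n n" "upper_triangular B" "similar_mat A B"
    using similar_upper_triangular[OF assms] by blast
  from triangular_to_jnf_vector[OF B(1,2)] have "jordan_nf B (triangular_to_jnf_vector B)" .
  then have "jordan_nf A (triangular_to_jnf_vector B)"
    using similar_mat_trans[OF B(3)] unfolding jordan_nf_def by blast
  then show ?thesis by (rule that)
qed

text \<open>The number of blocks of given positive size and eigenvalue is computed from dimensions
  of generalised eigenspaces, which depend on \<open>A\<close> alone; \<open>jordan_nf\<close>
  excludes blocks of size 0.\<close>

lemma jordan_nf_mset_unique: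
  fixes A :: "'k::field mat"
  assumes "jordan_nf A ns" "jordan_nf A ms"
  shows "mset ns = mset ms"
proof (rule multiset_eqI)
  fix x :: "nat \<times> 'k"
  obtain k e where x: "x = (k, e)" by force
  have len: "length (filter ((=) x) xs) = count (mset xs) x" for xs
    by (induction xs) auto
  show "count (mset ns) x = count (mset ms) x"
  proof (cases "k = 0")
    case True
    then have "x \<notin># mset ns" "x \<notin># mset ms" using assms x unfolding jordan_nf_def by force+
    then show ?thesis by (metis count_eq_zero_iff)
  next
    case False
    show ?thesis
      using compute_nr_of_jordan_blocks[OF assms(1) False, of e] compute_nr_of_jordan_blocks[OF assms(2) False, of e]
      unfolding x[symmetric] len by simp
  qed
qed

text \<open>Multiplication by \<zeta> acts freely on nonzero elements, with orbits of length exactly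
  \<open>d\<close>. Invariance makes the multiplicity constant along an orbit, so whole orbits can
  be removed one at a time; \<open>N\<close> collects a representative of each.\<close>

lemma root_of_unity_orbits:
  fixes \<zeta> :: "'k::field" and M :: "('r \<times> 'k) multiset"
  assumes d: "0 < d" and \<zeta>: "\<zeta> ^ d = 1" and prim: "\<And>e. 0 < e \<Longrightarrow> e < d \<Longrightarrow> \<zeta> ^ e \<noteq> 1"
    and nz: "\<And>r a. (r, a) \<in># M \<Longrightarrow> a \<noteq> 0"
    and inv: "\<And>r a. count M (r, \<zeta> * a) = count M (r, a)"
  shows "\<exists>N. M = (\<Sum>j<d. image_mset (\<lambda>(r, a). (r, \<zeta> ^ j * a)) N)"
  using nz inv
proof (induction "size M" arbitrary: M rule: less_induct)
  case less
  show ?case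
  proof (cases "M = {#}")
    case True
    then show ?thesis by (intro exI[of _ "{#}"]) simp
  next
    case False
    then obtain r a where ra: "(r, a) \<in># M" by (metis multiset_nonemptyE surj_pair)
    have a: "a \<noteq> 0" using less.prems(1) ra by blast
    have \<zeta>0: "\<zeta> \<noteq> 0" using \<zeta> d by (metis power_eq_0_iff zero_neq_one)
    let ?f = "\<lambda>j. (r, \<zeta> ^ j * a)"
    have inj: "inj_on ?f {..<d}"
    proof (rule linorder_inj_onI)
      fix i j assume ij: "i < j" "i \<in> {..<d}" "j \<in> {..<d}"
      show "?f i \<noteq> ?f j"
      proof
        assume "?f i = ?f j"
        then have "\<zeta> ^ i = \<zeta> ^ j" using a by simp
        also have "\<zeta> ^ j = \<zeta> ^ i * \<zeta> ^ (j - i)" using ij(1) by (simp flip: power_add)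
        finally have "\<zeta> ^ (j - i) = 1" using \<zeta>0 by simp
        moreover have "0 < j - i" "j - i < d" using ij by (simp_all add: less_imp_diff_less)
        ultimately show False using prim by blast
      qed
    qed auto
    define orb where "orb = mset_set (?f ` {..<d})"
    have orb: "orb = (\<Sum>j<d. {#?f j#})"
    proof -
      have "(\<Sum>j\<in>J. {#?f j#}) = image_mset ?f (mset_set J)" if "finite J" for J
        using that by induction simp_all
      then show ?thesis by (simp add: orb_def image_mset_mset_set[OF inj])
    qed
    have cM: "count M (r, \<zeta> ^ j * a) = count M (r, a)" for j
      by (induction j) (simp_all add: less.prems(2) mult.assoc)
    have sub: "orb \<subseteq># M"
    proof (rule mset_subset_eqI)
      fix y
      show "count orb y \<le> count M y"
      proof (cases "y \<in> ?f ` {..<d}")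
        case True
        then obtain j where "y = ?f j" by blast
        with cM[of j] ra have "1 \<le> count M y" by (simp add: Suc_le_eq)
        then show ?thesis using True by (simp add: orb_def)
      qed (simp add: orb_def)
    qed
    \<comment> \<open>An orbit is itself invariant, hence so is \<open>M - orb\<close>, and the
      induction hypothesis applies to it.\<close>
    have Oinv: "count orb (s, \<zeta> * b) = count orb (s, b)" for s b
    proof -
      have "(s, \<zeta> * b) \<in> ?f ` {..<d} \<longleftrightarrow> (s, b) \<in> ?f ` {..<d}"
      proof
        assume "(s, \<zeta> * b) \<in> ?f ` {..<d}"
        then obtain j where j: "j < d" "s = r" "\<zeta> * b = \<zeta> ^ j * a" by auto
        show "(s, b) \<in> ?f ` {..<d}"
        proof (cases j)
          case 0
          have "\<zeta> * (\<zeta> ^ (d - 1) * a) = a" using \<zeta> d by (simp flip: mult.assoc power_Suc)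
          with j 0 have "\<zeta> * b = \<zeta> * (\<zeta> ^ (d - 1) * a)" by simp
          then have "b = \<zeta> ^ (d - 1) * a" using \<zeta>0 by simp
          then show ?thesis using j(2) d by (intro image_eqI[of _ _ "d - 1"]) auto
        next
          case (Suc i)
          then have "b = \<zeta> ^ i * a" using j \<zeta>0 by (simp add: mult.assoc)
          then show ?thesis using j Suc by (intro image_eqI[of _ _ i]) auto
        qed
      next
        assume "(s, b) \<in> ?f ` {..<d}"
        then obtain j where j: "j < d" "s = r" "b = \<zeta> ^ j * a" by auto
        show "(s, \<zeta> * b) \<in> ?f ` {..<d}"
        proof (cases "Suc j = d")
          case True
          then have "\<zeta> * b = a" using \<zeta> j by (simp flip: mult.assoc power_Suc)
          then show ?thesis using j d by (intro image_eqI[of _ _ 0]) auto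
        next
          case False
          then show ?thesis using j by (intro image_eqI[of _ _ "Suc j"]) (auto simp: mult.assoc)
        qed
      qed
      then show ?thesis unfolding orb_def count_mset_set' by simp
    qed
    have "size orb > 0" using d by (simp add: orb_def card_image[OF inj])
    then have "size (M - orb) < size M" using sub by (simp add: size_Diff_submset size_mset_mono diff_less Suc_le_eq less_le_trans)
    then have "\<exists>N. M - orb = (\<Sum>j<d. image_mset (\<lambda>(r, a). (r, \<zeta> ^ j * a)) N)"
    proof (rule less.hyps)
      show "b \<noteq> 0" if "(s, b) \<in># M - orb" for s b using less.prems(1) in_diffD[OF that] by blast
      show "count (M - orb) (s, \<zeta> * b) = count (M - orb) (s, b)" for s b
        using less.prems(2) Oinv by simp
    qed
    then obtain N where N: "M - orb = (\<Sum>j<d. image_mset (\<lambda>(r, a). (r, \<zeta> ^ j * a)) N)" by blast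
    have "M = orb + (M - orb)" using sub by simp
    also have "\<dots> = (\<Sum>j<d. {#?f j#}) + (\<Sum>j<d. image_mset (\<lambda>(r, a). (r, \<zeta> ^ j * a)) N)"
      by (simp only: N orb[symmetric])
    also have "\<dots> = (\<Sum>j<d. image_mset (\<lambda>(r, a). (r, \<zeta> ^ j * a)) (add_mset (r, a) N))"
      by (simp add: sum.distrib[symmetric])
    finally show ?thesis by blast
  qed
qed

section \<open>Conjugation, and a cyclic matrix in the twisted centralizer\<close>

lemma conj_mult:
  fixes A B :: "'k::comm_ring_1 mat"
  assumes "A \<in> carrier_mat n n" "B \<in> carrier_mat n n" "P \<in> carrier_mat n n" "Q \<in> carrier_mat n n"
    and QP: "Q * P = 1\<^sub>m n"
  shows "(P * A * Q) * (P * B * Q) = P * (A * B) * Q"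
proof -
  have "(P * A * Q) * (P * B * Q) = P * A * (Q * P) * B * Q"
    using assms(1-4) by (simp add: assoc_mult_mat[of _ n n _ n _ n])
  then show ?thesis unfolding QP using assms(1-4) by (simp add: assoc_mult_mat[of _ n n _ n _ n])
qed

lemma conj_pow_mult_vec:
  fixes A :: "'k::comm_ring_1 mat"
  assumes A: "A \<in> carrier_mat n n" and P: "P \<in> carrier_mat n n" and Q: "Q \<in> carrier_mat n n"
    and QP: "Q * P = 1\<^sub>m n" and v: "v \<in> carrier_vec n"
  shows "(P * A * Q) ^\<^sub>m k *\<^sub>v (P *\<^sub>v v) = P *\<^sub>v (A ^\<^sub>m k *\<^sub>v v)"
proof (induction k)
  case 0
  then show ?case using A P Q v by simp
next
  case (Suc k)
  let ?u = "A ^\<^sub>m k *\<^sub>v v"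
  have u: "?u \<in> carrier_vec n" by (rule mult_mat_vec_carrier[OF pow_carrier_mat[OF A] v])
  have PAQ: "P * A * Q \<in> carrier_mat n n" using A P Q by simp
  have Pv: "P *\<^sub>v v \<in> carrier_vec n" using P v by (rule mult_mat_vec_carrier)
  have "(P * A * Q) ^\<^sub>m Suc k *\<^sub>v (P *\<^sub>v v) = (P * A * Q) *\<^sub>v (P *\<^sub>v ?u)"
    unfolding pow_mat_Suc_mult_vec[OF PAQ Pv] Suc ..
  also have "\<dots> = (P * A) *\<^sub>v ((Q * P) *\<^sub>v ?u)"
    using A P Q u by (simp add: assoc_mult_mat_vec[of _ n n _ n])
  also have "\<dots> = P *\<^sub>v (A *\<^sub>v ?u)"
    unfolding QP using A P u by (simp add: assoc_mult_mat_vec[of _ n n _ n])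
  also have "A *\<^sub>v ?u = A ^\<^sub>m Suc k *\<^sub>v v" using pow_mat_Suc_mult_vec[OF A v] by simp
  finally show ?case .
qed

lemma cyclic_vec_conj:
  fixes A :: "'k::comm_ring_1 mat"
  assumes cyc: "cyclic_vec n A v" and A: "A \<in> carrier_mat n n"
    and P: "P \<in> carrier_mat n n" and Q: "Q \<in> carrier_mat n n" and QP: "Q * P = 1\<^sub>m n"
  shows "cyclic_vec n (P * A * Q) (P *\<^sub>v v)"
  unfolding cyclic_vec_def
proof (intro conjI allI impI)
  have v: "v \<in> carrier_vec n" using cyc unfolding cyclic_vec_def by blast
  show "P *\<^sub>v v \<in> carrier_vec n" using P v by (rule mult_mat_vec_carrier)
  fix u k assume z: "\<forall>i<n. (\<Sum>k<n. u k * ((P * A * Q) ^\<^sub>m k *\<^sub>v (P *\<^sub>v v)) $ i) = 0" and k: "k < n"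
  have "(\<Sum>k<n. u k * (A ^\<^sub>m k *\<^sub>v v) $ i) = 0" if i: "i < n" for i
  proof -
    have Ak: "A ^\<^sub>m k *\<^sub>v v \<in> carrier_vec n" for k
      by (rule mult_mat_vec_carrier[OF pow_carrier_mat[OF A] v])
    have "(A ^\<^sub>m k *\<^sub>v v) $ i = (\<Sum>j<n. Q $$ (i, j) * (P *\<^sub>v (A ^\<^sub>m k *\<^sub>v v)) $ j)" for k
    proof -
      have "A ^\<^sub>m k *\<^sub>v v = (Q * P) *\<^sub>v (A ^\<^sub>m k *\<^sub>v v)" unfolding QP using Ak[of k] by simp
      also have "\<dots> = Q *\<^sub>v (P *\<^sub>v (A ^\<^sub>m k *\<^sub>v v))" using Q P Ak by (rule assoc_mult_mat_vec)
      finally show ?thesis using index_mult_vec_sum[OF Q mult_mat_vec_carrier[OF P Ak] i] by metis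
    qed
    then have "(\<Sum>k<n. u k * (A ^\<^sub>m k *\<^sub>v v) $ i) =
        (\<Sum>k<n. \<Sum>j<n. Q $$ (i, j) * (u k * (P *\<^sub>v (A ^\<^sub>m k *\<^sub>v v)) $ j))"
      by (simp only: sum_distrib_left mult.left_commute)
    also have "\<dots> = (\<Sum>j<n. Q $$ (i, j) * (\<Sum>k<n. u k * (P *\<^sub>v (A ^\<^sub>m k *\<^sub>v v)) $ j))"
      unfolding sum_distrib_left by (rule sum.swap)
    also have "\<dots> = 0"
      using z unfolding conj_pow_mult_vec[OF A P Q QP v] by simp
    finally show ?thesis .
  qed
  then show "u k = 0"
    using conjunct2[OF cyc[unfolded cyclic_vec_def], THEN spec, of u] k by blast
qed

text \<open>The invertibility of \<open>y\<close> makes \<open>x\<close> similar to \<zeta>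
  \<open>x\<close>, and that of \<open>x\<close> keeps its eigenvalues away from 0. The resulting
  \<open>z\<close> may be singular; invertibility is recovered when moving along the line from
  \<open>y\<close> to \<open>z\<close>.\<close>

lemma exists_twisted_commuting_cyclic:
  fixes x y :: "'k::alg_closed_field mat"
  assumes d: "0 < d" and \<zeta>: "\<zeta> ^ d = 1" and prim: "\<And>e. 0 < e \<Longrightarrow> e < d \<Longrightarrow> \<zeta> ^ e \<noteq> 1"
    and x: "x \<in> carrier_mat n n" "det x \<noteq> 0" and y: "y \<in> carrier_mat n n" "det y \<noteq> 0"
    and xy: "x * y = \<zeta> \<cdot>\<^sub>m (y * x)"
  obtains z v where "z \<in> carrier_mat n n" "x * z = \<zeta> \<cdot>\<^sub>m (z * x)" "cyclic_vec n z v"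
proof -
  have \<zeta>0: "\<zeta> \<noteq> 0" using \<zeta> d by (metis power_eq_0_iff zero_neq_one)
  obtain ns where ns: "jordan_nf x ns" using jordan_nf_exists_alg_closed[OF x(1)] .
  obtain q where q: "q \<in> carrier_mat n n" "y * q = 1\<^sub>m n" "q * y = 1\<^sub>m n"
    using inverse_mat_exists[OF y] .
  have "\<zeta> \<cdot>\<^sub>m x = q * x * y"
  proof -
    have "q * x * y = q * (x * y)" using q x y by (simp add: assoc_mult_mat[of _ n n _ n _ n])
    also have "\<dots> = \<zeta> \<cdot>\<^sub>m (q * (y * x))" unfolding xy
      using q x y by (simp add: mult_smult_distrib[of _ n n _ n])
    also have "q * (y * x) = (q * y) * x" using q(1) x y by (simp add: assoc_mult_mat[of _ n n _ n _ n])
    finally show ?thesis unfolding q(3) using x by simp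
  qed
  then have sim: "similar_mat (\<zeta> \<cdot>\<^sub>m x) x"
    using x q y by (intro similar_matI[of _ _ q y n]) auto
  let ?g = "\<lambda>(r::nat, a). (r, \<zeta> * a)"
  \<comment> \<open>\<zeta> \<open>x\<close> has the blocks of \<open>x\<close> with scaled
    eigenvalues, and \<open>x\<close> shares this Jordan form by similarity; uniqueness then gives
    an invariant multiset.\<close>
  have "jordan_nf x (map ?g ns)"
    using jordan_nf_smult[OF ns \<zeta>0] similar_mat_trans[OF similar_mat_sym[OF sim]]
    unfolding jordan_nf_def by blast
  note ms = jordan_nf_mset_unique[OF ns this, unfolded mset_map]
  have inj: "inj ?g" using \<zeta>0 by (auto simp: inj_def)
  have inv: "count (mset ns) (r, \<zeta> * a) = count (mset ns) (r, a)" for r a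
  proof -
    have "count (mset ns) (r, \<zeta> * a) = count (image_mset ?g (mset ns)) (?g (r, a))"
      by (simp flip: ms)
    also have "\<dots> = count (mset ns) (r, a)"
    proof -
      have "count (image_mset f K) (f p) = count K p" if "inj f" for f :: "nat \<times> 'k \<Rightarrow> nat \<times> 'k" and K p
        using that by (induction K) (auto dest: injD)
      then show ?thesis using inj by blast
    qed
    finally show ?thesis .
  qed
  \<comment> \<open>A block with eigenvalue 0 would give \<open>x\<close> a kernel, against
    \<open>det x\<close> being nonzero.\<close>
  have nz: "a \<noteq> 0" if "(r, a) \<in># mset ns" for r a
  proof
    assume "a = 0"
    with that have "(r, 0) \<in> set ns" "r \<noteq> 0" using ns unfolding jordan_nf_def by force+
    then have "poly (char_poly x) 0 = 0"
      using jordan_nf_block_size_order_bound[OF ns, of r 0] by (simp add: order_root)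
    then have "eigenvalue x 0" unfolding eigenvalue_root_char_poly[OF x(1)] .
    then obtain u where "u \<in> carrier_vec n" "u \<noteq> 0\<^sub>v n" "x *\<^sub>v u = 0 \<cdot>\<^sub>v u"
      using x(1) unfolding eigenvalue_def eigenvector_def by auto
    moreover have "0 \<cdot>\<^sub>v u = 0\<^sub>v n" using calculation(1) by auto
    ultimately show False using x(2) det_0_iff_vec_prod_zero_field[OF x(1)] by metis
  qed
  have "\<exists>N. mset ns = (\<Sum>j<d. image_mset (\<lambda>(r, a). (r, \<zeta> ^ j * a)) N)"
    by (rule root_of_unity_orbits[OF d \<zeta>]) (erule (1) prim | erule nz | rule inv)+
  then obtain N where N: "mset ns = (\<Sum>j<d. image_mset (\<lambda>(r, a). (r, \<zeta> ^ j * a)) N)" by (elim exE)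
  obtain L where L: "mset L = N" using ex_mset by blast
  let ?L = "\<lambda>j. map (\<lambda>(r, a). (r, \<zeta> ^ j * a)) L"
  let ?m = "sum_list (map fst L)" and ?X = "jordan_matrix L"
  have X: "?X \<in> carrier_mat ?m ?m" by simp
  have "mset (concat (map ?L [0..<d])) = mset ns"
  proof -
    have "mset (concat (map ?L [0..<e])) = (\<Sum>j<e. image_mset (\<lambda>(r, a). (r, \<zeta> ^ j * a)) N)" for e
      by (induction e) (simp_all add: L)
    then show ?thesis using N by simp
  qed
  then have 1: "similar_mat (jordan_matrix ns) (jordan_matrix (concat (map ?L [0..<d])))"
    by (intro similar_jordan_matrix_mset) simp
  have 2: "similar_mat (jordan_matrix (concat (map ?L [0..<d]))) (graded_diag d ?m \<zeta> ?X)"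
  proof -
    let ?Ms = "map (\<lambda>j. (jordan_matrix (?L j), \<zeta> ^ j \<cdot>\<^sub>m ?X)) [0..<d]"
    have "similar_mat (diag_block_mat (map fst ?Ms)) (diag_block_mat (map snd ?Ms))"
    proof (rule similar_diag_mat_block_mat)
      fix A B assume "(A, B) \<in> set ?Ms"
      then obtain j where "A = jordan_matrix (?L j)" "B = \<zeta> ^ j \<cdot>\<^sub>m ?X" by auto
      then show "similar_mat A B"
        using similar_mat_sym[OF similar_mat_jordan_matrix_smult[of "\<zeta> ^ j" L]] \<zeta>0 by simp
    qed
    then show ?thesis
      unfolding jordan_matrix_concat_diag_block_mat diag_block_mat_graded[OF X, symmetric]
      by (simp add: o_def)
  qed
  have "similar_mat x (jordan_matrix ns)" using ns unfolding jordan_nf_def by simp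
  from similar_mat_trans[OF similar_mat_trans[OF this 1] 2]
  obtain P Q where "similar_mat_wit x (graded_diag d ?m \<zeta> ?X) P Q"
    unfolding similar_mat_def by blast
  from similar_mat_witD2[OF x(1) this] have PQ: "P * Q = 1\<^sub>m n" "Q * P = 1\<^sub>m n"
    "x = P * graded_diag d ?m \<zeta> ?X * Q" "graded_diag d ?m \<zeta> ?X \<in> carrier_mat n n"
    "P \<in> carrier_mat n n" "Q \<in> carrier_mat n n" by auto
  have n: "n = d * ?m" using PQ(4) graded_carrier(1)[of d ?m \<zeta> ?X] by (metis carrier_matD(1))
  \<comment> \<open>\<open>?X\<close> may have several blocks with one eigenvalue and then has no
    cyclic vector. Fresh distinct eigenvalues, available in an infinite field, are put on blocks of
    the same sizes.\<close>
  obtain cs :: "'k list" where cs: "distinct cs" "length cs = length L"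
  proof -
    obtain C :: "'k set" where "card C = length L" "finite C"
      using infinite_arbitrarily_large[OF infinite_UNIV_alg_closed] by blast
    then show ?thesis using that finite_distinct_list distinct_card by metis
  qed
  define ms where "ms = zip (map fst L) cs"
  have ms: "map fst ms = map fst L" "map snd ms = cs" unfolding ms_def using cs(2) by simp_all
  have "fst ` set ms = fst ` set L" using arg_cong[OF ms(1), of set] by simp
  \<comment> \<open>The blocks of \<open>L\<close> occur, as the summand j = 0, among those of
    \<open>ns\<close>, which have positive size.\<close>
  moreover have "0 \<notin> fst ` set L"
  proof
    assume "0 \<in> fst ` set L"
    then obtain a where "(0, a) \<in># N" unfolding L[symmetric] by auto
    then have "(0, \<zeta> ^ 0 * a) \<in># image_mset (\<lambda>(r, a). (r, \<zeta> ^ 0 * a)) N" by force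
    then have "(0, \<zeta> ^ 0 * a) \<in># mset ns"
      unfolding N set_mset_sum[OF finite_lessThan] using d by (intro UN_I[of 0]) simp_all
    then show False using ns unfolding jordan_nf_def by force
  qed
  ultimately have pos: "\<forall>(r, c)\<in>set ms. 0 < r" by force
  let ?Z = "jordan_matrix ms"
  have Z: "?Z \<in> carrier_mat ?m ?m" using jordan_matrix_carrier[of ms] unfolding ms(1) .
  obtain w where w: "w \<in> carrier_vec ?m"
    "\<And>u. (\<And>i. i < ?m \<Longrightarrow> (\<Sum>k<?m. u k * (?Z ^\<^sub>m k *\<^sub>v w) $ i) = 0) \<Longrightarrow> \<forall>k<?m. u k = 0"
    using jordan_matrix_cyclic[OF pos] cs(1) unfolding ms by blast
  have cyc: "cyclic_vec ?m ?Z w" unfolding cyclic_vec_def using w by blast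
  let ?S = "graded_shift d ?m ?Z" and ?D = "graded_diag d ?m \<zeta> ?X"
  note S = graded_carrier(2)[of d ?m ?Z, folded n]
  have comm: "?D * ?S = \<zeta> \<cdot>\<^sub>m (?S * ?D)"
    using jordan_matrix_commute[OF ms(1)] by (intro graded_diag_shift_commute X Z \<zeta>) simp
  have "x * (P * ?S * Q) = P * (?D * ?S) * Q"
    unfolding PQ(3) by (rule conj_mult[OF PQ(4) S PQ(5,6,2)])
  also have "\<dots> = \<zeta> \<cdot>\<^sub>m (P * (?S * ?D) * Q)"
    unfolding comm using PQ(4-6) S
    by (simp add: mult_smult_distrib[of _ n n _ n] mult_smult_assoc_mat[of _ n n _ n])
  also have "P * (?S * ?D) * Q = (P * ?S * Q) * x"
    unfolding PQ(3) by (rule conj_mult[OF S PQ(4) PQ(5,6,2), symmetric])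
  finally have "x * (P * ?S * Q) = \<zeta> \<cdot>\<^sub>m ((P * ?S * Q) * x)" .
  moreover have "P * ?S * Q \<in> carrier_mat n n" using PQ(5,6) S by simp
  moreover note cyclic_vec_conj[OF graded_shift_cyclic[OF Z cyc, of d, folded n] S PQ(5,6,2)]
  ultimately show ?thesis using that by blast
qed

lemma eq_vec_carrierI:
  "u \<in> carrier_vec n \<Longrightarrow> v \<in> carrier_vec n \<Longrightarrow> (\<And>i. i < n \<Longrightarrow> u $ i = v $ i) \<Longrightarrow> u = v"
  by (intro eq_vecI) auto

lemma index_smult_carrier_vec: "u \<in> carrier_vec n \<Longrightarrow> i < n \<Longrightarrow> (k \<cdot>\<^sub>v u) $ i = k * u $ i"
  by simp

section \<open>Pairs with a cyclic vector\<close>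

definition krylov :: "nat \<Rightarrow> 'k::comm_ring_1 mat \<Rightarrow> 'k vec \<Rightarrow> 'k mat" where
  "krylov n y v = mat n n (\<lambda>(i, j). (y ^\<^sub>m j *\<^sub>v v) $ i)"

lemma krylov_carrier [simp]: "krylov n y v \<in> carrier_mat n n"
  by (simp add: krylov_def)

lemma pow_mult_vec_carrier:
  "y \<in> carrier_mat n n \<Longrightarrow> v \<in> carrier_vec n \<Longrightarrow> y ^\<^sub>m k *\<^sub>v v \<in> carrier_vec n"
  by (rule mult_mat_vec_carrier[OF pow_carrier_mat])

lemma krylov_mult_vec:
  assumes "u \<in> carrier_vec n" "i < n"
  shows "(krylov n y v *\<^sub>v u) $ i = (\<Sum>k<n. u $ k * (y ^\<^sub>m k *\<^sub>v v) $ i)"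
  unfolding index_mult_vec_sum[OF krylov_carrier assms]
  by (intro sum.cong refl) (use assms in \<open>simp add: krylov_def mult.commute\<close>)

text \<open>Expresses cyclicity as the nonvanishing of a polynomial in the entries, hence as an open
  condition.\<close>

lemma cyclic_vec_iff_det:
  fixes y :: "'k::field mat"
  assumes v: "v \<in> carrier_vec n"
  shows "cyclic_vec n y v \<longleftrightarrow> det (krylov n y v) \<noteq> 0"
proof
  assume cyc: "cyclic_vec n y v"
  show "det (krylov n y v) \<noteq> 0"
  proof
    assume "det (krylov n y v) = 0"
    then obtain u where u: "u \<in> carrier_vec n" "u \<noteq> 0\<^sub>v n" "krylov n y v *\<^sub>v u = 0\<^sub>v n"
      using det_0_iff_vec_prod_zero_field[OF krylov_carrier] by blast
    have "(\<Sum>k<n. u $ k * (y ^\<^sub>m k *\<^sub>v v) $ i) = 0" if "i < n" for i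
      using krylov_mult_vec[OF u(1) that, of y v] u(3) that by simp
    then have "\<forall>k<n. u $ k = 0"
      using conjunct2[OF cyc[unfolded cyclic_vec_def], THEN spec, of "\<lambda>k. u $ k"] by blast
    then have "u = 0\<^sub>v n" using u(1) by (intro eq_vecI) auto
    with u(2) show False ..
  qed
next
  assume det: "det (krylov n y v) \<noteq> 0"
  have "\<forall>k<n. u k = 0" if z: "\<forall>i<n. (\<Sum>k<n. u k * (y ^\<^sub>m k *\<^sub>v v) $ i) = 0" for u
  proof -
    have "krylov n y v *\<^sub>v vec n u = 0\<^sub>v n"
    proof (rule eq_vecI)
      fix i assume "i < dim_vec (0\<^sub>v n :: 'k vec)"
      then have i: "i < n" by simp
      show "(krylov n y v *\<^sub>v vec n u) $ i = 0\<^sub>v n $ i"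
        using krylov_mult_vec[OF vec_carrier i, of y v u] z i by simp
    qed (simp add: krylov_def)
    then have "vec n u = 0\<^sub>v n"
      using det det_0_iff_vec_prod_zero_field[OF krylov_carrier, of n y v] vec_carrier by blast
    then show ?thesis by (metis index_vec index_zero_vec(1))
  qed
  then show "cyclic_vec n y v" unfolding cyclic_vec_def using v by blast
qed

section \<open>Matrices determined by their action on a cyclic basis\<close>

lemma mult_mat_right_cancel:
  fixes A B :: "'k::field mat"
  assumes A: "A \<in> carrier_mat n n" and B: "B \<in> carrier_mat n n" and H: "H \<in> carrier_mat n n"
    and det: "det H \<noteq> 0" and eq: "A * H = B * H"
  shows "A = B"
proof -
  obtain Q where Q: "Q \<in> carrier_mat n n" "H * Q = 1\<^sub>m n" using inverse_mat_exists[OF H det] .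
  have "A = A * (H * Q)" using A Q by simp
  also have "\<dots> = A * H * Q" using A H Q(1) by (simp add: assoc_mult_mat[of _ n n _ n _ n])
  also have "\<dots> = B * (H * Q)" unfolding eq using B H Q(1) by (simp add: assoc_mult_mat[of _ n n _ n _ n])
  also have "\<dots> = B" using B Q by simp
  finally show ?thesis .
qed

lemma mult_krylov_index:
  fixes A :: "'k::comm_ring_1 mat"
  assumes A: "A \<in> carrier_mat n n" and y: "y \<in> carrier_mat n n" and v: "v \<in> carrier_vec n"
    and ij: "i < n" "j < n"
  shows "(A * krylov n y v) $$ (i, j) = (A *\<^sub>v (y ^\<^sub>m j *\<^sub>v v)) $ i"
proof -
  have "(A * krylov n y v) $$ (i, j) = (\<Sum>l<n. A $$ (i, l) * krylov n y v $$ (l, j))"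
    using A ij carrier_matD[OF krylov_carrier, of n y v]
    by (auto simp: scalar_prod_def lessThan_atLeast0 intro!: sum.cong)
  also have "\<dots> = (\<Sum>l<n. A $$ (i, l) * (y ^\<^sub>m j *\<^sub>v v) $ l)"
    by (intro sum.cong refl) (use ij in \<open>simp add: krylov_def\<close>)
  also have "\<dots> = (A *\<^sub>v (y ^\<^sub>m j *\<^sub>v v)) $ i"
    by (rule index_mult_vec_sum[OF A pow_mult_vec_carrier[OF y v] ij(1), symmetric])
  finally show ?thesis .
qed

text \<open>The vectors in \<open>eq\<close> are the columns of an invertible matrix, which can be
  cancelled on the right.\<close>

lemma cyclic_vec_mat_eqI:
  fixes A B :: "'k::field mat"
  assumes cyc: "cyclic_vec n y v" and y: "y \<in> carrier_mat n n"
    and A: "A \<in> carrier_mat n n" and B: "B \<in> carrier_mat n n"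
    and eq: "\<And>j. j < n \<Longrightarrow> A *\<^sub>v (y ^\<^sub>m j *\<^sub>v v) = B *\<^sub>v (y ^\<^sub>m j *\<^sub>v v)"
  shows "A = B"
proof (rule mult_mat_right_cancel[OF A B krylov_carrier])
  have v: "v \<in> carrier_vec n" using cyc unfolding cyclic_vec_def by blast
  show "det (krylov n y v) \<noteq> 0" using cyc cyclic_vec_iff_det[OF v] by blast
  show "A * krylov n y v = B * krylov n y v"
  proof (rule eq_matI)
    fix i j assume "i < dim_row (B * krylov n y v)" "j < dim_col (B * krylov n y v)"
    then have ij: "i < n" "j < n" using B carrier_matD[OF krylov_carrier, of n y v] by auto
    show "(A * krylov n y v) $$ (i, j) = (B * krylov n y v) $$ (i, j)"
      unfolding mult_krylov_index[OF A y v ij] mult_krylov_index[OF B y v ij] eq[OF ij(2)] ..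
  qed (use A B in auto)
qed

text \<open>A polynomial in \<open>y\<close> whose exponents are listed by \<open>e\<close>. This
  covers full relations, relations in powers with exponent divisible by \<open>d\<close>, and the
  single term \<open>y ^\<^sub>m 0\<close>.\<close>

definition pow_comb :: "nat \<Rightarrow> 'k::comm_ring_1 mat \<Rightarrow> (nat \<Rightarrow> 'k) \<Rightarrow> (nat \<Rightarrow> nat) \<Rightarrow> nat \<Rightarrow> 'k mat" where
  "pow_comb n y c e N = mat n n (\<lambda>(r, s). \<Sum>l<N. c l * (y ^\<^sub>m e l) $$ (r, s))"

lemma pow_comb_carrier [simp]: "pow_comb n y c e N \<in> carrier_mat n n"
  by (simp add: pow_comb_def)

lemma pow_comb_mult_vec:
  assumes y: "y \<in> carrier_mat n n" and u: "u \<in> carrier_vec n" and i: "i < n"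
  shows "(pow_comb n y c e N *\<^sub>v u) $ i = (\<Sum>l<N. c l * (y ^\<^sub>m e l *\<^sub>v u) $ i)"
proof -
  have "(pow_comb n y c e N *\<^sub>v u) $ i = (\<Sum>s<n. \<Sum>l<N. c l * ((y ^\<^sub>m e l) $$ (i, s) * u $ s))"
    unfolding index_mult_vec_sum[OF pow_comb_carrier u i]
    by (intro sum.cong refl) (use i in \<open>simp add: pow_comb_def sum_distrib_right mult.assoc\<close>)
  also have "\<dots> = (\<Sum>l<N. c l * (\<Sum>s<n. (y ^\<^sub>m e l) $$ (i, s) * u $ s))"
    unfolding sum_distrib_left by (rule sum.swap)
  finally show ?thesis by (simp only: index_mult_vec_sum[OF pow_carrier_mat[OF y] u i])
qed

lemma mult_vec_comb:
  assumes A: "A \<in> carrier_mat n n" and u: "u \<in> carrier_vec n" and t: "\<And>l. l < N \<Longrightarrow> t l \<in> carrier_vec n"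
    and eq: "\<And>s. s < n \<Longrightarrow> u $ s = (\<Sum>l<N. c l * t l $ s)" and i: "i < n"
  shows "(A *\<^sub>v u) $ i = (\<Sum>l<N. c l * (A *\<^sub>v t l) $ i :: 'k::comm_ring_1)"
proof -
  have "(A *\<^sub>v u) $ i = (\<Sum>s<n. \<Sum>l<N. c l * (A $$ (i, s) * t l $ s))"
    unfolding index_mult_vec_sum[OF A u i]
    by (intro sum.cong refl) (simp add: eq sum_distrib_left mult.left_commute)
  also have "\<dots> = (\<Sum>l<N. c l * (\<Sum>s<n. A $$ (i, s) * t l $ s))"
    unfolding sum_distrib_left by (rule sum.swap)
  also have "\<dots> = (\<Sum>l<N. c l * (A *\<^sub>v t l) $ i)"
    by (intro sum.cong refl) (simp add: index_mult_vec_sum[OF A t i] del: index_mult_mat_vec)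
  finally show ?thesis .
qed

lemma pow_mat_mult_vec_add:
  assumes y: "y \<in> carrier_mat n n" and v: "v \<in> carrier_vec n"
  shows "y ^\<^sub>m k *\<^sub>v (y ^\<^sub>m j *\<^sub>v v) = y ^\<^sub>m (k + j) *\<^sub>v v"
proof (induction k)
  case 0
  then show ?case using pow_mult_vec_carrier[OF y v, of j] y by simp
next
  case (Suc k)
  show ?case
    unfolding add_Suc pow_mat_Suc_mult_vec[OF y pow_mult_vec_carrier[OF y v]] pow_mat_Suc_mult_vec[OF y v] Suc ..
qed

text \<open>Cayley--Hamilton for a cyclic vector: a relation between \<open>y\<^sup>n v\<close> and lower powers
  holds for all vectors, since both sides commute with \<open>y\<close>.\<close>

lemma cyclic_vec_pow_relation:
  fixes y :: "'k::field mat" and N :: nat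
  assumes cyc: "cyclic_vec n y v" and y: "y \<in> carrier_mat n n"
    and rel: "\<And>i. i < n \<Longrightarrow> (y ^\<^sub>m n *\<^sub>v v) $ i = (\<Sum>l<N. c l * (y ^\<^sub>m e l *\<^sub>v v) $ i)"
    and u: "u \<in> carrier_vec n" and i: "i < n"
  shows "(y ^\<^sub>m n *\<^sub>v u) $ i = (\<Sum>l<N. c l * (y ^\<^sub>m e l *\<^sub>v u) $ i)"
proof -
  have v: "v \<in> carrier_vec n" using cyc unfolding cyclic_vec_def by blast
  let ?C = "pow_comb n y c e N"
  have "y ^\<^sub>m n = ?C"
  proof (rule cyclic_vec_mat_eqI[OF cyc y pow_carrier_mat[OF y] pow_comb_carrier])
    fix j assume j: "j < n"
    note yj = pow_mult_vec_carrier[OF y v, of j]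
    show "y ^\<^sub>m n *\<^sub>v (y ^\<^sub>m j *\<^sub>v v) = ?C *\<^sub>v (y ^\<^sub>m j *\<^sub>v v)"
    proof (rule eq_vecI)
      fix i assume "i < dim_vec (?C *\<^sub>v (y ^\<^sub>m j *\<^sub>v v))"
      then have i: "i < n" using carrier_matD(1)[OF pow_comb_carrier, of n y c e N] by simp
      have "(y ^\<^sub>m n *\<^sub>v (y ^\<^sub>m j *\<^sub>v v)) $ i = (y ^\<^sub>m j *\<^sub>v (y ^\<^sub>m n *\<^sub>v v)) $ i"
        by (simp only: pow_mat_mult_vec_add[OF y v] add.commute)
      also have "\<dots> = (\<Sum>l<N. c l * (y ^\<^sub>m j *\<^sub>v (y ^\<^sub>m e l *\<^sub>v v)) $ i)"
        by (rule mult_vec_comb[OF pow_carrier_mat[OF y] pow_mult_vec_carrier[OF y v]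
              pow_mult_vec_carrier[OF y v] rel i])
      also have "\<dots> = (\<Sum>l<N. c l * (y ^\<^sub>m e l *\<^sub>v (y ^\<^sub>m j *\<^sub>v v)) $ i)"
        by (simp only: pow_mat_mult_vec_add[OF y v] add.commute)
      also have "\<dots> = (?C *\<^sub>v (y ^\<^sub>m j *\<^sub>v v)) $ i"
        by (rule pow_comb_mult_vec[OF y yj i, symmetric])
      finally show "(y ^\<^sub>m n *\<^sub>v (y ^\<^sub>m j *\<^sub>v v)) $ i = (?C *\<^sub>v (y ^\<^sub>m j *\<^sub>v v)) $ i" .
    qed (use y carrier_matD(1)[OF pow_comb_carrier, of n y c e N] pow_carrier_mat[OF y, of n] in simp)
  qed
  then show ?thesis using pow_comb_mult_vec[OF y u i, of c e N] by simp
qed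

lemma twisted_pow_mult_vec:
  fixes x y :: "'k::field mat"
  assumes x: "x \<in> carrier_mat n n" and y: "y \<in> carrier_mat n n" and v: "v \<in> carrier_vec n"
    and xy: "x * y = \<zeta> \<cdot>\<^sub>m (y * x)"
  shows "x *\<^sub>v (y ^\<^sub>m k *\<^sub>v v) = \<zeta> ^ k \<cdot>\<^sub>v (y ^\<^sub>m k *\<^sub>v (x *\<^sub>v v))"
proof (induction k)
  case 0
  then show ?case using x y v by simp
next
  case (Suc k)
  let ?u = "y ^\<^sub>m k *\<^sub>v v" and ?w = "x *\<^sub>v v"
  have u: "?u \<in> carrier_vec n" and w: "?w \<in> carrier_vec n"
    using pow_mult_vec_carrier[OF y v] mult_mat_vec_carrier[OF x v] by auto
  have "x *\<^sub>v (y ^\<^sub>m Suc k *\<^sub>v v) = (x * y) *\<^sub>v ?u"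
    unfolding pow_mat_Suc_mult_vec[OF y v] by (rule assoc_mult_mat_vec[OF x y u, symmetric])
  also have "\<dots> = \<zeta> \<cdot>\<^sub>v (y *\<^sub>v (x *\<^sub>v ?u))"
    unfolding xy smult_mat_mult_vec[OF mult_carrier_mat[OF y x] u] assoc_mult_mat_vec[OF y x u] ..
  also have "\<dots> = \<zeta> \<cdot>\<^sub>v (\<zeta> ^ k \<cdot>\<^sub>v (y *\<^sub>v (y ^\<^sub>m k *\<^sub>v ?w)))"
    unfolding Suc mult_mat_vec[OF y pow_mult_vec_carrier[OF y w]] ..
  also have "\<dots> = \<zeta> ^ Suc k \<cdot>\<^sub>v (y ^\<^sub>m Suc k *\<^sub>v ?w)"
    unfolding pow_mat_Suc_mult_vec[OF y w] by (simp add: smult_smult_assoc)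
  finally show ?case .
qed

text \<open>Cramer's rule shows that the entries of the inverse are rational functions.\<close>

definition cramer_inv :: "nat \<Rightarrow> 'k::field mat \<Rightarrow> 'k mat" where
  "cramer_inv n A = mat n n (\<lambda>(i, j). det (replace_col A (unit_vec n j) i) / det A)"

lemma cramer_inv_carrier [simp]: "cramer_inv n A \<in> carrier_mat n n"
  by (simp add: cramer_inv_def)

lemma cramer_inv_eq:
  assumes A: "A \<in> carrier_mat n n" and B: "B \<in> carrier_mat n n" and AB: "A * B = 1\<^sub>m n"
  shows "cramer_inv n A = B"
proof (rule eq_matI)
  have "det A * det B = 1" using det_mult[OF A B] AB by simp
  then have det: "det A \<noteq> 0" by auto
  fix i j assume "i < dim_row B" "j < dim_col B"
  then have ij: "i < n" "j < n" using B by auto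
  have "A *\<^sub>v col B j = unit_vec n j"
    using col_mult2[OF A B ij(2)] ij unfolding AB by simp
  then have "det (replace_col A (unit_vec n j) i) = B $$ (i, j) * det A"
    using cramer_lemma_mat[OF A _ ij(1), of "col B j"] B ij by (simp add: col_carrier_vec)
  then show "cramer_inv n A $$ (i, j) = B $$ (i, j)" using det ij by (simp add: cramer_inv_def)
qed (use B in \<open>auto simp: cramer_inv_def\<close>)

lemma cramer_inv:
  assumes A: "A \<in> carrier_mat n n" and det: "det A \<noteq> 0"
  shows "A * cramer_inv n A = 1\<^sub>m n" "cramer_inv n A * A = 1\<^sub>m n"
proof -
  obtain B where B: "B \<in> carrier_mat n n" "A * B = 1\<^sub>m n" "B * A = 1\<^sub>m n"
    using inverse_mat_exists[OF A det] .
  then show "A * cramer_inv n A = 1\<^sub>m n" "cramer_inv n A * A = 1\<^sub>m n"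
    using cramer_inv_eq[OF A B(1,2)] by auto
qed

lemma mult_cramer_inv_cancel:
  assumes A: "A \<in> carrier_mat n n" and "det A \<noteq> 0" and M: "M \<in> carrier_mat n n"
  shows "M * cramer_inv n A * A = M" "M * A * cramer_inv n A = M"
  using assoc_mult_mat[OF M cramer_inv_carrier A] assoc_mult_mat[OF M A cramer_inv_carrier]
    cramer_inv[OF assms(1,2)] M by auto

locale root_of_unity_pairs =
  fixes n d :: nat and \<zeta> :: "'k::alg_closed_field"
  assumes n_pos: "0 < n" and d_pos: "0 < d" and d_dvd: "d dvd n"
    and root: "\<zeta> ^ d = 1" and prim: "\<And>e. 0 < e \<Longrightarrow> e < d \<Longrightarrow> \<zeta> ^ e \<noteq> 1"
begin

definition pairs :: "('k mat \<times> 'k mat) set" where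
  "pairs = {(x, y). x \<in> carrier_mat n n \<and> y \<in> carrier_mat n n \<and> det x \<noteq> 0 \<and> det y \<noteq> 0 \<and>
     x * y = \<zeta> \<cdot>\<^sub>m (y * x)}"

abbreviation e0 :: "'k vec" where "e0 \<equiv> unit_vec n 0"

text \<open>The parameters of a pair for which \<open>e0\<close> is a cyclic vector of \<open>y\<close> are the vectors
  \<open>x e0, y e0, \<dots>, y\<^sup>n\<^sup>-\<^sup>1 e0\<close>, stored as the columns of an \<open>n \<times> n\<close> matrix, and the
  coefficients of \<open>y\<^sup>n e0\<close> as a combination of the \<open>y\<^sup>d\<^sup>l e0\<close>.\<close>

definition basis_mat :: "((nat \<times> nat) + nat \<Rightarrow> 'k) \<Rightarrow> 'k mat" where
  "basis_mat a = mat n n (\<lambda>(i, j). if j = 0 then (if i = 0 then 1 else 0) else a (Inl (i, j)))"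

text \<open>What \<open>y\<close> does to the columns of the basis: each goes to the next one, and
  the last goes to the prescribed combination. In that basis \<open>y\<close> is a companion
  matrix.\<close>

definition image_mat :: "((nat \<times> nat) + nat \<Rightarrow> 'k) \<Rightarrow> 'k mat" where
  "image_mat a = mat n n (\<lambda>(i, j). if Suc j < n then basis_mat a $$ (i, Suc j)
     else \<Sum>l<n div d. a (Inr l) * basis_mat a $$ (i, d * l))"

definition param_y :: "((nat \<times> nat) + nat \<Rightarrow> 'k) \<Rightarrow> 'k mat" where
  "param_y a = image_mat a * cramer_inv n (basis_mat a)"

text \<open>This is \<open>x e0\<close>. Column 0 of \<open>basis_mat\<close> is constantly
  \<open>e0\<close>, so the variables \<open>Inl (i, 0)\<close> are free to store it.\<close>

definition param_w :: "((nat \<times> nat) + nat \<Rightarrow> 'k) \<Rightarrow> 'k vec" where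
  "param_w a = vec n (\<lambda>i. a (Inl (i, 0)))"

text \<open>With \<open>w\<close> in the role of \<open>x e0\<close>, column \<open>j\<close> is the
  value that the twisted relation forces on \<open>x\<close> at
  \<open>y ^\<^sub>m j *\<^sub>v e0\<close>.\<close>

definition twisted_krylov :: "'k mat \<Rightarrow> 'k vec \<Rightarrow> 'k mat" where
  "twisted_krylov y w = mat n n (\<lambda>(i, j). \<zeta> ^ j * (y ^\<^sub>m j *\<^sub>v w) $ i)"

definition param_x :: "((nat \<times> nat) + nat \<Rightarrow> 'k) \<Rightarrow> 'k mat" where
  "param_x a = twisted_krylov (param_y a) (param_w a) * cramer_inv n (basis_mat a)"

definition param_domain :: "((nat \<times> nat) + nat \<Rightarrow> 'k) set" where
  "param_domain = {a. det (basis_mat a) \<noteq> 0 \<and> det (param_y a) \<noteq> 0 \<and> det (param_x a) \<noteq> 0}"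

section \<open>From parameters to pairs and back\<close>

lemma param_carrier [simp]:
  "basis_mat a \<in> carrier_mat n n" "image_mat a \<in> carrier_mat n n" "twisted_krylov y w \<in> carrier_mat n n"
  "param_w a \<in> carrier_vec n"
  by (simp_all add: basis_mat_def image_mat_def twisted_krylov_def param_w_def)

lemma param_xy_carrier [simp]: "param_y a \<in> carrier_mat n n" "param_x a \<in> carrier_mat n n"
  unfolding param_y_def param_x_def by (rule mult_carrier_mat[of _ n n], simp, simp)+

lemma root_nonzero: "\<zeta> \<noteq> 0"
  using root d_pos by (metis power_eq_0_iff zero_neq_one)

lemma root_power_mult: "\<zeta> ^ (d * l) = 1"
  by (simp add: power_mult root)

lemma root_power_n: "\<zeta> ^ n = 1"
  using d_dvd root_power_mult by (metis dvdE)

lemma root_power_eq_1_iff: "\<zeta> ^ i = 1 \<longleftrightarrow> d dvd i"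
proof
  assume eq: "\<zeta> ^ i = 1"
  have "\<zeta> ^ i = \<zeta> ^ (d * (i div d)) * \<zeta> ^ (i mod d)" by (simp flip: power_add)
  then have "\<zeta> ^ (i mod d) = 1" using eq by (simp add: root_power_mult)
  then have "i mod d = 0" using prim[of "i mod d"] d_pos by auto
  then show "d dvd i" by auto
qed (auto simp: root_power_mult elim!: dvdE)

lemma block_less: "l < n div d \<Longrightarrow> d * l < n"
  using d_dvd d_pos by (metis dvd_mult_div_cancel mult_less_cancel1)

lemma sum_multiples: "(\<Sum>k<n. if d dvd k then f k else 0) = (\<Sum>l<n div d. f (d * l))"
proof -
  have "(\<Sum>k<n. if d dvd k then f k else 0) = (\<Sum>k\<in>(\<lambda>l. d * l) ` {..<n div d}. if d dvd k then f k else 0)"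
  proof (rule sum.mono_neutral_right)
    show "(\<lambda>l. d * l) ` {..<n div d} \<subseteq> {..<n}" using block_less by auto
    show "\<forall>k\<in>{..<n} - (\<lambda>l. d * l) ` {..<n div d}. (if d dvd k then f k else 0) = 0"
    proof
      fix k assume k: "k \<in> {..<n} - (\<lambda>l. d * l) ` {..<n div d}"
      have "\<not> d dvd k"
      proof
        assume "d dvd k"
        then obtain l where "k = d * l" by (rule dvdE)
        moreover from this have "l < n div d"
          using k d_dvd d_pos by (auto elim!: dvdE)
        ultimately show False using k by blast
      qed
      then show "(if d dvd k then f k else 0) = 0" by simp
    qed
  qed simp
  also have "\<dots> = (\<Sum>l<n div d. f (d * l))"
    using d_pos by (subst sum.reindex) (auto simp: inj_on_def)
  finally show ?thesis .
qed

lemma param_y_mult: "det (basis_mat a) \<noteq> 0 \<Longrightarrow> param_y a * basis_mat a = image_mat a"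
  unfolding param_y_def by (rule mult_cramer_inv_cancel) simp_all

lemma param_x_mult:
  "det (basis_mat a) \<noteq> 0 \<Longrightarrow> param_x a * basis_mat a = twisted_krylov (param_y a) (param_w a)"
  unfolding param_x_def by (rule mult_cramer_inv_cancel) simp_all

lemma e0_carrier: "e0 \<in> carrier_vec n" by simp

lemma param_y_pow_e0:
  assumes det: "det (basis_mat a) \<noteq> 0" and j: "j < n"
  shows "param_y a ^\<^sub>m j *\<^sub>v e0 = col (basis_mat a) j"
  using j
proof (induction j)
  case 0
  have "col (basis_mat a) 0 = e0" using 0 by (intro eq_vecI) (auto simp: basis_mat_def)
  then show ?case using carrier_matD[OF param_xy_carrier(1), of a] by simp
next
  case (Suc j)
  have "param_y a ^\<^sub>m Suc j *\<^sub>v e0 = param_y a *\<^sub>v col (basis_mat a) j"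
    unfolding pow_mat_Suc_mult_vec[OF param_xy_carrier(1) e0_carrier] using Suc by simp
  also have "\<dots> = col (image_mat a) j"
    using Suc.prems by (simp add: col_mult2[of _ n n _ n, symmetric] param_y_mult[OF det])
  also have "\<dots> = col (basis_mat a) (Suc j)"
    using Suc.prems by (intro eq_vecI) (auto simp: image_mat_def basis_mat_def)
  finally show ?case .
qed

lemma param_y_pow_n:
  assumes det: "det (basis_mat a) \<noteq> 0" and i: "i < n"
  shows "(param_y a ^\<^sub>m n *\<^sub>v e0) $ i = (\<Sum>l<n div d. a (Inr l) * (param_y a ^\<^sub>m (d * l) *\<^sub>v e0) $ i)"
proof -
  obtain n' where n': "Suc n' = n" using n_pos by (cases n) auto
  have n'_less: "n' < n" and n'_last: "\<not> Suc n' < n" using n' by auto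
  have "param_y a ^\<^sub>m n *\<^sub>v e0 = param_y a *\<^sub>v (param_y a ^\<^sub>m n' *\<^sub>v e0)"
    using pow_mat_Suc_mult_vec[OF param_xy_carrier(1) e0_carrier, of a n'] unfolding n' .
  also have "\<dots> = param_y a *\<^sub>v col (basis_mat a) n'" unfolding param_y_pow_e0[OF det n'_less] ..
  also have "\<dots> = col (image_mat a) n'"
    unfolding col_mult2[OF param_xy_carrier(1) param_carrier(1) n'_less, symmetric] param_y_mult[OF det] ..
  finally have "(param_y a ^\<^sub>m n *\<^sub>v e0) $ i = (\<Sum>l<n div d. a (Inr l) * basis_mat a $$ (i, d * l))"
    using i n'_less n'_last by (simp add: image_mat_def)
  also have "\<dots> = (\<Sum>l<n div d. a (Inr l) * (param_y a ^\<^sub>m (d * l) *\<^sub>v e0) $ i)"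
  proof (intro sum.cong refl)
    fix l assume "l \<in> {..<n div d}"
    then have "d * l < n" using block_less by simp
    then show "a (Inr l) * basis_mat a $$ (i, d * l) = a (Inr l) * (param_y a ^\<^sub>m (d * l) *\<^sub>v e0) $ i"
      using i carrier_matD[OF param_carrier(1), of a] by (simp add: param_y_pow_e0[OF det])
  qed
  finally show ?thesis .
qed

lemma param_krylov:
  assumes det: "det (basis_mat a) \<noteq> 0"
  shows "krylov n (param_y a) e0 = basis_mat a"
proof (rule eq_matI)
  fix i j assume "i < dim_row (basis_mat a)" "j < dim_col (basis_mat a)"
  then have ij: "i < n" "j < n" using carrier_matD[OF param_carrier(1), of a] by auto
  then show "krylov n (param_y a) e0 $$ (i, j) = basis_mat a $$ (i, j)"
    using carrier_matD[OF param_carrier(1), of a] by (simp add: krylov_def param_y_pow_e0[OF det])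
qed (simp_all add: krylov_def basis_mat_def)

lemma param_cyclic:
  assumes "det (basis_mat a) \<noteq> 0" shows "cyclic_vec n (param_y a) e0"
  using assms cyclic_vec_iff_det[OF e0_carrier, of "param_y a"] param_krylov[OF assms] by simp

lemma param_x_pow_e0:
  assumes det: "det (basis_mat a) \<noteq> 0" and j: "j < n"
  shows "param_x a *\<^sub>v (param_y a ^\<^sub>m j *\<^sub>v e0) = \<zeta> ^ j \<cdot>\<^sub>v (param_y a ^\<^sub>m j *\<^sub>v param_w a)"
proof -
  have "param_x a *\<^sub>v (param_y a ^\<^sub>m j *\<^sub>v e0) = col (param_x a * basis_mat a) j"
    unfolding param_y_pow_e0[OF det j] using col_mult2[OF param_xy_carrier(2) param_carrier(1) j] ..
  also have "\<dots> = \<zeta> ^ j \<cdot>\<^sub>v (param_y a ^\<^sub>m j *\<^sub>v param_w a)"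
    unfolding param_x_mult[OF det]
  proof (rule eq_vecI)
    have dim: "dim_vec (param_y a ^\<^sub>m j *\<^sub>v param_w a) = n"
      by (rule carrier_vecD[OF pow_mult_vec_carrier[OF param_xy_carrier(1) param_carrier(4)]])
    show "dim_vec (col (twisted_krylov (param_y a) (param_w a)) j) = dim_vec (\<zeta> ^ j \<cdot>\<^sub>v (param_y a ^\<^sub>m j *\<^sub>v param_w a))"
      using dim by (simp add: twisted_krylov_def)
    fix i assume "i < dim_vec (\<zeta> ^ j \<cdot>\<^sub>v (param_y a ^\<^sub>m j *\<^sub>v param_w a))"
    then have "i < n" using dim by simp
    then show "col (twisted_krylov (param_y a) (param_w a)) j $ i = (\<zeta> ^ j \<cdot>\<^sub>v (param_y a ^\<^sub>m j *\<^sub>v param_w a)) $ i"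
      using j dim by (simp add: twisted_krylov_def del: index_mult_mat_vec)
  qed
  finally show ?thesis .
qed

text \<open>On the basis vectors before the last one the relation holds by construction. At the last
  one it requires \<open>x\<close> applied to the n-th iterate of \<open>e0\<close> to be the n-th
  iterate of \<open>w\<close>. That iterate of \<open>e0\<close> combines only exponents divisible
  by \<open>d\<close>, whose twist is 1, and \<zeta>^n = 1 as well, so the relation for
  \<open>y ^\<^sub>m n\<close> applied to \<open>w\<close> closes the cycle.\<close>

lemma param_commute:
  assumes det: "det (basis_mat a) \<noteq> 0"
  shows "param_x a * param_y a = \<zeta> \<cdot>\<^sub>m (param_y a * param_x a)"
proof -
  let ?x = "param_x a" and ?y = "param_y a" and ?w = "param_w a"
  note x = param_xy_carrier(2)[of a] and y = param_xy_carrier(1)[of a] and w = param_carrier(4)[of a]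
  note yk = pow_mult_vec_carrier[OF y e0_carrier] and wk = pow_mult_vec_carrier[OF y w]
  have next_step: "?x *\<^sub>v (?y ^\<^sub>m Suc j *\<^sub>v e0) = \<zeta> ^ Suc j \<cdot>\<^sub>v (?y ^\<^sub>m Suc j *\<^sub>v ?w)" if j: "j < n" for j
  proof (cases "Suc j < n")
    case True
    then show ?thesis by (rule param_x_pow_e0[OF det])
  next
    case False
    with j have Suc: "Suc j = n" by simp
    have "(?x *\<^sub>v (?y ^\<^sub>m n *\<^sub>v e0)) $ i = (\<zeta> ^ n \<cdot>\<^sub>v (?y ^\<^sub>m n *\<^sub>v ?w)) $ i" if i: "i < n" for i
    proof -
      have "(?x *\<^sub>v (?y ^\<^sub>m n *\<^sub>v e0)) $ i = (\<Sum>l<n div d. a (Inr l) * (?x *\<^sub>v (?y ^\<^sub>m (d * l) *\<^sub>v e0)) $ i)"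
        by (rule mult_vec_comb[OF x yk yk param_y_pow_n[OF det] i])
      also have "\<dots> = (\<Sum>l<n div d. a (Inr l) * (?y ^\<^sub>m (d * l) *\<^sub>v ?w) $ i)"
        by (intro sum.cong refl) (use block_less i wk in \<open>simp add: param_x_pow_e0[OF det] root_power_mult del: index_mult_mat_vec\<close>)
      also have "\<dots> = (?y ^\<^sub>m n *\<^sub>v ?w) $ i"
        by (rule cyclic_vec_pow_relation[OF param_cyclic[OF det] y param_y_pow_n[OF det] w i, symmetric])
      finally show ?thesis by (simp add: root_power_n)
    qed
    then show ?thesis unfolding Suc
      by (rule eq_vec_carrierI[OF mult_mat_vec_carrier[OF x yk] smult_carrier_vec[THEN iffD2, OF wk]])
  qed
  show ?thesis
  proof (rule cyclic_vec_mat_eqI[OF param_cyclic[OF det] y mult_carrier_mat[OF x y] smult_carrier_mat[OF mult_carrier_mat[OF y x]]])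
    fix j assume j: "j < n"
    have "?x * ?y *\<^sub>v (?y ^\<^sub>m j *\<^sub>v e0) = ?x *\<^sub>v (?y ^\<^sub>m Suc j *\<^sub>v e0)"
      unfolding pow_mat_Suc_mult_vec[OF y e0_carrier] by (rule assoc_mult_mat_vec[OF x y yk])
    also have "\<dots> = \<zeta> \<cdot>\<^sub>v (\<zeta> ^ j \<cdot>\<^sub>v (?y *\<^sub>v (?y ^\<^sub>m j *\<^sub>v ?w)))"
      unfolding next_step[OF j] pow_mat_Suc_mult_vec[OF y w] by (simp add: smult_smult_assoc)
    also have "\<dots> = \<zeta> \<cdot>\<^sub>v (?y *\<^sub>v (?x *\<^sub>v (?y ^\<^sub>m j *\<^sub>v e0)))"
      unfolding param_x_pow_e0[OF det j] mult_mat_vec[OF y wk] ..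
    also have "\<dots> = \<zeta> \<cdot>\<^sub>m (?y * ?x) *\<^sub>v (?y ^\<^sub>m j *\<^sub>v e0)"
      unfolding smult_mat_mult_vec[OF mult_carrier_mat[OF y x] yk] assoc_mult_mat_vec[OF y x yk] ..
    finally show "?x * ?y *\<^sub>v (?y ^\<^sub>m j *\<^sub>v e0) = \<zeta> \<cdot>\<^sub>m (?y * ?x) *\<^sub>v (?y ^\<^sub>m j *\<^sub>v e0)" .
  qed
qed

lemma param_in_pairs: "a \<in> param_domain \<Longrightarrow> (param_x a, param_y a) \<in> pairs"
  unfolding pairs_def param_domain_def by (auto simp: param_commute)

lemma cyclic_pairs_param:
  assumes xy: "(x, y) \<in> pairs" and cyc: "cyclic_vec n y e0"
  obtains a where "a \<in> param_domain" "param_x a = x" "param_y a = y"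
proof -
  from xy have x: "x \<in> carrier_mat n n" and y: "y \<in> carrier_mat n n" and dx: "det x \<noteq> 0" and dy: "det y \<noteq> 0"
    and comm: "x * y = \<zeta> \<cdot>\<^sub>m (y * x)" unfolding pairs_def by auto
  let ?H = "krylov n y e0"
  define w where "w = x *\<^sub>v e0"
  have w: "w \<in> carrier_vec n" unfolding w_def by (rule mult_mat_vec_carrier[OF x e0_carrier])
  note yk = pow_mult_vec_carrier[OF y e0_carrier] and wk = pow_mult_vec_carrier[OF y w]
  have xk: "x *\<^sub>v (y ^\<^sub>m k *\<^sub>v e0) = \<zeta> ^ k \<cdot>\<^sub>v (y ^\<^sub>m k *\<^sub>v w)" for k
    unfolding w_def by (rule twisted_pow_mult_vec[OF x y e0_carrier comm])
  have det: "det ?H \<noteq> 0" using cyc cyclic_vec_iff_det[OF e0_carrier] by blast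
  obtain Q where Q: "Q \<in> carrier_mat n n" "?H * Q = 1\<^sub>m n" using inverse_mat_exists[OF krylov_carrier det] .
  define c where "c = Q *\<^sub>v (y ^\<^sub>m n *\<^sub>v e0)"
  have c: "c \<in> carrier_vec n" unfolding c_def by (rule mult_mat_vec_carrier[OF Q(1) yk])
  have "?H *\<^sub>v c = y ^\<^sub>m n *\<^sub>v e0"
    unfolding c_def assoc_mult_mat_vec[OF krylov_carrier Q(1) yk, symmetric] Q(2)
    by (rule one_mult_mat_vec[OF yk])
  then have rel: "(y ^\<^sub>m n *\<^sub>v e0) $ i = (\<Sum>k<n. c $ k * (y ^\<^sub>m k *\<^sub>v e0) $ i)" if "i < n" for i
    using krylov_mult_vec[OF c that, of y e0] by simp
  \<comment> \<open>Compute \<open>x\<close> applied to \<open>y ^\<^sub>m n *\<^sub>v e0\<close>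
    twice: term by term, which twists coefficient \<open>k\<close> by \<zeta>^k, and as
    \<open>y ^\<^sub>m n *\<^sub>v w\<close>, which does not twist. The difference is a relation
    with coefficients \<open>c $ k * (\<zeta> ^ k - 1)\<close>.\<close>
  have c0: "c $ k = 0" if k: "k < n" "\<not> d dvd k" for k
  proof -
    have z: "(\<Sum>k<n. (c $ k * (\<zeta> ^ k - 1)) * (y ^\<^sub>m k *\<^sub>v w) $ i) = 0" if i: "i < n" for i
    proof -
      have "(\<Sum>k<n. c $ k * (y ^\<^sub>m k *\<^sub>v w) $ i) = (y ^\<^sub>m n *\<^sub>v w) $ i"
        by (rule cyclic_vec_pow_relation[OF cyc y rel w i, symmetric])
      also have "\<dots> = (x *\<^sub>v (y ^\<^sub>m n *\<^sub>v e0)) $ i" unfolding xk by (simp add: root_power_n)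
      also have "\<dots> = (\<Sum>k<n. c $ k * (x *\<^sub>v (y ^\<^sub>m k *\<^sub>v e0)) $ i)"
        by (rule mult_vec_comb[OF x yk yk rel i])
      also have "\<dots> = (\<Sum>k<n. c $ k * (\<zeta> ^ k * (y ^\<^sub>m k *\<^sub>v w) $ i))"
        unfolding xk by (simp only: index_smult_carrier_vec[OF wk i])
      finally show ?thesis by (simp add: algebra_simps sum_subtractf)
    qed
    \<comment> \<open>The relation found is between iterates of \<open>w\<close>. Applying the
      inverse of \<open>x\<close> carries it back, up to nonzero factors, to iterates of
      \<open>e0\<close>, which are independent.\<close>
    obtain X where X: "X \<in> carrier_mat n n" "X * x = 1\<^sub>m n" using inverse_mat_exists[OF x dx] by blast
    have xw: "(X *\<^sub>v (y ^\<^sub>m k *\<^sub>v w)) $ i = inverse (\<zeta> ^ k) * (y ^\<^sub>m k *\<^sub>v e0) $ i" if i: "i < n" for i k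
    proof -
      have "y ^\<^sub>m k *\<^sub>v e0 = X *\<^sub>v (x *\<^sub>v (y ^\<^sub>m k *\<^sub>v e0))"
        unfolding assoc_mult_mat_vec[OF X(1) x yk, symmetric] X(2) by (rule one_mult_mat_vec[OF yk, symmetric])
      also have "\<dots> = \<zeta> ^ k \<cdot>\<^sub>v (X *\<^sub>v (y ^\<^sub>m k *\<^sub>v w))"
        unfolding xk by (rule mult_mat_vec[OF X(1) wk])
      finally have "(y ^\<^sub>m k *\<^sub>v e0) $ i = \<zeta> ^ k * (X *\<^sub>v (y ^\<^sub>m k *\<^sub>v w)) $ i"
        by (metis index_smult_carrier_vec[OF mult_mat_vec_carrier[OF X(1) wk] i])
      then show ?thesis using root_nonzero by (simp del: index_mult_mat_vec)
    qed
    have "(\<Sum>k<n. (c $ k * (\<zeta> ^ k - 1) * inverse (\<zeta> ^ k)) * (y ^\<^sub>m k *\<^sub>v e0) $ i) = 0" if i: "i < n" for i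
    proof -
      have "(X *\<^sub>v 0\<^sub>v n) $ i = (\<Sum>k<n. (c $ k * (\<zeta> ^ k - 1)) * (X *\<^sub>v (y ^\<^sub>m k *\<^sub>v w)) $ i)"
        by (rule mult_vec_comb[OF X(1) zero_carrier_vec wk _ i]) (simp add: z del: index_mult_mat_vec)
      moreover have "(X *\<^sub>v 0\<^sub>v n) $ i = 0" using X(1) i by simp
      ultimately show ?thesis by (simp add: xw[OF i] mult.assoc del: index_mult_mat_vec)
    qed
    then have "\<forall>k<n. c $ k * (\<zeta> ^ k - 1) * inverse (\<zeta> ^ k) = 0"
      using conjunct2[OF cyc[unfolded cyclic_vec_def], THEN spec, of "\<lambda>k. c $ k * (\<zeta> ^ k - 1) * inverse (\<zeta> ^ k)"]
      by blast
    then show ?thesis using k root_nonzero root_power_eq_1_iff[of k] by auto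
  qed
  define a where "a = (\<lambda>p. case p of Inl (i, j) \<Rightarrow> if j = 0 then w $ i else ?H $$ (i, j) | Inr l \<Rightarrow> c $ (d * l))"
  have a_Inr: "a (Inr l) = c $ (d * l)" for l by (simp add: a_def)
  have H: "basis_mat a = ?H"
    by (rule eq_matI) (use y in \<open>auto simp: basis_mat_def a_def krylov_def\<close>)
  have "image_mat a = y * ?H"
  proof (rule eq_matI)
    fix i j assume "i < dim_row (y * ?H)" "j < dim_col (y * ?H)"
    then have ij: "i < n" "j < n" using y by (auto simp: krylov_def)
    have yH: "(y * ?H) $$ (i, j) = (y ^\<^sub>m Suc j *\<^sub>v e0) $ i"
      unfolding mult_krylov_index[OF y y e0_carrier ij] pow_mat_Suc_mult_vec[OF y e0_carrier] ..
    show "image_mat a $$ (i, j) = (y * ?H) $$ (i, j)"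
    proof (cases "Suc j < n")
      case True
      then show ?thesis unfolding yH using ij by (simp add: image_mat_def H krylov_def)
    next
      case False
      with ij have Suc: "Suc j = n" by simp
      have "(y ^\<^sub>m n *\<^sub>v e0) $ i = (\<Sum>k<n. if d dvd k then c $ k * (y ^\<^sub>m k *\<^sub>v e0) $ i else 0)"
        unfolding rel[OF ij(1)] by (intro sum.cong refl) (use c0 in auto)
      also have "\<dots> = (\<Sum>l<n div d. c $ (d * l) * (y ^\<^sub>m (d * l) *\<^sub>v e0) $ i)"
        by (rule sum_multiples)
      also have "\<dots> = image_mat a $$ (i, j)"
        using ij False block_less by (auto simp: image_mat_def H krylov_def a_Inr intro!: sum.cong)
      finally show ?thesis unfolding yH Suc ..
    qed
  qed (use y in \<open>auto simp: krylov_def image_mat_def\<close>)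
  then have py: "param_y a = y"
    unfolding param_y_def H using mult_cramer_inv_cancel(2)[OF krylov_carrier det y] by simp
  have pw: "param_w a = w" using w by (intro eq_vecI) (auto simp: param_w_def a_def)
  have "twisted_krylov y w = x * ?H"
  proof (rule eq_matI)
    fix i j assume "i < dim_row (x * ?H)" "j < dim_col (x * ?H)"
    then have ij: "i < n" "j < n" using x by (auto simp: krylov_def)
    show "twisted_krylov y w $$ (i, j) = (x * ?H) $$ (i, j)"
      unfolding mult_krylov_index[OF x y e0_carrier ij] xk
      unfolding index_smult_carrier_vec[OF wk ij(1)] using ij by (simp add: twisted_krylov_def)
  qed (use x in \<open>auto simp: krylov_def twisted_krylov_def\<close>)
  then have px: "param_x a = x"
    unfolding param_x_def py pw H using mult_cramer_inv_cancel(2)[OF krylov_carrier det x] by simp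
  have "a \<in> param_domain" using det dx dy by (simp add: param_domain_def px py H)
  with px py show ?thesis using that by blast
qed

end

section \<open>The variety of pairs\<close>

interpretation ratfun_algebra: function_algebra "Collect (ratfun I A)" for I A
  by unfold_locales (simp_all add: ratfun_const ratfun_add ratfun_mult)

lemma ratfun_det:
  assumes "\<And>a. M a \<in> carrier_mat n n"
    and "\<And>i j. i < n \<Longrightarrow> j < n \<Longrightarrow> ratfun I A (\<lambda>a. M a $$ (i, j))"
  shows "ratfun I A (\<lambda>a. det (M a))"
  using ratfun_algebra.det_R[of M n I A] assms by simp

lemma ratfun_mult_mat:
  assumes "\<And>a. M a \<in> carrier_mat n n" "\<And>a. N a \<in> carrier_mat n n"
    and "\<And>i j. i < n \<Longrightarrow> j < n \<Longrightarrow> ratfun I A (\<lambda>a. M a $$ (i, j))"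
    and "\<And>i j. i < n \<Longrightarrow> j < n \<Longrightarrow> ratfun I A (\<lambda>a. N a $$ (i, j))" and "i < n" "j < n"
  shows "ratfun I A (\<lambda>a. (M a * N a) $$ (i, j))"
  using ratfun_algebra.mult_mat_R[of M n N I A i j] assms by simp

lemma ratfun_pow_mult_vec:
  assumes "\<And>a. M a \<in> carrier_mat n n" "\<And>a. u a \<in> carrier_vec n"
    and "\<And>i j. i < n \<Longrightarrow> j < n \<Longrightarrow> ratfun I A (\<lambda>a. M a $$ (i, j))"
    and "\<And>j. j < n \<Longrightarrow> ratfun I A (\<lambda>a. u a $ j)" and "i < n"
  shows "ratfun I A (\<lambda>a. (M a ^\<^sub>m k *\<^sub>v u a) $ i)"
  using ratfun_algebra.pow_mult_vec_R[of M n u I A i k] assms by simp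

lemma ratfun_det_krylov:
  assumes "\<And>a. M a \<in> carrier_mat n n" "v \<in> carrier_vec n"
    and "\<And>i j. i < n \<Longrightarrow> j < n \<Longrightarrow> ratfun I A (\<lambda>a. M a $$ (i, j))"
  shows "ratfun I A (\<lambda>a. det (krylov n (M a) v))"
proof (rule ratfun_det[OF krylov_carrier])
  fix i j assume ij: "i < n" "j < n"
  have "ratfun I A (\<lambda>a. (M a ^\<^sub>m j *\<^sub>v v) $ i)"
    by (rule ratfun_pow_mult_vec[OF assms(1,2,3) ratfun_const ij(1)])
  then show "ratfun I A (\<lambda>a. krylov n (M a) v $$ (i, j))" using ij by (simp add: krylov_def)
qed

lemma ratfun_cramer_inv:
  assumes M: "\<And>a. M a \<in> carrier_mat n n"
    and entries: "\<And>i j. i < n \<Longrightarrow> j < n \<Longrightarrow> ratfun I A (\<lambda>a. M a $$ (i, j))"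
    and nz: "\<And>a. a \<in> A \<Longrightarrow> det (M a) \<noteq> 0" and ij: "i < n" "j < n"
  shows "ratfun I A (\<lambda>a. cramer_inv n (M a) $$ (i, j))"
proof -
  have "ratfun I A (\<lambda>a. det (replace_col (M a) (unit_vec n j) i))"
  proof (rule ratfun_det[of _ n])
    show "replace_col (M a) (unit_vec n j) i \<in> carrier_mat n n" for a
      using M[of a] by (simp add: replace_col_def)
    fix k l assume kl: "k < n" "l < n"
    have "(\<lambda>a. replace_col (M a) (unit_vec n j) i $$ (k, l)) =
        (if l = i then (\<lambda>a. unit_vec n j $ k) else (\<lambda>a. M a $$ (k, l)))"
    proof
      fix a show "replace_col (M a) (unit_vec n j) i $$ (k, l) =
          (if l = i then (\<lambda>a. unit_vec n j $ k) else (\<lambda>a. M a $$ (k, l))) a"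
        using M[of a] kl by (simp add: replace_col_def)
    qed
    then show "ratfun I A (\<lambda>a. replace_col (M a) (unit_vec n j) i $$ (k, l))"
      by (cases "l = i") (simp_all add: entries[OF kl] ratfun_const)
  qed
  then have "ratfun I A (\<lambda>a. det (replace_col (M a) (unit_vec n j) i) / det (M a))"
    by (rule ratfun_divide[OF _ ratfun_det[OF M entries] nz])
  then show ?thesis using ij by (simp add: cramer_inv_def)
qed

lemma ratfun_mat_pair_coords:
  assumes "\<And>i j. i < n \<Longrightarrow> j < n \<Longrightarrow> ratfun I A (\<lambda>a. M a $$ (i, j))"
    and "\<And>i j. i < n \<Longrightarrow> j < n \<Longrightarrow> ratfun I A (\<lambda>a. N a $$ (i, j))"
  shows "ratfun I A (\<lambda>a. poly_eval p (mat_pair_coords n (M a, N a)))"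
proof (rule ratfun_poly_eval)
  fix c :: "(nat \<times> nat) + (nat \<times> nat)"
  obtain i j where "c = Inl (i, j) \<or> c = Inr (i, j)" by (cases c) auto
  then show "ratfun I A (\<lambda>a. mat_pair_coords n (M a, N a) c)"
    by (cases "i < n \<and> j < n") (auto simp: mat_pair_coords_def assms ratfun_const)
qed

section \<open>The Zariski topology on pairs through regular functions\<close>

lemma closedin_pullback_topology:
  assumes T: "topspace T = UNIV"
  shows "closedin (pullback_topology A f T) S \<longleftrightarrow> (\<exists>K. closedin T K \<and> S = f -` K \<inter> A)"
proof
  assume "closedin (pullback_topology A f T) S"
  then have S: "S \<subseteq> A" and "openin (pullback_topology A f T) (A - S)"
    by (simp_all add: closedin_def topspace_pullback_topology T)
  then obtain U where U: "openin T U" "A - S = f -` U \<inter> A"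
    unfolding openin_pullback_topology by blast
  have "closedin T (UNIV - U)" using U(1) by (simp add: closedin_def T Diff_Diff_Int)
  moreover have "S = A - (A - S)" using S by blast
  then have "S = f -` (UNIV - U) \<inter> A" unfolding U(2) by blast
  ultimately show "\<exists>K. closedin T K \<and> S = f -` K \<inter> A" by blast
next
  assume "\<exists>K. closedin T K \<and> S = f -` K \<inter> A"
  then obtain K where K: "closedin T K" "S = f -` K \<inter> A" by blast
  have "A - S = f -` (UNIV - K) \<inter> A" unfolding K(2) by blast
  moreover have "openin T (UNIV - K)" using K(1) by (simp add: closedin_def T)
  ultimately have "openin (pullback_topology A f T) (A - S)"
    unfolding openin_pullback_topology by blast
  then show "closedin (pullback_topology A f T) S"
    using K(2) by (simp add: closedin_def topspace_pullback_topology T)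
qed

text \<open>Polynomials in the matrix entries without inverse determinants: exactly the functions
  whose zeros define the closed sets of \<open>zariski_GL_pair\<close>.\<close>

definition regular_funs :: "nat \<Rightarrow> ('k::field mat \<times> 'k mat \<Rightarrow> 'k) set" where
  "regular_funs n = range (\<lambda>p v. poly_eval p (mat_pair_coords n v))"

lemma regular_funs_algebra: "function_algebra (regular_funs n :: ('k::field mat \<times> 'k mat \<Rightarrow> 'k) set)"
proof
  show "(\<lambda>_. c) \<in> regular_funs n" for c
    unfolding regular_funs_def
    by (rule range_eqI[of _ _ "Poly_Mapping.single 0 c"]) (simp add: poly_eval_single)
  fix f g :: "'k mat \<times> 'k mat \<Rightarrow> 'k" assume "f \<in> regular_funs n" "g \<in> regular_funs n"
  then obtain p q where "f = (\<lambda>v. poly_eval p (mat_pair_coords n v))" "g = (\<lambda>v. poly_eval q (mat_pair_coords n v))"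
    unfolding regular_funs_def by blast
  then show "(\<lambda>v. f v + g v) \<in> regular_funs n" "(\<lambda>v. f v * g v) \<in> regular_funs n"
    unfolding regular_funs_def
    by (auto intro: range_eqI[of _ _ "p + q"] range_eqI[of _ _ "p * q"] simp: poly_eval_add poly_eval_mult)
qed

lemma zero_locus_topology_GL_pair:
  fixes V :: "('k::field mat \<times> 'k mat) set"
  assumes "V \<subseteq> carrier (GL n) \<times> carrier (GL n)"
  shows "zero_locus_topology (subtopology (zariski_GL_pair n) V) (regular_funs n)"
    and "topspace (subtopology (zariski_GL_pair n) V) = V"
proof -
  let ?X = "subtopology (zariski_GL_pair n) V" and ?f = "mat_pair_coords n"
  have top: "topspace ?X = V"
    using assms unfolding zariski_GL_pair_def
    by (auto simp: topspace_subtopology topspace_pullback_topology)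
  then show "topspace ?X = V" .
  have cl: "closedin ?X C \<longleftrightarrow> (\<exists>P. C = {v \<in> V. \<forall>p\<in>P. poly_eval p (?f v) = 0})" for C
  proof -
    have "closedin ?X C \<longleftrightarrow> (\<exists>P. C = ?f -` zero_locus P \<inter> (carrier (GL n) \<times> carrier (GL n)) \<inter> V)"
      unfolding closedin_subtopology zariski_GL_pair_def closedin_pullback_topology[OF topspace_zariski] closedin_zariski
      by auto
    moreover have "?f -` zero_locus P \<inter> (carrier (GL n) \<times> carrier (GL n)) \<inter> V =
        {v \<in> V. \<forall>p\<in>P. poly_eval p (?f v) = 0}" for P
      using assms by (auto simp: zero_locus_def)
    ultimately show ?thesis by simp
  qed
  have "closedin ?X C \<longleftrightarrow> (\<exists>F\<subseteq>regular_funs n. C = {v \<in> V. \<forall>f\<in>F. f v = 0})" for C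
  proof
    assume "closedin ?X C"
    then obtain P where C: "C = {v \<in> V. \<forall>p\<in>P. poly_eval p (?f v) = 0}" unfolding cl by blast
    show "\<exists>F\<subseteq>regular_funs n. C = {v \<in> V. \<forall>f\<in>F. f v = 0}"
      by (rule exI[of _ "(\<lambda>p v. poly_eval p (?f v)) ` P"]) (auto simp: C regular_funs_def)
  next
    assume "\<exists>F\<subseteq>regular_funs n. C = {v \<in> V. \<forall>f\<in>F. f v = 0}"
    then obtain F where F: "F \<subseteq> regular_funs n" "C = {v \<in> V. \<forall>f\<in>F. f v = 0}" by blast
    from F(1) obtain P where "F = (\<lambda>p v. poly_eval p (?f v)) ` P"
      unfolding regular_funs_def by (rule subset_imageE)
    then show "closedin ?X C" unfolding cl F(2) by (intro exI[of _ P]) simp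
  qed
  then show "zero_locus_topology ?X (regular_funs n)"
    unfolding zero_locus_topology_def zero_locus_topology_axioms_def top
    using regular_funs_algebra by blast
qed

lemma regular_entry:
  assumes "i < n" "j < n"
  shows "(\<lambda>v. mat_pair_coords n v (Inl (i, j))) \<in> regular_funs n"
    "(\<lambda>v. mat_pair_coords n v (Inr (i, j))) \<in> regular_funs n"
  unfolding regular_funs_def
  by (rule range_eqI[of _ _ "Poly_Mapping.single (Poly_Mapping.single (Inl (i, j)) 1) 1"],
      simp add: poly_eval_single fun_eq_iff,
      rule range_eqI[of _ _ "Poly_Mapping.single (Poly_Mapping.single (Inr (i, j)) 1) 1"],
      simp add: poly_eval_single fun_eq_iff)

lemma carrier_GL: "x \<in> carrier (GL n) \<longleftrightarrow> x \<in> carrier_mat n n \<and> det (x :: 'k::field mat) \<noteq> 0"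
  using unit_imp_det_non_zero[of x n "()"] det_non_zero_imp_unit[of x n "()"]
  unfolding GL_def units_of_def by (auto simp: Units_def ring_mat_def)

context root_of_unity_pairs
begin

text \<open>The first two factors of the commutator form the inverse of \<open>y * x\<close>, so
  multiplying by \<open>y * x\<close> clears all inverses.\<close>

lemma commutator_variety_eq: "commutator_variety n \<zeta> = pairs"
proof -
  have "group_commutator (GL n) x y = \<zeta> \<cdot>\<^sub>m 1\<^sub>m n \<longleftrightarrow> x * y = \<zeta> \<cdot>\<^sub>m (y * x)"
    if xG: "x \<in> carrier (GL n)" and yG: "y \<in> carrier (GL n)" for x y :: "'k mat"
  proof -
    let ?R = "ring_mat TYPE('k) n ()"
    interpret R: ring ?R by (rule ring_mat)
    interpret G: group "GL n :: 'k mat monoid" unfolding GL_def by (rule R.units_group)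
    have mult: "a \<otimes>\<^bsub>GL n\<^esub> b = a * b" for a b :: "'k mat" by (simp add: GL_def units_of_def ring_mat_def)
    have one: "\<one>\<^bsub>GL n\<^esub> = (1\<^sub>m n :: 'k mat)" by (simp add: GL_def units_of_def ring_mat_def)
    let ?p = "inv\<^bsub>GL n\<^esub> x" and ?q = "inv\<^bsub>GL n\<^esub> y"
    have car: "x \<in> carrier_mat n n" "y \<in> carrier_mat n n" "?p \<in> carrier_mat n n" "?q \<in> carrier_mat n n"
      using xG yG G.inv_closed[OF xG] G.inv_closed[OF yG] unfolding carrier_GL by auto
    have inv: "x * ?p = 1\<^sub>m n" "?p * x = 1\<^sub>m n" "y * ?q = 1\<^sub>m n" "?q * y = 1\<^sub>m n"
      using G.r_inv[OF xG] G.l_inv[OF xG] G.r_inv[OF yG] G.l_inv[OF yG] unfolding mult one by auto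
    have com: "group_commutator (GL n) x y = ?p * ?q * x * y" unfolding group_commutator_def mult ..
    have c: "?p * ?q * x * y = (?p * ?q) * (x * y)" "(?p * ?q) * (y * x) = 1\<^sub>m n" "(y * x) * (?p * ?q) = 1\<^sub>m n"
    proof -
      show "?p * ?q * x * y = (?p * ?q) * (x * y)" using car by (simp add: assoc_mult_mat[of _ n n _ n _ n])
      have "(?p * ?q) * (y * x) = ?p * (?q * y) * x" using car by (simp add: assoc_mult_mat[of _ n n _ n _ n])
      then show "(?p * ?q) * (y * x) = 1\<^sub>m n" unfolding inv using car inv by simp
      have "(y * x) * (?p * ?q) = y * (x * ?p) * ?q" using car by (simp add: assoc_mult_mat[of _ n n _ n _ n])
      then show "(y * x) * (?p * ?q) = 1\<^sub>m n" unfolding inv using car inv by simp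
    qed
    show ?thesis
    proof
      assume "group_commutator (GL n) x y = \<zeta> \<cdot>\<^sub>m 1\<^sub>m n"
      then have "(y * x) * ((?p * ?q) * (x * y)) = (y * x) * (\<zeta> \<cdot>\<^sub>m 1\<^sub>m n)" unfolding com c(1) by simp
      moreover have "(y * x) * ((?p * ?q) * (x * y)) = ((y * x) * (?p * ?q)) * (x * y)"
        using car by (simp add: assoc_mult_mat[of _ n n _ n _ n])
      moreover have "(y * x) * (\<zeta> \<cdot>\<^sub>m 1\<^sub>m n) = \<zeta> \<cdot>\<^sub>m (y * x)"
        using car by (simp add: mult_smult_distrib[of _ n n _ n])
      ultimately show "x * y = \<zeta> \<cdot>\<^sub>m (y * x)" unfolding c(3) using car by simp
    next
      assume "x * y = \<zeta> \<cdot>\<^sub>m (y * x)"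
      then have "(?p * ?q) * (x * y) = \<zeta> \<cdot>\<^sub>m ((?p * ?q) * (y * x))"
        using car by (simp add: mult_smult_distrib[of _ n n _ n])
      then show "group_commutator (GL n) x y = \<zeta> \<cdot>\<^sub>m 1\<^sub>m n" unfolding com c(1,2) .
    qed
  qed
  then show ?thesis unfolding commutator_variety_def pairs_def by (auto simp: carrier_GL)
qed

lemma pairs_subset_GL: "pairs \<subseteq> carrier (GL n) \<times> carrier (GL n)"
  unfolding pairs_def by (auto simp: carrier_GL)

definition index_set :: "((nat \<times> nat) + nat) set" where
  "index_set = ({..<n} \<times> {..<n}) <+> {..<n div d}"

lemma card_index_set: "finite index_set" "card index_set = n\<^sup>2 + n div d"
  unfolding index_set_def by (simp_all add: card_Plus power2_eq_square)

lemma ratfun_basis_mat: "i < n \<Longrightarrow> j < n \<Longrightarrow> ratfun index_set A (\<lambda>a. basis_mat a $$ (i, j))"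
  by (cases "j = 0") (auto simp: basis_mat_def index_set_def intro!: ratfun_const ratfun_var)

lemma ratfun_param:
  assumes A: "\<And>a. a \<in> A \<Longrightarrow> det (basis_mat a) \<noteq> 0" and ij: "i < n" "j < n"
  shows "ratfun index_set A (\<lambda>a. param_y a $$ (i, j))" "ratfun index_set A (\<lambda>a. param_x a $$ (i, j))"
proof -
  have inv: "ratfun index_set A (\<lambda>a. cramer_inv n (basis_mat a) $$ (i, j))" if "i < n" "j < n" for i j
    by (rule ratfun_cramer_inv[OF param_carrier(1) ratfun_basis_mat A that])
  have img: "ratfun index_set A (\<lambda>a. image_mat a $$ (i, j))" if "i < n" "j < n" for i j
  proof (cases "Suc j < n")
    case True
    then show ?thesis using that ratfun_basis_mat[of i "Suc j"] by (simp add: image_mat_def)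
  next
    case False
    have "ratfun index_set A (\<lambda>a. \<Sum>l<n div d. a (Inr l) * basis_mat a $$ (i, d * l))"
      using that block_less
      by (intro ratfun_sum ratfun_mult ratfun_var ratfun_basis_mat) (auto simp: index_set_def)
    then show ?thesis using that False by (simp add: image_mat_def)
  qed
  have y: "ratfun index_set A (\<lambda>a. param_y a $$ (i, j))" if "i < n" "j < n" for i j
    unfolding param_y_def by (rule ratfun_mult_mat[OF param_carrier(2) cramer_inv_carrier img inv that])
  have w: "ratfun index_set A (\<lambda>a. param_w a $ i)" if "i < n" for i
    using that n_pos by (auto simp: param_w_def index_set_def intro!: ratfun_var)
  have tw: "ratfun index_set A (\<lambda>a. twisted_krylov (param_y a) (param_w a) $$ (i, j))" if "i < n" "j < n" for i j
  proof -
    have "ratfun index_set A (\<lambda>a. \<zeta> ^ j * (param_y a ^\<^sub>m j *\<^sub>v param_w a) $ i)"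
      by (rule ratfun_mult[OF ratfun_const ratfun_pow_mult_vec[OF param_xy_carrier(1) param_carrier(4) y w that(1)]])
    then show ?thesis using that by (simp add: twisted_krylov_def)
  qed
  show "ratfun index_set A (\<lambda>a. param_y a $$ (i, j))" by (rule y[OF ij])
  show "ratfun index_set A (\<lambda>a. param_x a $$ (i, j))"
    unfolding param_x_def by (rule ratfun_mult_mat[OF param_carrier(3) cramer_inv_carrier tw inv ij])
qed

text \<open>The conditions are imposed one after another, because the entries of
  \<open>param_y\<close> and \<open>param_x\<close> are known to be rational only where
  \<open>det (basis_mat a)\<close> is nonzero.\<close>

lemma principal_open_param_domain: "principal_open index_set param_domain"
proof -
  let ?A = "{a. det (basis_mat a) \<noteq> 0}"
  let ?B = "{a \<in> ?A. det (param_y a) \<noteq> 0}"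
  have "principal_open index_set {a \<in> UNIV. det (basis_mat a) \<noteq> 0}"
    by (rule principal_open_nonzero[OF principal_open_UNIV ratfun_det[OF param_carrier(1) ratfun_basis_mat]])
  then have A: "principal_open index_set ?A" by simp
  have y: "ratfun index_set ?A (\<lambda>a. det (param_y a))"
    by (rule ratfun_det[OF param_xy_carrier(1) ratfun_param(1)]) auto
  have x: "ratfun index_set ?B (\<lambda>a. det (param_x a))"
    by (rule ratfun_det[OF param_xy_carrier(2) ratfun_param(2)]) auto
  have "principal_open index_set {a \<in> ?B. det (param_x a) \<noteq> 0}"
    by (rule principal_open_nonzero[OF principal_open_nonzero[OF A y] x])
  moreover have "{a \<in> ?B. det (param_x a) \<noteq> 0} = param_domain" unfolding param_domain_def by auto
  ultimately show ?thesis by simp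
qed

lemma ratfun_regular_param:
  assumes "g \<in> regular_funs n"
  shows "ratfun index_set param_domain (\<lambda>a. g (param_x a, param_y a))"
proof -
  obtain p where "g = (\<lambda>v. poly_eval p (mat_pair_coords n v))" using assms unfolding regular_funs_def by blast
  moreover have "\<And>a. a \<in> param_domain \<Longrightarrow> det (basis_mat a) \<noteq> 0" unfolding param_domain_def by simp
  ultimately show ?thesis using ratfun_mat_pair_coords[OF ratfun_param(2) ratfun_param(1)] by simp
qed

end

section \<open>Density of the parametrised pairs\<close>

lemma smult_vec_comb:
  fixes p q :: "'k::comm_ring_1 vec"
  assumes "p \<in> carrier_vec n" "q \<in> carrier_vec n"
  shows "a \<cdot>\<^sub>v (c \<cdot>\<^sub>v p) + b \<cdot>\<^sub>v (c \<cdot>\<^sub>v q) = c \<cdot>\<^sub>v (a \<cdot>\<^sub>v p + b \<cdot>\<^sub>v q)"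
  using assms by (intro eq_vecI) (auto simp: algebra_simps)

lemma mult_mat_zero_vec:
  fixes A :: "'k::comm_ring_1 mat"
  shows "A \<in> carrier_mat n m \<Longrightarrow> A *\<^sub>v 0\<^sub>v m = 0\<^sub>v n"
  by (intro eq_vecI) auto

context root_of_unity_pairs
begin

text \<open>Move \<open>y\<close> along the line towards a cyclic \<open>z\<close> with \<open>x z = \<zeta> z x\<close>; then conjugate
  so that \<open>e0\<close> becomes a cyclic vector.\<close>

lemma nonzero_at_cyclic_vec:
  assumes g: "g \<in> regular_funs n" and xy: "(x, y) \<in> pairs" and nz: "g (x, y) \<noteq> 0"
  obtains y' v where "(x, y') \<in> pairs" "cyclic_vec n y' v" "g (x, y') \<noteq> 0"
proof -
  from xy have x: "x \<in> carrier_mat n n" and y: "y \<in> carrier_mat n n" and dx: "det x \<noteq> 0" and dy: "det y \<noteq> 0"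
    and comm: "x * y = \<zeta> \<cdot>\<^sub>m (y * x)" unfolding pairs_def by auto
  obtain z v where z: "z \<in> carrier_mat n n" "x * z = \<zeta> \<cdot>\<^sub>m (z * x)" "cyclic_vec n z v"
    by (rule exists_twisted_commuting_cyclic[OF d_pos root prim x dx y dy comm])
  have v: "v \<in> carrier_vec n" using z(3) unfolding cyclic_vec_def by blast
  \<comment> \<open>The line parameter is a single variable indexed by \<open>unit\<close>, so that
    the results on principal open sets apply to it.\<close>
  define Y where "Y = (\<lambda>t :: unit \<Rightarrow> 'k. mat n n (\<lambda>(i, j). (1 - t ()) * y $$ (i, j) + t () * z $$ (i, j)))"
  have Y: "Y t \<in> carrier_mat n n" for t unfolding Y_def by simp
  have ratY: "ratfun UNIV UNIV (\<lambda>t. Y t $$ (i, j))" if "i < n" "j < n" for i j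
  proof -
    have "ratfun UNIV UNIV (\<lambda>t :: unit \<Rightarrow> 'k. (1 + (-1) * t ()) * y $$ (i, j) + t () * z $$ (i, j))"
      by (intro ratfun_add ratfun_mult ratfun_const ratfun_var UNIV_I)
    then show ?thesis using that by (simp add: Y_def)
  qed
  obtain p where p: "g = (\<lambda>v. poly_eval p (mat_pair_coords n v))" using g unfolding regular_funs_def by blast
  have ratg: "ratfun UNIV UNIV (\<lambda>t. g (x, Y t))"
    unfolding p by (rule ratfun_mat_pair_coords[OF ratfun_const ratY])
  \<comment> \<open>The factor \<open>det (Y t)\<close> keeps the chosen point of the line
    invertible. The product is nonzero at \<open>y\<close>, where t = 0; the cyclic condition holds
    at \<open>z\<close>, where t = 1.\<close>
  have 1: "ratfun UNIV UNIV (\<lambda>t. g (x, Y t) * det (Y t))"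
    by (rule ratfun_mult[OF ratg ratfun_det[OF Y ratY]])
  have 2: "ratfun UNIV UNIV (\<lambda>t. det (krylov n (Y t) v))"
    by (rule ratfun_det_krylov[OF Y v ratY])
  have "Y (\<lambda>_. 0) = y" "Y (\<lambda>_. 1) = z" using y z(1) unfolding Y_def by (auto intro!: eq_matI)
  then have nz1: "g (x, Y (\<lambda>_. 0)) * det (Y (\<lambda>_. 0)) \<noteq> 0" and nz2: "det (krylov n (Y (\<lambda>_. 1)) v) \<noteq> 0"
    using nz dy z(3) cyclic_vec_iff_det[OF v] by simp_all
  have "\<exists>t\<in>UNIV. g (x, Y t) * det (Y t) \<noteq> 0 \<and> det (krylov n (Y t) v) \<noteq> 0"
    by (rule common_nonzero[where a = "\<lambda>_. 0" and b = "\<lambda>_. 1", OF principal_open_UNIV 1 2 UNIV_I nz1 UNIV_I nz2])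
  then obtain t where t: "g (x, Y t) * det (Y t) \<noteq> 0" "det (krylov n (Y t) v) \<noteq> 0"
    by (elim bexE conjE)
  \<comment> \<open>The equation is linear in its second component, so it holds at every point of
    the line.\<close>
  have "x * Y t = \<zeta> \<cdot>\<^sub>m (Y t * x)"
  proof (rule eq_mat_mult_vecI[OF mult_carrier_mat[OF x Y] smult_carrier_mat[OF mult_carrier_mat[OF Y x]]])
    fix u :: "'k vec" assume u: "u \<in> carrier_vec n"
    have Yu: "Y t *\<^sub>v w = (1 - t ()) \<cdot>\<^sub>v (y *\<^sub>v w) + t () \<cdot>\<^sub>v (z *\<^sub>v w)" if w: "w \<in> carrier_vec n" for w
    proof (rule eq_vec_carrierI[of _ n])
      fix i assume i: "i < n"
      have "(Y t *\<^sub>v w) $ i = (\<Sum>j<n. (1 - t ()) * (y $$ (i, j) * w $ j) + t () * (z $$ (i, j) * w $ j))"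
        unfolding index_mult_vec_sum[OF Y w i]
        by (intro sum.cong refl) (use i in \<open>simp add: Y_def algebra_simps\<close>)
      also have "\<dots> = (1 - t ()) * (y *\<^sub>v w) $ i + t () * (z *\<^sub>v w) $ i"
        unfolding index_mult_vec_sum[OF y w i] index_mult_vec_sum[OF z(1) w i]
        by (simp add: sum.distrib sum_distrib_left)
      finally show "(Y t *\<^sub>v w) $ i = ((1 - t ()) \<cdot>\<^sub>v (y *\<^sub>v w) + t () \<cdot>\<^sub>v (z *\<^sub>v w)) $ i"
        using i y z(1) by simp
    next
      show "Y t *\<^sub>v w \<in> carrier_vec n" by (rule mult_mat_vec_carrier[OF Y w])
      show "(1 - t ()) \<cdot>\<^sub>v (y *\<^sub>v w) + t () \<cdot>\<^sub>v (z *\<^sub>v w) \<in> carrier_vec n"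
        using mult_mat_vec_carrier[OF y w] mult_mat_vec_carrier[OF z(1) w] by simp
    qed
    have xu: "x *\<^sub>v u \<in> carrier_vec n" and yu: "y *\<^sub>v u \<in> carrier_vec n" and zu: "z *\<^sub>v u \<in> carrier_vec n"
      by (rule mult_mat_vec_carrier[OF x u], rule mult_mat_vec_carrier[OF y u], rule mult_mat_vec_carrier[OF z(1) u])
    have xm: "x *\<^sub>v (m *\<^sub>v u) = \<zeta> \<cdot>\<^sub>v (m *\<^sub>v (x *\<^sub>v u))"
      if m: "m \<in> carrier_mat n n" and c: "x * m = \<zeta> \<cdot>\<^sub>m (m * x)" for m
      unfolding assoc_mult_mat_vec[OF x m u, symmetric] c smult_mat_mult_vec[OF mult_carrier_mat[OF m x] u]
        assoc_mult_mat_vec[OF m x u] ..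
    have "x * Y t *\<^sub>v u = x *\<^sub>v ((1 - t ()) \<cdot>\<^sub>v (y *\<^sub>v u) + t () \<cdot>\<^sub>v (z *\<^sub>v u))"
      unfolding assoc_mult_mat_vec[OF x Y u] Yu[OF u] ..
    also have "\<dots> = (1 - t ()) \<cdot>\<^sub>v (x *\<^sub>v (y *\<^sub>v u)) + t () \<cdot>\<^sub>v (x *\<^sub>v (z *\<^sub>v u))"
      using yu zu by (simp add: mult_add_distrib_mat_vec[OF x] mult_mat_vec[OF x])
    also have "\<dots> = \<zeta> \<cdot>\<^sub>v (Y t *\<^sub>v (x *\<^sub>v u))"
      unfolding xm[OF y comm] xm[OF z(1,2)] Yu[OF xu]
      by (rule smult_vec_comb[OF mult_mat_vec_carrier[OF y xu] mult_mat_vec_carrier[OF z(1) xu]])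
    also have "\<dots> = \<zeta> \<cdot>\<^sub>m (Y t * x) *\<^sub>v u"
      unfolding smult_mat_mult_vec[OF mult_carrier_mat[OF Y x] u] assoc_mult_mat_vec[OF Y x u] ..
    finally show "x * Y t *\<^sub>v u = \<zeta> \<cdot>\<^sub>m (Y t * x) *\<^sub>v u" .
  qed
  then have "(x, Y t) \<in> pairs" using x dx Y t(1) unfolding pairs_def by simp
  moreover have "cyclic_vec n (Y t) v" using t(2) cyclic_vec_iff_det[OF v] by blast
  moreover have "g (x, Y t) \<noteq> 0" using t(1) by simp
  ultimately show ?thesis by (rule that)
qed

lemma pairs_conj:
  assumes xy: "(x, y) \<in> pairs" and P: "P \<in> carrier_mat n n" and Q: "Q \<in> carrier_mat n n"
    and PQ: "P * Q = 1\<^sub>m n" "Q * P = 1\<^sub>m n"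
  shows "(P * x * Q, P * y * Q) \<in> pairs"
proof -
  from xy have x: "x \<in> carrier_mat n n" and y: "y \<in> carrier_mat n n" and dx: "det x \<noteq> 0" and dy: "det y \<noteq> 0"
    and comm: "x * y = \<zeta> \<cdot>\<^sub>m (y * x)" unfolding pairs_def by auto
  have "det P * det Q = 1" using det_mult[OF P Q] PQ(1) by simp
  then have dPQ: "det P \<noteq> 0" "det Q \<noteq> 0" by auto
  have "(P * x * Q) * (P * y * Q) = P * (\<zeta> \<cdot>\<^sub>m (y * x)) * Q"
    unfolding conj_mult[OF x y P Q PQ(2)] comm ..
  also have "\<dots> = \<zeta> \<cdot>\<^sub>m (P * (y * x) * Q)"
    using P Q x y by (simp add: mult_smult_distrib[of _ n n _ n] mult_smult_assoc_mat[of _ n n _ n])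
  also have "P * (y * x) * Q = (P * y * Q) * (P * x * Q)"
    by (rule conj_mult[OF y x P Q PQ(2), symmetric])
  finally show ?thesis
    using x y P Q dx dy dPQ det_mult[OF mult_carrier_mat[OF P x] Q] det_mult[OF P x]
      det_mult[OF mult_carrier_mat[OF P y] Q] det_mult[OF P y]
    unfolding pairs_def by simp
qed

text \<open>A conjugation that makes \<open>e0\<close> cyclic may turn \<open>g\<close> into 0. So
  the conjugating matrix \<open>G s\<close> is allowed to vary: at the identity \<open>g\<close> is
  nonzero, at \<open>Q\<close> the vector \<open>e0\<close> is cyclic, and as both conditions are
  open and the invertible matrices form a principal open set, some \<open>s\<close> satisfies
  both.\<close>

lemma nonzero_on_params:
  assumes g: "g \<in> regular_funs n" and xy: "(x, y) \<in> pairs" and nz: "g (x, y) \<noteq> 0"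
  shows "\<exists>a\<in>param_domain. g (param_x a, param_y a) \<noteq> 0"
proof -
  obtain y' v where y': "(x, y') \<in> pairs" "cyclic_vec n y' v" "g (x, y') \<noteq> 0"
    by (rule nonzero_at_cyclic_vec[OF g xy nz])
  from y'(1) have x: "x \<in> carrier_mat n n" and y: "y' \<in> carrier_mat n n" unfolding pairs_def by auto
  have v: "v \<in> carrier_vec n" using y'(2) unfolding cyclic_vec_def by blast
  have "v \<noteq> 0\<^sub>v n"
  proof
    assume v0: "v = 0\<^sub>v n"
    have "(y' ^\<^sub>m k *\<^sub>v v) $ i = 0" if "i < n" for i k
      unfolding v0 mult_mat_zero_vec[OF pow_carrier_mat[OF y]] using that by simp
    then have "\<forall>k<n. (1::'k) = 0"
      using conjunct2[OF y'(2)[unfolded cyclic_vec_def], THEN spec, of "\<lambda>_. 1"] by simp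
    with n_pos show False by auto
  qed
  obtain P where P: "P \<in> carrier_mat n n" "det P \<noteq> 0" "\<And>i. i < n \<Longrightarrow> P $$ (i, 0) = v $ i"
    using invertible_with_first_col[OF v \<open>v \<noteq> 0\<^sub>v n\<close>] by blast
  obtain Q where Q: "Q \<in> carrier_mat n n" "P * Q = 1\<^sub>m n" "Q * P = 1\<^sub>m n"
    using inverse_mat_exists[OF P(1,2)] .
  have "Q *\<^sub>v v = e0"
  proof -
    have "col P 0 = v" using P(1,3) v n_pos by (intro eq_vec_carrierI[of _ n]) auto
    then have "Q *\<^sub>v v = col (Q * P) 0" using col_mult2[OF Q(1) P(1) n_pos] by simp
    then show ?thesis unfolding Q(3) using n_pos by simp
  qed
  define G where "G = (\<lambda>s. mat n n (\<lambda>p. s p :: 'k))"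
  have G: "G s \<in> carrier_mat n n" for s unfolding G_def by simp
  have G_of: "G (\<lambda>p. M $$ p) = M" if "M \<in> carrier_mat n n" for M
    using that unfolding G_def by (intro eq_matI) auto
  let ?I = "{..<n} \<times> {..<n}" and ?A = "{s. det (G s) \<noteq> 0}"
  have ratG: "ratfun ?I A (\<lambda>s. G s $$ (i, j))" if "i < n" "j < n" for i j A
    using that by (auto simp: G_def intro!: ratfun_var)
  have "principal_open ?I {s \<in> UNIV. det (G s) \<noteq> 0}"
    by (rule principal_open_nonzero[OF principal_open_UNIV ratfun_det[OF G ratG]])
  then have A: "principal_open ?I ?A" by simp
  let ?c = "\<lambda>m s. G s * m * cramer_inv n (G s)"
  have rat_inv: "ratfun ?I ?A (\<lambda>s. cramer_inv n (G s) $$ (i, j))" if "i < n" "j < n" for i j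
    by (rule ratfun_cramer_inv[OF G ratG _ that]) auto
  have carc: "?c m s \<in> carrier_mat n n" if "m \<in> carrier_mat n n" for m s
    using mult_carrier_mat[OF mult_carrier_mat[OF G that] cramer_inv_carrier] .
  have ratc: "ratfun ?I ?A (\<lambda>s. ?c m s $$ (i, j))" if m: "m \<in> carrier_mat n n" and ij: "i < n" "j < n" for m i j
    by (rule ratfun_mult_mat[OF mult_carrier_mat[OF G m] cramer_inv_carrier
          ratfun_mult_mat[OF G m ratG ratfun_const] rat_inv ij])
  obtain p where p: "g = (\<lambda>v. poly_eval p (mat_pair_coords n v))" using g unfolding regular_funs_def by blast
  have 1: "ratfun ?I ?A (\<lambda>s. g (?c x s, ?c y' s))"
    unfolding p by (rule ratfun_mat_pair_coords[OF ratc[OF x] ratc[OF y]])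
  have 2: "ratfun ?I ?A (\<lambda>s. det (krylov n (?c y' s) e0))"
    by (rule ratfun_det_krylov[OF carc[OF y] e0_carrier ratc[OF y]])
  let ?one = "\<lambda>p. (1\<^sub>m n :: 'k mat) $$ p" and ?q = "\<lambda>p. Q $$ p"
  have "cramer_inv n (1\<^sub>m n :: 'k mat) = 1\<^sub>m n" by (rule cramer_inv_eq) auto
  then have "?c m ?one = m" if "m \<in> carrier_mat n n" for m using that by (simp add: G_of)
  then have one: "?one \<in> ?A" "g (?c x ?one, ?c y' ?one) \<noteq> 0" using y'(3) x y by (simp_all add: G_of)
  have "det Q * det P = 1" using det_mult[OF Q(1) P(1)] Q(3) by simp
  then have q1: "?q \<in> ?A" using Q(1) by (auto simp: G_of)
  have "?c y' ?q = Q * y' * P"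
    using cramer_inv_eq[OF Q(1) P(1) Q(3)] by (simp add: G_of Q(1))
  then have "cyclic_vec n (?c y' ?q) e0"
    using cyclic_vec_conj[OF y'(2) y Q(1) P(1) Q(2)] \<open>Q *\<^sub>v v = e0\<close> by simp
  then have q2: "det (krylov n (?c y' ?q) e0) \<noteq> 0" using cyclic_vec_iff_det[OF e0_carrier] by blast
  have "\<exists>s\<in>?A. g (?c x s, ?c y' s) \<noteq> 0 \<and> det (krylov n (?c y' s) e0) \<noteq> 0"
    by (rule common_nonzero[where a = ?one and b = ?q, OF A 1 2 one q1 q2])
  then obtain s where sA: "s \<in> ?A"
    and s: "g (?c x s, ?c y' s) \<noteq> 0" "det (krylov n (?c y' s) e0) \<noteq> 0"
    by (elim bexE conjE)
  have det_s: "det (G s) \<noteq> 0" using sA by simp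
  have "(?c x s, ?c y' s) \<in> pairs"
    by (rule pairs_conj[OF y'(1) G cramer_inv_carrier cramer_inv[OF G det_s]])
  moreover have "cyclic_vec n (?c y' s) e0" using s(2) cyclic_vec_iff_det[OF e0_carrier] by blast
  ultimately obtain a where a: "a \<in> param_domain" "param_x a = ?c x s" "param_y a = ?c y' s"
    by (rule cyclic_pairs_param)
  show ?thesis by (rule bexI[OF _ a(1)]) (unfold a, rule s(1))
qed

text \<open>The pair is given by the clock and shift matrices: powers of \<zeta> on the diagonal and
  a cyclic permutation. The wrap-around of the permutation is compatible with \<zeta>^n = 1.\<close>

lemma param_domain_nonempty: "param_domain \<noteq> {}"
proof -
  define x where "x = mat n n (\<lambda>(i, j). if i = j then \<zeta> ^ i else 0)"
  define y where "y = mat n n (\<lambda>(i, j). if i = Suc j mod n then 1 else 0 :: 'k)"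
  have x: "x \<in> carrier_mat n n" and y: "y \<in> carrier_mat n n" unfolding x_def y_def by simp_all
  have ye: "y ^\<^sub>m j *\<^sub>v e0 = unit_vec n (j mod n)" for j
  proof (induction j)
    case 0
    then show ?case using y by simp
  next
    case (Suc j)
    have "y *\<^sub>v unit_vec n (j mod n) = unit_vec n (Suc j mod n)"
    proof (rule eq_vec_carrierI[of _ n])
      fix i assume i: "i < n"
      have "(y *\<^sub>v unit_vec n (j mod n)) $ i = (\<Sum>l<n. y $$ (i, l) * (if l = j mod n then 1 else 0))"
        unfolding index_mult_vec_sum[OF y unit_vec_carrier i]
        by (intro sum.cong refl) (use n_pos in auto)
      also have "\<dots> = y $$ (i, j mod n)" using n_pos by (simp add: if_distrib sum.delta cong: if_cong)
      finally show "(y *\<^sub>v unit_vec n (j mod n)) $ i = unit_vec n (Suc j mod n) $ i"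
        using i n_pos by (simp add: y_def mod_Suc_eq)
    qed (simp_all add: mult_mat_vec_carrier[OF y])
    then show ?case unfolding pow_mat_Suc_mult_vec[OF y e0_carrier] Suc .
  qed
  have "krylov n y e0 = 1\<^sub>m n" by (intro eq_matI) (auto simp: krylov_def ye)
  then have cyc: "cyclic_vec n y e0" using cyclic_vec_iff_det[OF e0_carrier, of y] by simp
  \<comment> \<open>\<open>y ^\<^sub>m n\<close> fixes \<open>e0\<close>, which is a relation with
    the single exponent 0; by cyclicity it holds for every vector, and \<open>y\<close> is therefore
    injective.\<close>
  have yn: "y ^\<^sub>m n *\<^sub>v u = u" if u: "u \<in> carrier_vec n" for u
  proof (rule eq_vec_carrierI[OF pow_mult_vec_carrier[OF y u] u])
    fix i assume i: "i < n"
    have "(y ^\<^sub>m n *\<^sub>v u) $ i = (\<Sum>l<(1::nat). 1 * (y ^\<^sub>m 0 *\<^sub>v u) $ i)"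
      by (rule cyclic_vec_pow_relation[OF cyc y _ u i]) (use y in \<open>simp add: ye\<close>)
    then show "(y ^\<^sub>m n *\<^sub>v u) $ i = u $ i" using y u by simp
  qed
  have dy: "det y \<noteq> 0"
  proof
    assume "det y = 0"
    then obtain u where u: "u \<in> carrier_vec n" "u \<noteq> 0\<^sub>v n" "y *\<^sub>v u = 0\<^sub>v n"
      using det_0_iff_vec_prod_zero_field[OF y] by blast
    obtain k where k: "n = Suc k" using n_pos by (cases n) auto
    have "y ^\<^sub>m n *\<^sub>v u = y ^\<^sub>m k *\<^sub>v (y *\<^sub>v u)"
      unfolding k pow_mat.simps by (rule assoc_mult_mat_vec[OF pow_carrier_mat[OF y] y u(1)])
    also have "\<dots> = 0\<^sub>v n" unfolding u(3) by (rule mult_mat_zero_vec[OF pow_carrier_mat[OF y]])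
    finally show False using yn[OF u(1)] u(2) by simp
  qed
  have dx: "det x \<noteq> 0"
  proof -
    have "det x = prod_list (diag_mat x)"
      by (rule det_upper_triangular[OF _ x]) (auto simp: x_def)
    moreover have "0 \<notin> set (diag_mat x)" using root_nonzero by (auto simp: diag_mat_def x_def)
    ultimately show ?thesis by (simp add: prod_list_zero_iff)
  qed
  have "x * y = \<zeta> \<cdot>\<^sub>m (y * x)"
  proof (rule eq_matI)
    fix i j assume "i < dim_row (\<zeta> \<cdot>\<^sub>m (y * x))" "j < dim_col (\<zeta> \<cdot>\<^sub>m (y * x))"
    then have ij: "i < n" "j < n" using x y by auto
    have "(x * y) $$ (i, j) = (\<Sum>l<n. x $$ (i, l) * y $$ (l, j))"
      using x y ij by (auto simp: scalar_prod_def lessThan_atLeast0 intro!: sum.cong)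
    also have "\<dots> = (\<Sum>l<n. if l = i then \<zeta> ^ i * y $$ (i, j) else 0)"
      by (intro sum.cong refl) (use ij in \<open>auto simp: x_def\<close>)
    finally have 1: "(x * y) $$ (i, j) = \<zeta> ^ i * y $$ (i, j)" using ij by simp
    have "(y * x) $$ (i, j) = (\<Sum>l<n. y $$ (i, l) * x $$ (l, j))"
      using x y ij by (auto simp: scalar_prod_def lessThan_atLeast0 intro!: sum.cong)
    also have "\<dots> = (\<Sum>l<n. if l = j then y $$ (i, j) * \<zeta> ^ j else 0)"
      by (intro sum.cong refl) (use ij in \<open>auto simp: x_def\<close>)
    finally have 2: "(y * x) $$ (i, j) = y $$ (i, j) * \<zeta> ^ j" using ij by simp
    have "\<zeta> ^ i = \<zeta> * \<zeta> ^ j" if "i = Suc j mod n"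
      using that ij root_power_n by (cases "Suc j = n") (simp_all flip: power_Suc)
    then have "\<zeta> ^ i * y $$ (i, j) = \<zeta> * (y $$ (i, j) * \<zeta> ^ j)" using ij by (simp add: y_def)
    then show "(x * y) $$ (i, j) = (\<zeta> \<cdot>\<^sub>m (y * x)) $$ (i, j)" using 1 2 ij x y by simp
  qed (use x y in auto)
  then have "(x, y) \<in> pairs" unfolding pairs_def using x y dx dy by simp
  then obtain a where "a \<in> param_domain" by (rule cyclic_pairs_param[OF _ cyc])
  then show ?thesis by blast
qed

end

section \<open>Irreducibility and dimension of the variety\<close>

lemma monomial_fun_comp: "monomial_fun (map (\<lambda>f. f \<circ> h) fs) es a = monomial_fun fs es (h a)"
proof (induction fs arbitrary: es)
  case Nil
  then show ?case by (cases es) auto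
next
  case (Cons f fs)
  then show ?case by (cases es) auto
qed

context root_of_unity_pairs
begin

text \<open>The parametrisation has a rational inverse with regular numerators and denominators. The
  vectors are read off from the iterates of \<open>e0\<close> under \<open>y\<close> and from
  \<open>x e0\<close>, with denominator 1; the coefficients come from Cramer's rule for the n-th
  iterate in the Krylov basis. This allows parameters to be compared by regular functions.\<close>

lemma regular_param_coordinate:
  assumes i: "i \<in> index_set"
  obtains N \<Delta> where "N \<in> regular_funs n" "\<Delta> \<in> regular_funs n"
    "\<forall>a\<in>param_domain. \<Delta> (param_x a, param_y a) \<noteq> 0 \<and>
      N (param_x a, param_y a) = \<Delta> (param_x a, param_y a) * a i"
proof -
  interpret function_algebra "regular_funs n :: ('k mat \<times> 'k mat \<Rightarrow> 'k) set" by (rule regular_funs_algebra)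
  define X where "X = (\<lambda>v :: 'k mat \<times> 'k mat. mat n n (\<lambda>ij. mat_pair_coords n v (Inl ij)))"
  define Y where "Y = (\<lambda>v :: 'k mat \<times> 'k mat. mat n n (\<lambda>ij. mat_pair_coords n v (Inr ij)))"
  have X: "X v \<in> carrier_mat n n" and Y: "Y v \<in> carrier_mat n n" for v unfolding X_def Y_def by simp_all
  have RX: "(\<lambda>v. X v $$ (i, j)) \<in> regular_funs n" if "i < n" "j < n" for i j
    using regular_entry(1)[OF that] that by (simp add: X_def)
  have RY: "(\<lambda>v. Y v $$ (i, j)) \<in> regular_funs n" if "i < n" "j < n" for i j
    using regular_entry(2)[OF that] that by (simp add: Y_def)
  have Xp: "X (param_x a, param_y a) = param_x a" for a
    by (rule eq_matI) (use carrier_matD[OF param_xy_carrier(2), of a] in \<open>auto simp: X_def mat_pair_coords_def\<close>)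
  have Yp: "Y (param_x a, param_y a) = param_y a" for a
    by (rule eq_matI) (use carrier_matD[OF param_xy_carrier(1), of a] in \<open>auto simp: Y_def mat_pair_coords_def\<close>)
  have det: "det (basis_mat a) \<noteq> 0" if "a \<in> param_domain" for a using that unfolding param_domain_def by simp
  have RYe: "(\<lambda>v. (Y v ^\<^sub>m k *\<^sub>v e0) $ j) \<in> regular_funs n" if "j < n" for j k
    by (rule pow_mult_vec_R[OF Y e0_carrier RY const_R that])
  consider k j where "k < n" "j < n" "0 < j" "i = Inl (k, j)" | k where "k < n" "i = Inl (k, 0)"
    | l where "l < n div d" "i = Inr l"
    using i unfolding index_set_def by (auto simp: neq0_conv)
  then show ?thesis
  proof cases
    case 1
    let ?N = "\<lambda>v. (Y v ^\<^sub>m j *\<^sub>v e0) $ k"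
    have "?N (param_x a, param_y a) = a i" if "a \<in> param_domain" for a
      unfolding Yp param_y_pow_e0[OF det[OF that] 1(2)] using 1 by (simp add: basis_mat_def)
    then show ?thesis by (intro that[OF RYe[OF 1(1), of j] const_R[of 1]]) simp
  next
    case 2
    let ?N = "\<lambda>v. (X v *\<^sub>v e0) $ k"
    have R: "?N \<in> regular_funs n"
      by (rule mult_vec_R[OF X e0_carrier RX[OF 2(1)] const_R 2(1)])
    have "?N (param_x a, param_y a) = a i" if "a \<in> param_domain" for a
    proof -
      have "param_x a *\<^sub>v e0 = param_w a"
        using param_x_pow_e0[OF det[OF that] n_pos] carrier_matD[OF param_xy_carrier(1), of a] by simp
      then show ?thesis unfolding Xp using 2 by (simp add: param_w_def)
    qed
    then show ?thesis by (intro that[OF R const_R[of 1]]) simp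
  next
    case 3
    have dl: "d * l < n" by (rule block_less[OF 3(1)])
    let ?M = "\<lambda>v. replace_col (krylov n (Y v) e0) (Y v ^\<^sub>m n *\<^sub>v e0) (d * l)"
    let ?N = "\<lambda>v. det (?M v)" and ?D = "\<lambda>v. det (krylov n (Y v) e0)"
    have kry: "(\<lambda>v. krylov n (Y v) e0 $$ (r, s)) \<in> regular_funs n" if "r < n" "s < n" for r s
      using RYe[OF that(1), of s] that by (simp add: krylov_def)
    have RD: "?D \<in> regular_funs n" by (rule det_R[OF krylov_carrier kry])
    have RN: "?N \<in> regular_funs n"
    proof (rule det_R[of _ n])
      show "?M v \<in> carrier_mat n n" for v by (simp add: replace_col_def krylov_def)
      fix r s assume rs: "r < n" "s < n"
      show "(\<lambda>v. ?M v $$ (r, s)) \<in> regular_funs n"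
      proof (cases "s = d * l")
        case True
        then have "(\<lambda>v. ?M v $$ (r, s)) = (\<lambda>v. (Y v ^\<^sub>m n *\<^sub>v e0) $ r)"
          using rs by (simp add: replace_col_def krylov_def del: index_mult_mat_vec)
        then show ?thesis using RYe[OF rs(1)] by simp
      next
        case False
        then have "(\<lambda>v. ?M v $$ (r, s)) = (\<lambda>v. krylov n (Y v) e0 $$ (r, s))"
          using rs by (simp add: replace_col_def krylov_def del: index_mult_mat_vec)
        then show ?thesis using kry[OF rs] by simp
      qed
    qed
    have "?D (param_x a, param_y a) \<noteq> 0 \<and> ?N (param_x a, param_y a) = ?D (param_x a, param_y a) * a i"
      if a: "a \<in> param_domain" for a
    proof -
      let ?H = "basis_mat a"
      define c where "c = vec n (\<lambda>k. if d dvd k then a (Inr (k div d)) else 0)"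
      have c: "c \<in> carrier_vec n" unfolding c_def by simp
      have "param_y a ^\<^sub>m n *\<^sub>v e0 = ?H *\<^sub>v c"
      proof (rule eq_vec_carrierI[OF pow_mult_vec_carrier[OF param_xy_carrier(1) e0_carrier]
            mult_mat_vec_carrier[OF param_carrier(1) c]])
        fix r assume r: "r < n"
        have "(?H *\<^sub>v c) $ r = (\<Sum>k<n. c $ k * (param_y a ^\<^sub>m k *\<^sub>v e0) $ r)"
          using krylov_mult_vec[OF c r, of "param_y a" e0] unfolding param_krylov[OF det[OF a]] .
        also have "\<dots> = (\<Sum>k<n. if d dvd k then a (Inr (k div d)) * (param_y a ^\<^sub>m k *\<^sub>v e0) $ r else 0)"
          by (intro sum.cong refl) (simp add: c_def del: index_mult_mat_vec)
        also have "\<dots> = (\<Sum>l<n div d. a (Inr (d * l div d)) * (param_y a ^\<^sub>m (d * l) *\<^sub>v e0) $ r)"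
          by (rule sum_multiples)
        also have "\<dots> = (param_y a ^\<^sub>m n *\<^sub>v e0) $ r"
          using param_y_pow_n[OF det[OF a] r] d_pos by (simp del: index_mult_mat_vec)
        finally show "(param_y a ^\<^sub>m n *\<^sub>v e0) $ r = (?H *\<^sub>v c) $ r" ..
      qed
      moreover have "det (replace_col ?H (?H *\<^sub>v c) (d * l)) = a (Inr l) * det ?H"
        using cramer_lemma_mat[OF param_carrier(1) c dl, of a] dl d_pos by (simp add: c_def)
      ultimately show ?thesis
        using det[OF a] unfolding Yp param_krylov[OF det[OF a]] 3(2) by simp
    qed
    then show ?thesis by (intro that[OF RN RD]) blast
  qed
qed

abbreviation variety_top :: "('k mat \<times> 'k mat) topology" where
  "variety_top \<equiv> subtopology (zariski_GL_pair n) pairs"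

abbreviation param :: "((nat \<times> nat) + nat \<Rightarrow> 'k) \<Rightarrow> 'k mat \<times> 'k mat" where
  "param a \<equiv> (param_x a, param_y a)"

sublocale zero_locus_topology variety_top "regular_funs n"
  by (rule zero_locus_topology_GL_pair(1)[OF pairs_subset_GL])

lemma topspace_variety: "topspace variety_top = pairs"
  by (rule zero_locus_topology_GL_pair(2)[OF pairs_subset_GL])

text \<open>The common point is taken on the line through \<open>a\<close> and \<open>b\<close>, so
  that coordinates on which they agree keep their values; this keeps it inside a slice.\<close>

lemma common_nonzero_param:
  assumes f: "f \<in> regular_funs n" "a \<in> param_domain" "f (param a) \<noteq> 0"
    and g: "g \<in> regular_funs n" "b \<in> param_domain" "g (param b) \<noteq> 0"
  shows "\<exists>t. line_point a b t \<in> param_domain \<and> f (param (line_point a b t)) \<noteq> 0 \<and>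
    g (param (line_point a b t)) \<noteq> 0"
  using nonzero_on_line[where f = "\<lambda>a. f (param a)" and g = "\<lambda>a. g (param a)" and a = a and b = b,
      OF principal_open_param_domain ratfun_regular_param[OF f(1)] ratfun_regular_param[OF g(1)] f(2,3) g(2,3)] .

text \<open>By density both functions are nonzero somewhere on the parametrised pairs, and a line
  between two such parameters yields a common point.\<close>

lemma irreducible_variety: "irreducible_space variety_top"
proof -
  have "irreducible_space (subtopology variety_top pairs)"
    unfolding irreducible_iff[OF equalityD2[OF topspace_variety]]
  proof (intro conjI ballI impI)
    show "pairs \<noteq> {}" using param_domain_nonempty param_in_pairs by blast
    fix f g assume fg: "f \<in> regular_funs n" "g \<in> regular_funs n"
      and ne: "(\<exists>a\<in>pairs. f a \<noteq> 0) \<and> (\<exists>b\<in>pairs. g b \<noteq> 0)"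
    have ex: "\<exists>a\<in>param_domain. f (param a) \<noteq> 0"
      if f: "f \<in> regular_funs n" and ne: "\<exists>v\<in>pairs. f v \<noteq> 0" for f
    proof -
      from ne obtain x y where "(x, y) \<in> pairs" "f (x, y) \<noteq> 0" by auto
      then show ?thesis by (rule nonzero_on_params[OF f])
    qed
    from ex[OF fg(1) conjunct1[OF ne]] obtain a where a: "a \<in> param_domain" "f (param a) \<noteq> 0" by blast
    from ex[OF fg(2) conjunct2[OF ne]] obtain b where b: "b \<in> param_domain" "g (param b) \<noteq> 0" by blast
    obtain t where "line_point a b t \<in> param_domain"
      "f (param (line_point a b t)) \<noteq> 0" "g (param (line_point a b t)) \<noteq> 0"
      using common_nonzero_param[OF fg(1) a fg(2) b] by blast
    then show "\<exists>c\<in>pairs. f c \<noteq> 0 \<and> g c \<noteq> 0" using param_in_pairs by blast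
  qed
  then show ?thesis by (simp add: subtopology_subtopology)
qed

text \<open>A relation between the pulled back functions is a regular function that vanishes on all
  parametrised pairs, hence on \<open>pairs\<close> by density. Independence thus survives the
  pullback, where the monomial count bounds the length.\<close>

lemma alg_indep_length_le:
  assumes fs: "set fs \<subseteq> regular_funs n" and indep: "alg_indep_on pairs fs"
  shows "length fs \<le> card index_set"
proof (rule ccontr)
  assume long: "\<not> length fs \<le> card index_set"
  let ?hs = "map (\<lambda>f. f \<circ> param) fs"
  have "\<forall>h\<in>set ?hs. ratfun index_set param_domain h"
    using fs ratfun_regular_param by (auto simp: o_def)
  then have "\<not> alg_indep_on param_domain ?hs"
    using long by (intro ratfun_not_alg_indep[OF card_index_set(1)]) simp_all
  moreover have "alg_indep_on param_domain ?hs"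
    unfolding alg_indep_on_def
  proof (intro allI impI)
    fix M c
    let ?E = "exponents (length ?hs) M"
    let ?g = "\<lambda>v. \<Sum>es\<in>?E. c es * monomial_fun fs es v"
    assume z: "\<forall>a\<in>param_domain. (\<Sum>es\<in>?E. c es * monomial_fun ?hs es a) = 0"
    have g: "?g \<in> regular_funs n" by (intro sum_R mult_R const_R monomial_fun_R fs)
    have "?g v = 0" if v: "v \<in> pairs" for v
    proof (rule ccontr)
      assume nz: "?g v \<noteq> 0"
      obtain x y where xy: "v = (x, y)" by force
      have "\<exists>a\<in>param_domain. ?g (param a) \<noteq> 0"
        by (rule nonzero_on_params[OF g v[unfolded xy] nz[unfolded xy]])
      then show False using z by (simp add: monomial_fun_comp)
    qed
    then show "\<forall>es\<in>?E. c es = 0"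
      using indep[unfolded alg_indep_on_def, THEN spec[of _ M], THEN spec[of _ c]] by simp
  qed
  ultimately show False ..
qed

text \<open>With \<open>h\<close> an enumeration of the variables, the first \<open>k\<close> are
  free and the others are frozen at their values in \<open>b\<close>: the trace on the domain of a
  flag of affine coordinate subspaces through \<open>b\<close>.\<close>

definition param_slice :: "(nat \<Rightarrow> (nat \<times> nat) + nat) \<Rightarrow> ((nat \<times> nat) + nat \<Rightarrow> 'k) \<Rightarrow> nat \<Rightarrow>
    ((nat \<times> nat) + nat \<Rightarrow> 'k) set" where
  "param_slice h b k = {a \<in> param_domain. \<forall>j. k \<le> j \<and> j < card index_set \<longrightarrow> a (h j) = b (h j)}"

definition slice_closure :: "(nat \<Rightarrow> (nat \<times> nat) + nat) \<Rightarrow> ((nat \<times> nat) + nat \<Rightarrow> 'k) \<Rightarrow> nat \<Rightarrow>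
    ('k mat \<times> 'k mat) set" where
  "slice_closure h b k = {v \<in> topspace variety_top. \<forall>f\<in>regular_funs n.
     (\<forall>u\<in>param ` param_slice h b k. f u = 0) \<longrightarrow> f v = 0}"

lemma slice_closureD:
  assumes "v \<in> slice_closure h b k" "f \<in> regular_funs n" "\<forall>u\<in>param ` param_slice h b k. f u = 0"
  shows "f v = 0"
  using assms by (simp add: slice_closure_def)

lemma irreducible_slice_closure:
  assumes b: "b \<in> param_domain"
  shows "irreducible_space (subtopology variety_top (slice_closure h b k))"
  unfolding slice_closure_def
proof (rule irreducible_zero_closure)
  show "param ` param_slice h b k \<subseteq> topspace variety_top"
    unfolding topspace_variety using param_in_pairs by (auto simp: param_slice_def)
  have "b \<in> param_slice h b k" using b by (simp add: param_slice_def)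
  then show "param ` param_slice h b k \<noteq> {}" by blast
  fix f g u v assume fg: "f \<in> regular_funs n" "g \<in> regular_funs n"
    and u: "u \<in> param ` param_slice h b k" "f u \<noteq> 0" and v: "v \<in> param ` param_slice h b k" "g v \<noteq> 0"
  from u obtain a where a: "a \<in> param_slice h b k" "u = param a" by blast
  from v obtain a' where a': "a' \<in> param_slice h b k" "v = param a'" by blast
  have dom: "a \<in> param_domain" "a' \<in> param_domain" using a a' by (simp_all add: param_slice_def)
  obtain t where t: "line_point a a' t \<in> param_domain"
    "f (param (line_point a a' t)) \<noteq> 0" "g (param (line_point a a' t)) \<noteq> 0"
    using common_nonzero_param[OF fg(1) dom(1) u(2)[unfolded a(2)] fg(2) dom(2) v(2)[unfolded a'(2)]] by blast
  have "line_point a a' t \<in> param_slice h b k"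
    using t(1) a(1) a'(1) by (simp add: param_slice_def line_point_def)
  with t(2,3) show "\<exists>c\<in>param ` param_slice h b k. f c \<noteq> 0 \<and> g c \<noteq> 0"
    by (intro bexI[of _ "param (line_point a a' t)"]) simp_all
qed

text \<open>Freeing the variable \<open>h k\<close> produces a parameter \<open>a\<close> with a new
  value there. The regular function that is the denominator times (\<open>h k\<close>-th parameter
  minus \<open>b (h k)\<close>) vanishes on the smaller slice but not at \<open>a\<close>.\<close>

lemma slice_closure_strict:
  assumes b: "b \<in> param_domain" and h: "bij_betw h {..<card index_set} index_set" and k: "k < card index_set"
  shows "slice_closure h b k \<subset> slice_closure h b (Suc k)"
proof -
  have hk: "h k \<in> index_set" using h k by (auto simp: bij_betw_def)
  have sub: "param_slice h b k \<subseteq> param_slice h b (Suc k)" by (auto simp: param_slice_def)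
  have "slice_closure h b k \<subseteq> slice_closure h b (Suc k)"
  proof
    fix v assume v: "v \<in> slice_closure h b k"
    have "f v = 0" if f: "f \<in> regular_funs n" "\<forall>u\<in>param ` param_slice h b (Suc k). f u = 0" for f
    proof -
      have "\<forall>u\<in>param ` param_slice h b k. f u = 0" using f(2) sub by blast
      then show ?thesis by (rule slice_closureD[OF v f(1)])
    qed
    then show "v \<in> slice_closure h b (Suc k)" using v by (simp add: slice_closure_def)
  qed
  moreover have "slice_closure h b k \<noteq> slice_closure h b (Suc k)"
  proof -
    obtain D where D: "polyfun index_set D" "param_domain = {a. D a \<noteq> 0}"
      using principal_open_param_domain unfolding principal_open_def by blast
    \<comment> \<open>\<open>?b\<close> itself may lie outside the domain, so \<open>a\<close> is a
      general point of the line from \<open>b\<close> to \<open>?b\<close>; along it only the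
      variable \<open>h k\<close> changes.\<close>
    let ?b = "b(h k := b (h k) + 1)"
    have ratD: "ratfun index_set UNIV D" using D(1) by (rule ratfun_polyfun)
    have rat_coord: "ratfun index_set UNIV (\<lambda>a. a (h k) + - b (h k))"
      by (intro ratfun_add ratfun_var ratfun_const hk)
    have Db: "D b \<noteq> 0" using b D(2) by simp
    have one: "?b (h k) + - b (h k) \<noteq> 0" by simp
    obtain t where t: "D (line_point b ?b t) \<noteq> 0" "line_point b ?b t (h k) + - b (h k) \<noteq> 0"
      using nonzero_on_line[where a = b and b = ?b, OF principal_open_UNIV ratD rat_coord UNIV_I Db UNIV_I one]
      by blast
    define a where "a = line_point b ?b t"
    have a: "a \<in> param_domain" "a (h k) \<noteq> b (h k)" using t D(2) unfolding a_def by auto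
    have "a (h j) = b (h j)" if "Suc k \<le> j" "j < card index_set" for j
    proof -
      have "h j \<noteq> h k" using inj_on_eq_iff[OF bij_betw_imp_inj_on[OF h], of j k] k that by simp
      then show ?thesis unfolding a_def line_point_def by simp
    qed
    then have a_slice: "a \<in> param_slice h b (Suc k)" using a(1) by (simp add: param_slice_def)
    then have in_Suc: "param a \<in> slice_closure h b (Suc k)"
      using param_in_pairs[OF a(1)] unfolding slice_closure_def topspace_variety by blast
    obtain N \<Delta> where N: "N \<in> regular_funs n" "\<Delta> \<in> regular_funs n"
      "\<forall>a\<in>param_domain. \<Delta> (param a) \<noteq> 0 \<and> N (param a) = \<Delta> (param a) * a (h k)"
      by (rule regular_param_coordinate[OF hk])
    let ?f = "\<lambda>v. N v + - b (h k) * \<Delta> v"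
    have f: "?f \<in> regular_funs n" by (intro add_R mult_R const_R N(1,2))
    have f_param: "?f (param a) = \<Delta> (param a) * (a (h k) - b (h k))" if "a \<in> param_domain" for a
      using bspec[OF N(3) that] by (simp add: algebra_simps)
    have vanish: "\<forall>u\<in>param ` param_slice h b k. ?f u = 0"
    proof
      fix u assume "u \<in> param ` param_slice h b k"
      then obtain a' where a': "a' \<in> param_slice h b k" "u = param a'" by blast
      then have "a' \<in> param_domain" "a' (h k) = b (h k)" using k by (simp_all add: param_slice_def)
      then show "?f u = 0" unfolding a'(2) using f_param[of a'] by simp
    qed
    have nz: "?f (param a) \<noteq> 0" using f_param[OF a(1)] bspec[OF N(3) a(1)] a(2) by simp
    have "param a \<notin> slice_closure h b k"
    proof
      assume "param a \<in> slice_closure h b k"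
      from slice_closureD[OF this f vanish] nz show False by (rule notE[rotated])
    qed
    with in_Suc show ?thesis by blast
  qed
  ultimately show ?thesis by blast
qed

lemma krull_dim_variety: "krull_dim variety_top = enat (n\<^sup>2 + n div d)"
proof -
  obtain b where b: "b \<in> param_domain" using param_domain_nonempty by blast
  obtain h where h: "bij_betw h {..<card index_set} index_set"
    using ex_bij_betw_nat_finite[OF card_index_set(1)] unfolding atLeast0LessThan by blast
  have "krull_dim variety_top = enat (card index_set)"
  proof (rule krull_dim_eqI[where Z = "slice_closure h b"])
    show "length fs \<le> card index_set" if "set fs \<subseteq> regular_funs n" "alg_indep_on (topspace variety_top) fs" for fs
      using that unfolding topspace_variety by (rule alg_indep_length_le)
    show "closedin variety_top (slice_closure h b i) \<and>
        irreducible_space (subtopology variety_top (slice_closure h b i))" for i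
      using irreducible_slice_closure[OF b] closedin_zero_closure unfolding slice_closure_def by blast
    show "slice_closure h b i \<subset> slice_closure h b (Suc i)" if "i < card index_set" for i
      by (rule slice_closure_strict[OF b h that])
  qed
  then show ?thesis unfolding card_index_set(2) .
qed

end

theorem theoremC:
  fixes \<zeta> :: "'k::alg_closed_field" and n d :: nat
  assumes "n > 0" and "d > 0" and "d dvd n"
    and "\<zeta> \<noteq> 0"
    and "\<zeta> ^ d = 1" and "\<And>e. 0 < e \<Longrightarrow> e < d \<Longrightarrow> \<zeta> ^ e \<noteq> 1"
  shows "irreducible_space (subtopology (zariski_GL_pair n) (commutator_variety n \<zeta>)) \<and>
    krull_dim (subtopology (zariski_GL_pair n) (commutator_variety n \<zeta>)) = enat (n\<^sup>2 + n div d)"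
proof -
  interpret root_of_unity_pairs n d \<zeta>
    by unfold_locales (fact assms)+
  show ?thesis
    unfolding commutator_variety_eq using irreducible_variety krull_dim_variety by blast
qed

end
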